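(* Let $\mathcal{C},\mathcal{D}$ be triangulated categories and let $S : \mathcal{C} \to \mathcal{D}$ be a spherical functor with right adjoint functor $R : \mathcal{D}\to\mathcal{C}$, twist functor $T_S$ and cotwist functor $C_S$. Assume that the essential image of $R$ contains a split-generator of $\mathcal{C}$. Then $$h_t(T_S) = h_t(C_S[2])$$ for all $t \in \mathbb{R}$ such that $h_t(C_S[2]) \geq 0$. In particular, $h_0(T_S) = h_0(C_S[2])$.
   Context: Standing assumptions: all triangulated categories are linear over a field $\mathbb{K}$, admit a dg enhancement (i.e. are equivalent, as triangulated categories, to $H^0(\mathcal{A})$ for a pretriangulated dg category $\mathcal{A}$), and all exact functors between them admit dg lifts; cones of natural transformations are formed functorially via these. A triangulated category is assumed to have a split-generator whenever the categorical entropy of one of its endofunctors is considered. Split-generator: an object $G$ of a triangulated category $\mathcal{D}$ such that the smallest full triangulated subcategory containing $G$ and closed under taking direct summands is $\mathcal{D}$. Categorical complexity: for objects $E,F$ of $\mathcal{D}$ and $t \in \mathbb{R}$, $\delta_t(E,F)=0$ if $F\cong 0$; otherwise $\delta_t(E,F) \in [0,\infty]$ is the infimum of $\sum_{i=1}^k e^{n_i t}$ over all sequences of integers $(n_1,\dots,n_k)$ for which there exist an object $F'$ and objects $0=A_0,A_1,\dots,A_k = F\oplus F'$ with exact triangles $A_{i-1}\to A_i \to E[n_i] \to A_{i-1}[1]$ for $i=1,\dots,k$. Categorical entropy of an exact endofunctor $\Phi$ of $\mathcal{D}$: $h_t(\Phi) = \lim_{n\to\infty}\frac1n\log\delta_t(G,\Phi^nG)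 \in [-\infty,\infty)$ for a split-generator $G$ (the limit exists and is independent of $G$). Spherical functor: an exact functor $S:\mathcal{C}\to\mathcal{D}$ with right and left adjoints $R,L$ such that (1) the twist functor $T_S=\mathrm{Cone}(SR\xrightarrow{\varepsilon}\mathrm{Id}_\mathcal{D})$ ($\varepsilon$ the counit of $S\dashv R$) is an exact autoequivalence of $\mathcal{D}$; (2) the cotwist functor $C_S=\mathrm{Cone}(\mathrm{Id}_\mathcal{C}\xrightarrow{\eta}RS)[-1]$ ($\eta$ the unit of $S\dashv R$) is an exact autoequivalence of $\mathcal{C}$; (3) $R\cong LT_S[-1]$; (4) $R\cong C_SL[1]$. Here $C_S[2]$ is the composition of $C_S$ with the shift $[2]$.
   Formalization: The final claim h_0(T_S) = h_0(C_S[2]) is proved for nonzero C only; for C = 0 and D nonzero it fails, since T_S = Id gives h_0(T_S) = 0 while h_0(C_S[2]) = -∞ by the convention δ_t(E,0) = 0. *)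

theory Defs
  imports "HOL-Algebra.Module" "HOL-Algebra.AbelCoset" "HOL-Library.Extended_Real"
begin

section \<open>Linear categories and functors\<close>

definition linear_map ::
  "'k ring \<Rightarrow> ('k, 'a) module \<Rightarrow> ('k, 'b) module \<Rightarrow> ('a \<Rightarrow> 'b) \<Rightarrow> bool" where
  "linear_map K M N f \<longleftrightarrow>
     f \<in> carrier M \<rightarrow> carrier N \<and>
     (\<forall>x\<in>carrier M. \<forall>y\<in>carrier M. f (x \<oplus>\<^bsub>M\<^esub> y) = f x \<oplus>\<^bsub>N\<^esub> f y) \<and>
     (\<forall>a\<in>carrier K. \<forall>x\<in>carrier M. f (a \<odot>\<^bsub>M\<^esub> x) = a \<odot>\<^bsub>N\<^esub> f x)"

definition bilinear_map ::
  "'k ring \<Rightarrow> ('k, 'a) module \<Rightarrow> ('k, 'b) module \<Rightarrow> ('k, 'c) module \<Rightarrow> ('a \<Rightarrow> 'b \<Rightarrow> 'c) \<Rightarrow> bool" where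
  "bilinear_map K M N P f \<longleftrightarrow>
     (\<forall>x\<in>carrier M. linear_map K N P (f x)) \<and>
     (\<forall>y\<in>carrier N. linear_map K M P (\<lambda>x. f x y))"

text \<open>The morphism spaces of different pairs of objects need not be disjoint; therefore
  all operations on morphisms take the objects as arguments. For \<open>f : X \<rightarrow> Y\<close> and
  \<open>g : Y \<rightarrow> Z\<close>, the composite \<open>g \<circ> f\<close> is \<open>Comp C X Y Z g f\<close>. The multiplicative fields
  of the records \<open>Hom C X Y\<close> are never used.\<close>

record ('k, 'o, 'm) lin_cat =
  Obj :: "'o set"
  Hom :: "'o \<Rightarrow> 'o \<Rightarrow> ('k, 'm) module"
  Comp :: "'o \<Rightarrow> 'o \<Rightarrow> 'o \<Rightarrow> 'm \<Rightarrow> 'm \<Rightarrow> 'm"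
  Idm :: "'o \<Rightarrow> 'm"

abbreviation mor :: "('k, 'o, 'm, 'z) lin_cat_scheme \<Rightarrow> 'o \<Rightarrow> 'o \<Rightarrow> 'm set" where
  "mor C X Y \<equiv> carrier (Hom C X Y)"

locale linear_category =
  fixes K :: "'k ring" and C :: "('k, 'o, 'm, 'z) lin_cat_scheme"
  assumes field_K: "Ring.field K"
    and Hom_module: "\<lbrakk>X \<in> Obj C; Y \<in> Obj C\<rbrakk> \<Longrightarrow> Module.module K (Hom C X Y)"
    and Comp_bilinear: "\<lbrakk>X \<in> Obj C; Y \<in> Obj C; Z \<in> Obj C\<rbrakk> \<Longrightarrow>
      bilinear_map K (Hom C Y Z) (Hom C X Y) (Hom C X Z) (Comp C X Y Z)"
    and Comp_assoc: "\<lbrakk>W \<in> Obj C; X \<in> Obj C; Y \<in> Obj C; Z \<in> Obj C;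
      f \<in> mor C W X; g \<in> mor C X Y; h \<in> mor C Y Z\<rbrakk> \<Longrightarrow>
      Comp C W X Z (Comp C X Y Z h g) f = Comp C W Y Z h (Comp C W X Y g f)"
    and Idm_closed: "X \<in> Obj C \<Longrightarrow> Idm C X \<in> mor C X X"
    and Idm_right: "\<lbrakk>X \<in> Obj C; Y \<in> Obj C; f \<in> mor C X Y\<rbrakk> \<Longrightarrow> Comp C X X Y f (Idm C X) = f"
    and Idm_left: "\<lbrakk>X \<in> Obj C; Y \<in> Obj C; f \<in> mor C X Y\<rbrakk> \<Longrightarrow> Comp C X Y Y (Idm C Y) f = f"

definition is_iso :: "('k, 'o, 'm, 'z) lin_cat_scheme \<Rightarrow> 'o \<Rightarrow> 'o \<Rightarrow> 'm \<Rightarrow> bool" where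
  "is_iso C X Y f \<longleftrightarrow> f \<in> mor C X Y \<and>
     (\<exists>g\<in>mor C Y X. Comp C X Y X g f = Idm C X \<and> Comp C Y X Y f g = Idm C Y)"

definition isomorphic :: "('k, 'o, 'm, 'z) lin_cat_scheme \<Rightarrow> 'o \<Rightarrow> 'o \<Rightarrow> bool" where
  "isomorphic C X Y \<longleftrightarrow> X \<in> Obj C \<and> Y \<in> Obj C \<and> (\<exists>f. is_iso C X Y f)"

definition is_zero_obj :: "('k, 'o, 'm, 'z) lin_cat_scheme \<Rightarrow> 'o \<Rightarrow> bool" where
  "is_zero_obj C Z \<longleftrightarrow> Z \<in> Obj C \<and>
     (\<forall>X\<in>Obj C. (\<exists>!f. f \<in> mor C X Z) \<and> (\<exists>!f. f \<in> mor C Z X))"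

definition is_biproduct :: "('k, 'o, 'm, 'z) lin_cat_scheme \<Rightarrow> 'o \<Rightarrow> 'o \<Rightarrow> 'o \<Rightarrow> bool" where
  "is_biproduct C X Y B \<longleftrightarrow> X \<in> Obj C \<and> Y \<in> Obj C \<and> B \<in> Obj C \<and>
     (\<exists>i\<in>mor C X B. \<exists>j\<in>mor C Y B. \<exists>p\<in>mor C B X. \<exists>q\<in>mor C B Y.
        Comp C X B X p i = Idm C X \<and> Comp C Y B Y q j = Idm C Y \<and>
        Comp C Y B X p j = \<zero>\<^bsub>Hom C Y X\<^esub> \<and> Comp C X B Y q i = \<zero>\<^bsub>Hom C X Y\<^esub> \<and>
        Comp C B X B i p \<oplus>\<^bsub>Hom C B B\<^esub> Comp C B Y B j q = Idm C B)"

text \<open>\<open>fmor F X Y\<close> is the action of a functor on the morphisms \<open>X \<rightarrow> Y\<close>.\<close>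

record ('o, 'm, 'p, 'n) func =
  fob :: "'o \<Rightarrow> 'p"
  fmor :: "'o \<Rightarrow> 'o \<Rightarrow> 'm \<Rightarrow> 'n"

definition fid :: "('o, 'm, 'o, 'm) func" where
  "fid = \<lparr>fob = (\<lambda>X. X), fmor = (\<lambda>X Y f. f)\<rparr>"

definition fcomp ::
  "('p, 'n, 'q, 'l) func \<Rightarrow> ('o, 'm, 'p, 'n) func \<Rightarrow> ('o, 'm, 'q, 'l) func" (infixr \<open>\<circ>\<circ>\<close> 70) where
  "G \<circ>\<circ> F = \<lparr>fob = (\<lambda>X. fob G (fob F X)),
             fmor = (\<lambda>X Y f. fmor G (fob F X) (fob F Y) (fmor F X Y f))\<rparr>"

primrec fpow :: "('o, 'm, 'o, 'm) func \<Rightarrow> nat \<Rightarrow> ('o, 'm, 'o, 'm) func" where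
  "fpow F 0 = fid"
| "fpow F (Suc n) = F \<circ>\<circ> fpow F n"

definition linear_functor ::
  "'k ring \<Rightarrow> ('k, 'o, 'm, 'z) lin_cat_scheme \<Rightarrow> ('k, 'p, 'n, 'y) lin_cat_scheme \<Rightarrow>
   ('o, 'm, 'p, 'n) func \<Rightarrow> bool" where
  "linear_functor K C D F \<longleftrightarrow>
     (\<forall>X\<in>Obj C. fob F X \<in> Obj D) \<and>
     (\<forall>X\<in>Obj C. \<forall>Y\<in>Obj C. linear_map K (Hom C X Y) (Hom D (fob F X) (fob F Y)) (fmor F X Y)) \<and>
     (\<forall>X\<in>Obj C. fmor F X X (Idm C X) = Idm D (fob F X)) \<and>
     (\<forall>X\<in>Obj C. \<forall>Y\<in>Obj C. \<forall>Z\<in>Obj C. \<forall>f\<in>mor C X Y. \<forall>g\<in>mor C Y Z.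
        fmor F X Z (Comp C X Y Z g f) =
        Comp D (fob F X) (fob F Y) (fob F Z) (fmor F Y Z g) (fmor F X Y f))"

definition nat_trans ::
  "('k, 'o, 'm, 'z) lin_cat_scheme \<Rightarrow> ('k, 'p, 'n, 'y) lin_cat_scheme \<Rightarrow>
   ('o, 'm, 'p, 'n) func \<Rightarrow> ('o, 'm, 'p, 'n) func \<Rightarrow> ('o \<Rightarrow> 'n) \<Rightarrow> bool" where
  "nat_trans C D F G \<alpha> \<longleftrightarrow>
     (\<forall>X\<in>Obj C. \<alpha> X \<in> mor D (fob F X) (fob G X)) \<and>
     (\<forall>X\<in>Obj C. \<forall>Y\<in>Obj C. \<forall>f\<in>mor C X Y.
        Comp D (fob F X) (fob F Y) (fob G Y) (\<alpha> Y) (fmor F X Y f) =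
        Comp D (fob F X) (fob G X) (fob G Y) (fmor G X Y f) (\<alpha> X))"

definition nat_iso ::
  "('k, 'o, 'm, 'z) lin_cat_scheme \<Rightarrow> ('k, 'p, 'n, 'y) lin_cat_scheme \<Rightarrow>
   ('o, 'm, 'p, 'n) func \<Rightarrow> ('o, 'm, 'p, 'n) func \<Rightarrow> ('o \<Rightarrow> 'n) \<Rightarrow> bool" where
  "nat_iso C D F G \<alpha> \<longleftrightarrow> nat_trans C D F G \<alpha> \<and> (\<forall>X\<in>Obj C. is_iso D (fob F X) (fob G X) (\<alpha> X))"

definition nat_isomorphic ::
  "('k, 'o, 'm, 'z) lin_cat_scheme \<Rightarrow> ('k, 'p, 'n, 'y) lin_cat_scheme \<Rightarrow>
   ('o, 'm, 'p, 'n) func \<Rightarrow> ('o, 'm, 'p, 'n) func \<Rightarrow> bool" where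
  "nat_isomorphic C D F G \<longleftrightarrow> (\<exists>\<alpha>. nat_iso C D F G \<alpha>)"

definition equivalence_functor ::
  "'k ring \<Rightarrow> ('k, 'o, 'm, 'z) lin_cat_scheme \<Rightarrow> ('k, 'p, 'n, 'y) lin_cat_scheme \<Rightarrow>
   ('o, 'm, 'p, 'n) func \<Rightarrow> bool" where
  "equivalence_functor K C D F \<longleftrightarrow> linear_functor K C D F \<and>
     (\<forall>X\<in>Obj C. \<forall>Y\<in>Obj C. bij_betw (fmor F X Y) (mor C X Y) (mor D (fob F X) (fob F Y))) \<and>
     (\<forall>Y\<in>Obj D. \<exists>X\<in>Obj C. isomorphic D (fob F X) Y)"

text \<open>\<open>F \<stileturn> G\<close> for \<open>F : C \<rightarrow> D\<close>, with unit \<open>\<eta>\<close> and counit \<open>\<epsilon>\<close>.\<close>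

definition adjunction ::
  "('k, 'o, 'm, 'z) lin_cat_scheme \<Rightarrow> ('k, 'p, 'n, 'y) lin_cat_scheme \<Rightarrow>
   ('o, 'm, 'p, 'n) func \<Rightarrow> ('p, 'n, 'o, 'm) func \<Rightarrow> ('o \<Rightarrow> 'm) \<Rightarrow> ('p \<Rightarrow> 'n) \<Rightarrow> bool" where
  "adjunction C D F G \<eta> \<epsilon> \<longleftrightarrow>
     nat_trans C C fid (G \<circ>\<circ> F) \<eta> \<and> nat_trans D D (F \<circ>\<circ> G) fid \<epsilon> \<and>
     (\<forall>X\<in>Obj C. Comp D (fob F X) (fob F (fob G (fob F X))) (fob F X)
        (\<epsilon> (fob F X)) (fmor F X (fob G (fob F X)) (\<eta> X)) = Idm D (fob F X)) \<and>
     (\<forall>Y\<in>Obj D. Comp C (fob G Y) (fob G (fob F (fob G Y))) (fob G Y)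
        (fmor G (fob F (fob G Y)) Y (\<epsilon> Y)) (\<eta> (fob G Y)) = Idm C (fob G Y))"

section \<open>Triangulated categories\<close>

text \<open>The shift is an autoequivalence with a chosen quasi-inverse \<open>Unshift\<close>.
  An element \<open>(X, Y, Z, f, g, h)\<close> of \<open>Tri\<close> is an exact triangle
  \<open>X \<rightarrow> Y \<rightarrow> Z \<rightarrow> X[1]\<close> with morphisms \<open>f, g, h\<close>.\<close>

type_synonym ('o, 'm) triangle = "'o \<times> 'o \<times> 'o \<times> 'm \<times> 'm \<times> 'm"

record ('k, 'o, 'm) tri_cat = "('k, 'o, 'm) lin_cat" +
  Shift :: "('o, 'm, 'o, 'm) func"
  Unshift :: "('o, 'm, 'o, 'm) func"
  Tri :: "('o, 'm) triangle set"

definition shift_pow :: "('k, 'o, 'm, 'z) tri_cat_scheme \<Rightarrow> int \<Rightarrow> ('o, 'm, 'o, 'm) func" where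
  "shift_pow D n = (if n \<ge> 0 then fpow (Shift D) (nat n) else fpow (Unshift D) (nat (- n)))"

definition is_triangle ::
  "('k, 'o, 'm, 'z) lin_cat_scheme \<Rightarrow> ('o, 'm, 'o, 'm) func \<Rightarrow> ('o, 'm) triangle \<Rightarrow> bool" where
  "is_triangle C \<Sigma> = (\<lambda>(X, Y, Z, f, g, h).
     X \<in> Obj C \<and> Y \<in> Obj C \<and> Z \<in> Obj C \<and>
     f \<in> mor C X Y \<and> g \<in> mor C Y Z \<and> h \<in> mor C Z (fob \<Sigma> X))"

definition isomorphic_triangles ::
  "('k, 'o, 'm, 'z) lin_cat_scheme \<Rightarrow> ('o, 'm, 'o, 'm) func \<Rightarrow>
   ('o, 'm) triangle \<Rightarrow> ('o, 'm) triangle \<Rightarrow> bool" where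
  "isomorphic_triangles C \<Sigma> = (\<lambda>(X, Y, Z, f, g, h) (X', Y', Z', f', g', h').
     is_triangle C \<Sigma> (X, Y, Z, f, g, h) \<and> is_triangle C \<Sigma> (X', Y', Z', f', g', h') \<and>
     (\<exists>a b c. is_iso C X X' a \<and> is_iso C Y Y' b \<and> is_iso C Z Z' c \<and>
        Comp C X Y Y' b f = Comp C X X' Y' f' a \<and>
        Comp C Y Z Z' c g = Comp C Y Y' Z' g' b \<and>
        Comp C Z (fob \<Sigma> X) (fob \<Sigma> X') (fmor \<Sigma> X X' a) h = Comp C Z Z' (fob \<Sigma> X') h' c))"

locale triangulated_category = linear_category K C
  for K :: "'k ring" and C :: "('k, 'o, 'm) tri_cat" +
  assumes zero_obj: "\<exists>Z. is_zero_obj C Z"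
    and biproducts: "\<lbrakk>X \<in> Obj C; Y \<in> Obj C\<rbrakk> \<Longrightarrow> \<exists>B. is_biproduct C X Y B"
    and Shift_functor: "linear_functor K C C (Shift C)"
    and Unshift_functor: "linear_functor K C C (Unshift C)"
    and Shift_Unshift: "nat_isomorphic C C (Shift C \<circ>\<circ> Unshift C) fid"
    and Unshift_Shift: "nat_isomorphic C C (Unshift C \<circ>\<circ> Shift C) fid"
    and Tri_is_triangle: "\<tau> \<in> Tri C \<Longrightarrow> is_triangle C (Shift C) \<tau>"
    and TR1_iso: "\<lbrakk>\<tau> \<in> Tri C; isomorphic_triangles C (Shift C) \<tau> \<tau>'\<rbrakk> \<Longrightarrow> \<tau>' \<in> Tri C"
    and TR1_id: "\<lbrakk>X \<in> Obj C; is_zero_obj C Z\<rbrakk> \<Longrightarrow>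
      (X, X, Z, Idm C X, \<zero>\<^bsub>Hom C X Z\<^esub>, \<zero>\<^bsub>Hom C Z (fob (Shift C) X)\<^esub>) \<in> Tri C"
    and TR1_cone: "\<lbrakk>X \<in> Obj C; Y \<in> Obj C; f \<in> mor C X Y\<rbrakk> \<Longrightarrow>
      \<exists>Z g h. (X, Y, Z, f, g, h) \<in> Tri C"
    and TR2: "is_triangle C (Shift C) (X, Y, Z, f, g, h) \<Longrightarrow>
      (X, Y, Z, f, g, h) \<in> Tri C \<longleftrightarrow>
      (Y, Z, fob (Shift C) X, g, h,
        \<ominus>\<^bsub>Hom C (fob (Shift C) X) (fob (Shift C) Y)\<^esub> fmor (Shift C) X Y f) \<in> Tri C"
    and TR3: "\<lbrakk>(X, Y, Z, f, g, h) \<in> Tri C; (X', Y', Z', f', g', h') \<in> Tri C;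
      a \<in> mor C X X'; b \<in> mor C Y Y'; Comp C X Y Y' b f = Comp C X X' Y' f' a\<rbrakk> \<Longrightarrow>
      \<exists>c\<in>mor C Z Z'. Comp C Y Z Z' c g = Comp C Y Y' Z' g' b \<and>
        Comp C Z (fob (Shift C) X) (fob (Shift C) X') (fmor (Shift C) X X' a) h
          = Comp C Z Z' (fob (Shift C) X') h' c"
    and TR4: "\<lbrakk>(X, Y, Z', f, i, i') \<in> Tri C; (Y, Z, X', g, j, j') \<in> Tri C;
      (X, Z, Y', Comp C X Y Z g f, k, k') \<in> Tri C\<rbrakk> \<Longrightarrow>
      \<exists>u v. (Z', Y', X', u, v,
          Comp C X' (fob (Shift C) Y) (fob (Shift C) Z') (fmor (Shift C) Y Z' i) j') \<in> Tri C \<and>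
        Comp C Y Z' Y' u i = Comp C Y Z Y' k g \<and>
        Comp C Z' Y' (fob (Shift C) X) k' u = i' \<and>
        Comp C Z Y' X' v k = j \<and>
        Comp C Y' X' (fob (Shift C) Y) j' v
          = Comp C Y' (fob (Shift C) X) (fob (Shift C) Y) (fmor (Shift C) X Y f) k'"

text \<open>The image of a triangle under a functor \<open>F\<close> with a comparison \<open>\<phi> : F \<circ> [1] \<rightarrow> [1] \<circ> F\<close>.\<close>

definition map_triangle ::
  "('k, 'o, 'm) tri_cat \<Rightarrow> ('k, 'p, 'n) tri_cat \<Rightarrow> ('o, 'm, 'p, 'n) func \<Rightarrow> ('o \<Rightarrow> 'n) \<Rightarrow>
   ('o, 'm) triangle \<Rightarrow> ('p, 'n) triangle" where
  "map_triangle C D F \<phi> = (\<lambda>(X, Y, Z, f, g, h).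
     (fob F X, fob F Y, fob F Z, fmor F X Y f, fmor F Y Z g,
      Comp D (fob F Z) (fob F (fob (Shift C) X)) (fob (Shift D) (fob F X))
        (\<phi> X) (fmor F Z (fob (Shift C) X) h)))"

definition exact_functor ::
  "'k ring \<Rightarrow> ('k, 'o, 'm) tri_cat \<Rightarrow> ('k, 'p, 'n) tri_cat \<Rightarrow> ('o, 'm, 'p, 'n) func \<Rightarrow> bool" where
  "exact_functor K C D F \<longleftrightarrow> linear_functor K C D F \<and>
     (\<exists>\<phi>. nat_iso C D (F \<circ>\<circ> Shift C) (Shift D \<circ>\<circ> F) \<phi> \<and>
          (\<forall>\<tau>\<in>Tri C. map_triangle C D F \<phi> \<tau> \<in> Tri D))"

definition exact_autoequivalence ::
  "'k ring \<Rightarrow> ('k, 'o, 'm) tri_cat \<Rightarrow> ('o, 'm, 'o, 'm) func \<Rightarrow> bool" where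
  "exact_autoequivalence K D F \<longleftrightarrow> exact_functor K D D F \<and> equivalence_functor K D D F"

definition triangulated_equivalence ::
  "'k ring \<Rightarrow> ('k, 'o, 'm) tri_cat \<Rightarrow> ('k, 'p, 'n) tri_cat \<Rightarrow> ('o, 'm, 'p, 'n) func \<Rightarrow> bool" where
  "triangulated_equivalence K C D F \<longleftrightarrow> equivalence_functor K C D F \<and>
     (\<exists>\<phi>. nat_iso C D (F \<circ>\<circ> Shift C) (Shift D \<circ>\<circ> F) \<phi> \<and>
          (\<forall>\<tau>. is_triangle C (Shift C) \<tau> \<longrightarrow>
             (\<tau> \<in> Tri C \<longleftrightarrow> map_triangle C D F \<phi> \<tau> \<in> Tri D)))"

section \<open>Split-generators, complexity and entropy\<close>

definition full_triangulated_subcategory :: "('k, 'o, 'm) tri_cat \<Rightarrow> 'o set \<Rightarrow> bool" where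
  "full_triangulated_subcategory D P \<longleftrightarrow> P \<subseteq> Obj D \<and> P \<noteq> {} \<and>
     (\<forall>X\<in>P. fob (Shift D) X \<in> P \<and> fob (Unshift D) X \<in> P) \<and>
     (\<forall>X Y Z f g h. (X, Y, Z, f, g, h) \<in> Tri D \<and> X \<in> P \<and> Y \<in> P \<longrightarrow> Z \<in> P)"

definition closed_under_summands :: "('k, 'o, 'm) tri_cat \<Rightarrow> 'o set \<Rightarrow> bool" where
  "closed_under_summands D P \<longleftrightarrow> (\<forall>X Y B. is_biproduct D X Y B \<and> B \<in> P \<longrightarrow> X \<in> P \<and> Y \<in> P)"

definition split_generator :: "('k, 'o, 'm) tri_cat \<Rightarrow> 'o \<Rightarrow> bool" where
  "split_generator D G \<longleftrightarrow> G \<in> Obj D \<and>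
     \<Inter> {P. full_triangulated_subcategory D P \<and> closed_under_summands D P \<and> G \<in> P} = Obj D"

text \<open>\<open>A\<close> is a tower \<open>0 = A\<^sub>0, \<dots>, A\<^sub>k\<close> whose \<open>i\<close>-th step is an exact triangle
  \<open>A\<^sub>i\<^sub>-\<^sub>1 \<rightarrow> A\<^sub>i \<rightarrow> E[n\<^sub>i] \<rightarrow> A\<^sub>i\<^sub>-\<^sub>1[1]\<close>, where \<open>ns = [n\<^sub>1, \<dots>, n\<^sub>k]\<close>.\<close>

definition is_tower ::
  "('k, 'o, 'm) tri_cat \<Rightarrow> 'o \<Rightarrow> int list \<Rightarrow> (nat \<Rightarrow> 'o) \<Rightarrow> bool" where
  "is_tower D E ns A \<longleftrightarrow> is_zero_obj D (A 0) \<and>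
     (\<forall>i<length ns. \<exists>f g h. (A i, A (Suc i), fob (shift_pow D (ns ! i)) E, f, g, h) \<in> Tri D)"

definition complexity :: "('k, 'o, 'm) tri_cat \<Rightarrow> real \<Rightarrow> 'o \<Rightarrow> 'o \<Rightarrow> ereal" where
  "complexity D t E F = (if is_zero_obj D F then 0 else
     Inf {ereal (\<Sum>n\<leftarrow>ns. exp (real_of_int n * t)) | ns.
            \<exists>F' A. is_tower D E ns A \<and> is_biproduct D F F' (A (length ns))})"

definition ereal_ln :: "ereal \<Rightarrow> ereal" where
  "ereal_ln x = (if x \<le> 0 then - \<infinity> else if x = \<infinity> then \<infinity> else ereal (ln (real_of_ereal x)))"

text \<open>The limit exists and does not depend on the split-generator; \<open>entropy\<close> is
  only meaningful if there is a split-generator.\<close>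

definition entropy :: "('k, 'o, 'm) tri_cat \<Rightarrow> ('o, 'm, 'o, 'm) func \<Rightarrow> real \<Rightarrow> ereal" where
  "entropy D \<Phi> t = (THE l. \<forall>G. split_generator D G \<longrightarrow>
     (\<lambda>n. ereal (1 / real n) * ereal_ln (complexity D t G (fob (fpow \<Phi> n) G))) \<longlonglongrightarrow> l)"

section \<open>dg categories\<close>

text \<open>\<open>dHom A X Y n\<close> is the degree \<open>n\<close> part of the complex of morphisms \<open>X \<rightarrow> Y\<close> and
  \<open>Diff A X Y n\<close> its differential, of degree \<open>+1\<close>. The composite of \<open>f\<close> of degree \<open>n\<close> and
  \<open>g\<close> of degree \<open>m\<close> is \<open>dComp A X Y Z m n g f\<close>.\<close>

record ('k, 'o, 'm) dg_cat =
  dObj :: "'o set"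
  dHom :: "'o \<Rightarrow> 'o \<Rightarrow> int \<Rightarrow> ('k, 'm) module"
  Diff :: "'o \<Rightarrow> 'o \<Rightarrow> int \<Rightarrow> 'm \<Rightarrow> 'm"
  dComp :: "'o \<Rightarrow> 'o \<Rightarrow> 'o \<Rightarrow> int \<Rightarrow> int \<Rightarrow> 'm \<Rightarrow> 'm \<Rightarrow> 'm"
  dIdm :: "'o \<Rightarrow> 'm"

abbreviation dmor :: "('k, 'o, 'm) dg_cat \<Rightarrow> 'o \<Rightarrow> 'o \<Rightarrow> int \<Rightarrow> 'm set" where
  "dmor A X Y n \<equiv> carrier (dHom A X Y n)"

definition koszul :: "('k, 'm) module \<Rightarrow> int \<Rightarrow> 'm \<Rightarrow> 'm" where
  "koszul M n x = (if even n then x else \<ominus>\<^bsub>M\<^esub> x)"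

locale dg_category =
  fixes K :: "'k ring" and A :: "('k, 'o, 'm) dg_cat"
  assumes field_K: "Ring.field K"
    and dHom_module: "\<lbrakk>X \<in> dObj A; Y \<in> dObj A\<rbrakk> \<Longrightarrow> Module.module K (dHom A X Y n)"
    and Diff_linear: "\<lbrakk>X \<in> dObj A; Y \<in> dObj A\<rbrakk> \<Longrightarrow>
      linear_map K (dHom A X Y n) (dHom A X Y (n + 1)) (Diff A X Y n)"
    and Diff_Diff: "\<lbrakk>X \<in> dObj A; Y \<in> dObj A; f \<in> dmor A X Y n\<rbrakk> \<Longrightarrow>
      Diff A X Y (n + 1) (Diff A X Y n f) = \<zero>\<^bsub>dHom A X Y (n + 1 + 1)\<^esub>"
    and dComp_bilinear: "\<lbrakk>X \<in> dObj A; Y \<in> dObj A; Z \<in> dObj A\<rbrakk> \<Longrightarrow>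
      bilinear_map K (dHom A Y Z m) (dHom A X Y n) (dHom A X Z (m + n)) (dComp A X Y Z m n)"
    and dComp_assoc: "\<lbrakk>W \<in> dObj A; X \<in> dObj A; Y \<in> dObj A; Z \<in> dObj A;
      f \<in> dmor A W X n; g \<in> dmor A X Y m; h \<in> dmor A Y Z l\<rbrakk> \<Longrightarrow>
      dComp A W X Z (l + m) n (dComp A X Y Z l m h g) f =
      dComp A W Y Z l (m + n) h (dComp A W X Y m n g f)"
    and dIdm_closed: "X \<in> dObj A \<Longrightarrow> dIdm A X \<in> dmor A X X 0"
    and dIdm_right: "\<lbrakk>X \<in> dObj A; Y \<in> dObj A; f \<in> dmor A X Y n\<rbrakk> \<Longrightarrow>
      dComp A X X Y n 0 f (dIdm A X) = f"
    and dIdm_left: "\<lbrakk>X \<in> dObj A; Y \<in> dObj A; f \<in> dmor A X Y n\<rbrakk> \<Longrightarrow>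
      dComp A X Y Y 0 n (dIdm A Y) f = f"
    and Leibniz: "\<lbrakk>X \<in> dObj A; Y \<in> dObj A; Z \<in> dObj A; f \<in> dmor A X Y n; g \<in> dmor A Y Z m\<rbrakk> \<Longrightarrow>
      Diff A X Z (m + n) (dComp A X Y Z m n g f) =
      dComp A X Y Z (m + 1) n (Diff A Y Z m g) f \<oplus>\<^bsub>dHom A X Z (m + n + 1)\<^esub>
      koszul (dHom A X Z (m + n + 1)) m (dComp A X Y Z m (n + 1) g (Diff A X Y n f))"

definition cocycles :: "('k, 'o, 'm) dg_cat \<Rightarrow> 'o \<Rightarrow> 'o \<Rightarrow> int \<Rightarrow> 'm set" where
  "cocycles A X Y n = {f \<in> dmor A X Y n. Diff A X Y n f = \<zero>\<^bsub>dHom A X Y (n + 1)\<^esub>}"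

definition coboundaries :: "('k, 'o, 'm) dg_cat \<Rightarrow> 'o \<Rightarrow> 'o \<Rightarrow> int \<Rightarrow> 'm set" where
  "coboundaries A X Y n = Diff A X Y (n - 1) ` dmor A X Y (n - 1)"

definition hclass :: "('k, 'o, 'm) dg_cat \<Rightarrow> 'o \<Rightarrow> 'o \<Rightarrow> 'm \<Rightarrow> 'm set" where
  "hclass A X Y f = coboundaries A X Y 0 +>\<^bsub>dHom A X Y 0\<^esub> f"

text \<open>The coset generated by a set of mutually cohomologous cocycles.\<close>

abbreviation hclosure :: "('k, 'o, 'm) dg_cat \<Rightarrow> 'o \<Rightarrow> 'o \<Rightarrow> 'm set \<Rightarrow> 'm set" where
  "hclosure A X Y S \<equiv> coboundaries A X Y 0 <+>\<^bsub>dHom A X Y 0\<^esub> S"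

definition H0_Hom :: "('k, 'o, 'm) dg_cat \<Rightarrow> 'o \<Rightarrow> 'o \<Rightarrow> ('k, 'm set) module" where
  "H0_Hom A X Y =
     \<lparr>carrier = hclass A X Y ` cocycles A X Y 0,
      mult = undefined, one = undefined,
      zero = coboundaries A X Y 0,
      add = (\<lambda>c c'. c <+>\<^bsub>dHom A X Y 0\<^esub> c'),
      smult = (\<lambda>a c. hclosure A X Y ((\<lambda>f. a \<odot>\<^bsub>dHom A X Y 0\<^esub> f) ` c))\<rparr>"

definition H0 :: "('k, 'o, 'm) dg_cat \<Rightarrow> ('k, 'o, 'm set) lin_cat" where
  "H0 A = \<lparr>Obj = dObj A, Hom = H0_Hom A,
     Comp = (\<lambda>X Y Z c' c. hclosure A X Z {dComp A X Y Z 0 0 g f | g f. g \<in> c' \<and> f \<in> c}),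
     Idm = (\<lambda>X. hclass A X X (dIdm A X))\<rparr>"

text \<open>\<open>Y\<close> is a shift \<open>X[n]\<close> up to homotopy equivalence, exhibited by the closed morphism
  \<open>\<sigma> : X \<rightarrow> Y\<close> of degree \<open>-n\<close> with inverse \<open>\<rho>\<close> up to homotopy.\<close>

definition is_dg_shift ::
  "('k, 'o, 'm) dg_cat \<Rightarrow> int \<Rightarrow> 'o \<Rightarrow> 'o \<Rightarrow> 'm \<Rightarrow> 'm \<Rightarrow> bool" where
  "is_dg_shift A n X Y \<sigma> \<rho> \<longleftrightarrow> X \<in> dObj A \<and> Y \<in> dObj A \<and>
     \<sigma> \<in> cocycles A X Y (- n) \<and> \<rho> \<in> cocycles A Y X n \<and>
     hclass A X X (dComp A X Y X n (- n) \<rho> \<sigma>) = hclass A X X (dIdm A X) \<and>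
     hclass A Y Y (dComp A Y X Y (- n) n \<sigma> \<rho>) = hclass A Y Y (dIdm A Y)"

text \<open>For a closed \<open>f : X \<rightarrow> Y\<close> of degree 0, the complex \<open>Cone (f\<^sub>* : Hom(W,X) \<rightarrow> Hom(W,Y))\<close>
  has \<open>Hom\<^sup>n(W,Y) \<oplus> Hom\<^sup>n\<^sup>+\<^sup>1(W,X)\<close> in degree \<open>n\<close> and the
  differential \<open>(y, x) \<mapsto> (d y + f x, - d x)\<close>.\<close>

definition cone_Diff ::
  "('k, 'o, 'm) dg_cat \<Rightarrow> 'o \<Rightarrow> 'o \<Rightarrow> 'm \<Rightarrow> 'o \<Rightarrow> int \<Rightarrow> 'm \<times> 'm \<Rightarrow> 'm \<times> 'm" where
  "cone_Diff A X Y f W n = (\<lambda>(y, x).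
     (Diff A W Y n y \<oplus>\<^bsub>dHom A W Y (n + 1)\<^esub> dComp A W X Y 0 (n + 1) f x,
      \<ominus>\<^bsub>dHom A W X (n + 1 + 1)\<^esub> Diff A W X (n + 1) x))"

definition cone_cocycles ::
  "('k, 'o, 'm) dg_cat \<Rightarrow> 'o \<Rightarrow> 'o \<Rightarrow> 'm \<Rightarrow> 'o \<Rightarrow> int \<Rightarrow> ('m \<times> 'm) set" where
  "cone_cocycles A X Y f W n = {c \<in> dmor A W Y n \<times> dmor A W X (n + 1).
     cone_Diff A X Y f W n c = (\<zero>\<^bsub>dHom A W Y (n + 1)\<^esub>, \<zero>\<^bsub>dHom A W X (n + 1 + 1)\<^esub>)}"

definition cone_cohomologous ::
  "('k, 'o, 'm) dg_cat \<Rightarrow> 'o \<Rightarrow> 'o \<Rightarrow> 'm \<Rightarrow> 'o \<Rightarrow> int \<Rightarrow> 'm \<times> 'm \<Rightarrow> 'm \<times> 'm \<Rightarrow> bool" where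
  "cone_cohomologous A X Y f W n c c' \<longleftrightarrow>
     (\<exists>b \<in> dmor A W Y (n - 1) \<times> dmor A W X n.
        (fst c \<ominus>\<^bsub>dHom A W Y n\<^esub> fst c', snd c \<ominus>\<^bsub>dHom A W X (n + 1)\<^esub> snd c')
          = cone_Diff A X Y f W (n - 1) b)"

text \<open>\<open>Z\<close> is a cone of the closed degree 0 morphism \<open>f : X \<rightarrow> Y\<close>: the cocycle \<open>(s, p)\<close>
  of \<open>Cone (f\<^sub>*)\<close> corresponds by the Yoneda lemma to a map of dg modules
  \<open>Hom(-,Z) \<rightarrow> Cone (f\<^sub>*)\<close>, \<open>g \<mapsto> (s g, p g)\<close>, which is required to be a quasi-isomorphism;
  \<open>i : Y \<rightarrow> Z\<close> represents the canonical map \<open>Hom(-,Y) \<rightarrow> Cone (f\<^sub>*)\<close>. The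
  connecting morphism \<open>p : Z \<rightarrow> X\<close> has degree 1.\<close>

definition is_dg_cone ::
  "('k, 'o, 'm) dg_cat \<Rightarrow> 'o \<Rightarrow> 'o \<Rightarrow> 'm \<Rightarrow> 'o \<Rightarrow> 'm \<Rightarrow> 'm \<Rightarrow> 'm \<Rightarrow> bool" where
  "is_dg_cone A X Y f Z i s p \<longleftrightarrow>
     X \<in> dObj A \<and> Y \<in> dObj A \<and> Z \<in> dObj A \<and> f \<in> cocycles A X Y 0 \<and>
     (s, p) \<in> cone_cocycles A X Y f Z 0 \<and>
     (\<forall>W\<in>dObj A. \<forall>n.
        (\<forall>g\<in>cocycles A W Z n.
           cone_cohomologous A X Y f W n (dComp A W Z Y 0 n s g, dComp A W Z X 1 n p g)
             (\<zero>\<^bsub>dHom A W Y n\<^esub>, \<zero>\<^bsub>dHom A W X (n + 1)\<^esub>) \<longrightarrow> g \<in> coboundaries A W Z n) \<and>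
        (\<forall>c\<in>cone_cocycles A X Y f W n. \<exists>g\<in>cocycles A W Z n.
           cone_cohomologous A X Y f W n (dComp A W Z Y 0 n s g, dComp A W Z X 1 n p g) c)) \<and>
     i \<in> cocycles A Y Z 0 \<and>
     cone_cohomologous A X Y f Y 0 (dComp A Y Z Y 0 0 s i, dComp A Y Z X 1 0 p i)
       (dIdm A Y, \<zero>\<^bsub>dHom A Y X 1\<^esub>)"

locale pretriangulated_dg_category = dg_category K A
  for K :: "'k ring" and A :: "('k, 'o, 'm) dg_cat" +
  assumes nonempty: "dObj A \<noteq> {}"
    and shifts: "X \<in> dObj A \<Longrightarrow> \<exists>Y \<sigma> \<rho>. is_dg_shift A n X Y \<sigma> \<rho>"
    and cones: "\<lbrakk>X \<in> dObj A; Y \<in> dObj A; f \<in> cocycles A X Y 0\<rbrakk> \<Longrightarrow>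
      \<exists>Z i s p. is_dg_cone A X Y f Z i s p"

text \<open>A choice of the shift \<open>X[n]\<close> together with the structure morphisms.\<close>

definition dg_shift :: "('k, 'o, 'm) dg_cat \<Rightarrow> int \<Rightarrow> 'o \<Rightarrow> 'o \<times> 'm \<times> 'm" where
  "dg_shift A n X = (SOME (Y, \<sigma>, \<rho>). is_dg_shift A n X Y \<sigma> \<rho>)"

definition sh_ob :: "('k, 'o, 'm) dg_cat \<Rightarrow> int \<Rightarrow> 'o \<Rightarrow> 'o" where
  "sh_ob A n X = fst (dg_shift A n X)"

definition sh_to :: "('k, 'o, 'm) dg_cat \<Rightarrow> int \<Rightarrow> 'o \<Rightarrow> 'm" where
  "sh_to A n X = fst (snd (dg_shift A n X))"

definition sh_from :: "('k, 'o, 'm) dg_cat \<Rightarrow> int \<Rightarrow> 'o \<Rightarrow> 'm" where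
  "sh_from A n X = snd (snd (dg_shift A n X))"

text \<open>\<open>f[n] = \<sigma>\<^sub>Y \<circ> f \<circ> \<rho>\<^sub>X\<close> for \<open>f : X \<rightarrow> Y\<close> of degree 0.\<close>

definition H0_shift :: "('k, 'o, 'm) dg_cat \<Rightarrow> int \<Rightarrow> ('o, 'm set, 'o, 'm set) func" where
  "H0_shift A n = \<lparr>fob = sh_ob A n,
     fmor = (\<lambda>X Y c. hclosure A (sh_ob A n X) (sh_ob A n Y)
       {dComp A (sh_ob A n X) X (sh_ob A n Y) (- n) n
          (dComp A X Y (sh_ob A n Y) (- n) 0 (sh_to A n Y) f) (sh_from A n X) | f. f \<in> c})\<rparr>"

definition standard_triangles :: "('k, 'o, 'm) dg_cat \<Rightarrow> ('o, 'm set) triangle set" where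
  "standard_triangles A =
     {(X, Y, Z, hclass A X Y f, hclass A Y Z i,
       hclass A Z (sh_ob A 1 X) (dComp A Z X (sh_ob A 1 X) (- 1) 1 (sh_to A 1 X) p))
      | X Y Z f i s p. is_dg_cone A X Y f Z i s p}"

definition H0_tri :: "('k, 'o, 'm) dg_cat \<Rightarrow> ('k, 'o, 'm set) tri_cat" where
  "H0_tri A =
     \<lparr>Obj = Obj (H0 A), Hom = Hom (H0 A), Comp = Comp (H0 A), Idm = Idm (H0 A),
      Shift = H0_shift A 1, Unshift = H0_shift A (- 1),
      Tri = {\<tau>. \<exists>\<tau>'\<in>standard_triangles A. isomorphic_triangles (H0 A) (H0_shift A 1) \<tau> \<tau>'}\<rparr>"

record ('o, 'm, 'p, 'n) dg_func =
  dfob :: "'o \<Rightarrow> 'p"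
  dfmor :: "'o \<Rightarrow> 'o \<Rightarrow> int \<Rightarrow> 'm \<Rightarrow> 'n"

definition dg_functor ::
  "'k ring \<Rightarrow> ('k, 'o, 'm) dg_cat \<Rightarrow> ('k, 'p, 'n) dg_cat \<Rightarrow> ('o, 'm, 'p, 'n) dg_func \<Rightarrow> bool" where
  "dg_functor K A B F \<longleftrightarrow>
     (\<forall>X\<in>dObj A. dfob F X \<in> dObj B) \<and>
     (\<forall>X\<in>dObj A. \<forall>Y\<in>dObj A. \<forall>n.
        linear_map K (dHom A X Y n) (dHom B (dfob F X) (dfob F Y) n) (dfmor F X Y n) \<and>
        (\<forall>f\<in>dmor A X Y n. dfmor F X Y (n + 1) (Diff A X Y n f)
           = Diff B (dfob F X) (dfob F Y) n (dfmor F X Y n f))) \<and>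
     (\<forall>X\<in>dObj A. dfmor F X X 0 (dIdm A X) = dIdm B (dfob F X)) \<and>
     (\<forall>X\<in>dObj A. \<forall>Y\<in>dObj A. \<forall>Z\<in>dObj A. \<forall>m n. \<forall>f\<in>dmor A X Y n. \<forall>g\<in>dmor A Y Z m.
        dfmor F X Z (m + n) (dComp A X Y Z m n g f) =
        dComp B (dfob F X) (dfob F Y) (dfob F Z) m n (dfmor F Y Z m g) (dfmor F X Y n f))"

definition H0_func ::
  "('k, 'p, 'n) dg_cat \<Rightarrow> ('o, 'm, 'p, 'n) dg_func \<Rightarrow> ('o, 'm set, 'p, 'n set) func" where
  "H0_func B F = \<lparr>fob = dfob F,
     fmor = (\<lambda>X Y c. hclosure B (dfob F X) (dfob F Y) (dfmor F X Y 0 ` c))\<rparr>"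

text \<open>An element of degree \<open>n\<close> of the complex of natural transformations \<open>F \<rightarrow> G\<close>;
  it need not be closed.\<close>

definition dg_nat_trans ::
  "('k, 'o, 'm) dg_cat \<Rightarrow> ('k, 'p, 'n) dg_cat \<Rightarrow> ('o, 'm, 'p, 'n) dg_func \<Rightarrow>
   ('o, 'm, 'p, 'n) dg_func \<Rightarrow> int \<Rightarrow> ('o \<Rightarrow> 'n) \<Rightarrow> bool" where
  "dg_nat_trans A B F G n \<alpha> \<longleftrightarrow>
     (\<forall>X\<in>dObj A. \<alpha> X \<in> dmor B (dfob F X) (dfob G X) n) \<and>
     (\<forall>X\<in>dObj A. \<forall>Y\<in>dObj A. \<forall>m. \<forall>f\<in>dmor A X Y m.
        dComp B (dfob F X) (dfob F Y) (dfob G Y) n m (\<alpha> Y) (dfmor F X Y m f) =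
        koszul (dHom B (dfob F X) (dfob G Y) (m + n)) (m * n)
          (dComp B (dfob F X) (dfob G X) (dfob G Y) m n (dfmor G X Y m f) (\<alpha> X)))"

definition closed_dg_nat_trans ::
  "('k, 'o, 'm) dg_cat \<Rightarrow> ('k, 'p, 'n) dg_cat \<Rightarrow> ('o, 'm, 'p, 'n) dg_func \<Rightarrow>
   ('o, 'm, 'p, 'n) dg_func \<Rightarrow> ('o \<Rightarrow> 'n) \<Rightarrow> bool" where
  "closed_dg_nat_trans A B F G \<alpha> \<longleftrightarrow> dg_nat_trans A B F G 0 \<alpha> \<and>
     (\<forall>X\<in>dObj A. \<alpha> X \<in> cocycles B (dfob F X) (dfob G X) 0)"

section \<open>dg enhancements and functorial cones\<close>

definition dg_enhancement ::
  "'k ring \<Rightarrow> ('k, 'o, 'm) tri_cat \<Rightarrow> ('k, 'a, 'b) dg_cat \<Rightarrow> ('o, 'm, 'a, 'b set) func \<Rightarrow> bool" where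
  "dg_enhancement K D A E \<longleftrightarrow>
     pretriangulated_dg_category K A \<and> triangulated_equivalence K D (H0_tri A) E"

text \<open>The dg functor \<open>F'\<close> lifts \<open>F : C \<rightarrow> D\<close> along the enhancements
  \<open>E\<^sub>C : C \<rightarrow> H\<^sup>0(A)\<close> and \<open>E\<^sub>D : D \<rightarrow> H\<^sup>0(B)\<close>, via the natural isomorphism
  \<open>\<theta> : E\<^sub>D \<circ> F \<rightarrow> H\<^sup>0(F') \<circ> E\<^sub>C\<close>.\<close>

definition is_dg_lift ::
  "'k ring \<Rightarrow> ('k, 'o, 'm) tri_cat \<Rightarrow> ('k, 'a, 'b) dg_cat \<Rightarrow> ('o, 'm, 'a, 'b set) func \<Rightarrow>
   ('k, 'p, 'n) tri_cat \<Rightarrow> ('k, 'c, 'd) dg_cat \<Rightarrow> ('p, 'n, 'c, 'd set) func \<Rightarrow>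
   ('o, 'm, 'p, 'n) func \<Rightarrow> ('a, 'b, 'c, 'd) dg_func \<Rightarrow> ('o \<Rightarrow> 'd set) \<Rightarrow> bool" where
  "is_dg_lift K C A E\<^sub>C D B E\<^sub>D F F' \<theta> \<longleftrightarrow>
     dg_functor K A B F' \<and> nat_iso C (H0_tri B) (E\<^sub>D \<circ>\<circ> F) (H0_func B F' \<circ>\<circ> E\<^sub>C) \<theta>"

definition has_dg_lift ::
  "'k ring \<Rightarrow> ('k, 'o, 'm) tri_cat \<Rightarrow> ('k, 'a, 'b) dg_cat \<Rightarrow> ('o, 'm, 'a, 'b set) func \<Rightarrow>
   ('k, 'p, 'n) tri_cat \<Rightarrow> ('k, 'c, 'd) dg_cat \<Rightarrow> ('p, 'n, 'c, 'd set) func \<Rightarrow>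
   ('o, 'm, 'p, 'n) func \<Rightarrow> bool" where
  "has_dg_lift K C A E\<^sub>C D B E\<^sub>D F \<longleftrightarrow> (\<exists>F' \<theta>. is_dg_lift K C A E\<^sub>C D B E\<^sub>D F F' \<theta>)"

text \<open>\<open>T \<cong> Cone (\<alpha> : F \<rightarrow> G)\<close>: the transformation \<open>\<alpha>\<close> lifts to a closed transformation
  \<open>\<alpha>' : F' \<rightarrow> G'\<close> of dg lifts, and \<open>T\<close> lifts to a dg functor \<open>T'\<close> whose values \<open>T'(X)\<close> are
  cones of \<open>\<alpha>'\<^sub>X\<close>, naturally in \<open>X\<close> at the dg level.\<close>

definition is_functorial_cone ::
  "'k ring \<Rightarrow> ('k, 'o, 'm) tri_cat \<Rightarrow> ('k, 'a, 'b) dg_cat \<Rightarrow> ('o, 'm, 'a, 'b set) func \<Rightarrow>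
   ('k, 'p, 'n) tri_cat \<Rightarrow> ('k, 'c, 'd) dg_cat \<Rightarrow> ('p, 'n, 'c, 'd set) func \<Rightarrow>
   ('o, 'm, 'p, 'n) func \<Rightarrow> ('o, 'm, 'p, 'n) func \<Rightarrow> ('o \<Rightarrow> 'n) \<Rightarrow> ('o, 'm, 'p, 'n) func \<Rightarrow> bool" where
  "is_functorial_cone K C A E\<^sub>C D B E\<^sub>D F G \<alpha> T \<longleftrightarrow>
     (\<exists>F' \<theta> G' \<psi> T' \<chi> \<alpha>' s p.
        is_dg_lift K C A E\<^sub>C D B E\<^sub>D F F' \<theta> \<and>
        is_dg_lift K C A E\<^sub>C D B E\<^sub>D G G' \<psi> \<and>
        is_dg_lift K C A E\<^sub>C D B E\<^sub>D T T' \<chi> \<and>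
        closed_dg_nat_trans A B F' G' \<alpha>' \<and>
        (\<forall>X\<in>Obj C.
           Comp (H0 B) (fob E\<^sub>D (fob F X)) (dfob F' (fob E\<^sub>C X)) (dfob G' (fob E\<^sub>C X))
             (hclass B (dfob F' (fob E\<^sub>C X)) (dfob G' (fob E\<^sub>C X)) (\<alpha>' (fob E\<^sub>C X))) (\<theta> X) =
           Comp (H0 B) (fob E\<^sub>D (fob F X)) (fob E\<^sub>D (fob G X)) (dfob G' (fob E\<^sub>C X))
             (\<psi> X) (fmor E\<^sub>D (fob F X) (fob G X) (\<alpha> X))) \<and>
        dg_nat_trans A B T' G' 0 s \<and> dg_nat_trans A B T' F' 1 p \<and>
        (\<forall>X\<in>dObj A. \<exists>i. is_dg_cone B (dfob F' X) (dfob G' X) (\<alpha>' X) (dfob T' X) i (s X) (p X)))"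

section \<open>Spherical functors\<close>

definition is_twist ::
  "'k ring \<Rightarrow> ('k, 'p, 'n) tri_cat \<Rightarrow> ('k, 'c, 'd) dg_cat \<Rightarrow> ('p, 'n, 'c, 'd set) func \<Rightarrow>
   ('o, 'm, 'p, 'n) func \<Rightarrow> ('p, 'n, 'o, 'm) func \<Rightarrow> ('p \<Rightarrow> 'n) \<Rightarrow> ('p, 'n, 'p, 'n) func \<Rightarrow> bool" where
  "is_twist K D B E\<^sub>D S R \<epsilon> T \<longleftrightarrow> is_functorial_cone K D B E\<^sub>D D B E\<^sub>D (S \<circ>\<circ> R) fid \<epsilon> T"

definition is_cotwist ::
  "'k ring \<Rightarrow> ('k, 'o, 'm) tri_cat \<Rightarrow> ('k, 'a, 'b) dg_cat \<Rightarrow> ('o, 'm, 'a, 'b set) func \<Rightarrow>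
   ('o, 'm, 'p, 'n) func \<Rightarrow> ('p, 'n, 'o, 'm) func \<Rightarrow> ('o \<Rightarrow> 'm) \<Rightarrow> ('o, 'm, 'o, 'm) func \<Rightarrow> bool" where
  "is_cotwist K C A E\<^sub>C S R \<eta> Q \<longleftrightarrow>
     (\<exists>N. is_functorial_cone K C A E\<^sub>C C A E\<^sub>C fid (R \<circ>\<circ> S) \<eta> N \<and>
          nat_isomorphic C C Q (shift_pow C (- 1) \<circ>\<circ> N))"

text \<open>\<open>S : C \<rightarrow> D\<close> is spherical with right adjoint \<open>R\<close>, left adjoint \<open>L\<close>, twist \<open>T\<close> and
  cotwist \<open>Q\<close>; here \<open>\<eta>\<close> and \<open>\<epsilon>\<close> are the unit and the counit of \<open>S \<stileturn> R\<close>.\<close>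

definition spherical_functor ::
  "'k ring \<Rightarrow> ('k, 'o, 'm) tri_cat \<Rightarrow> ('k, 'a, 'b) dg_cat \<Rightarrow> ('o, 'm, 'a, 'b set) func \<Rightarrow>
   ('k, 'p, 'n) tri_cat \<Rightarrow> ('k, 'c, 'd) dg_cat \<Rightarrow> ('p, 'n, 'c, 'd set) func \<Rightarrow>
   ('o, 'm, 'p, 'n) func \<Rightarrow> ('p, 'n, 'o, 'm) func \<Rightarrow> ('p, 'n, 'o, 'm) func \<Rightarrow>
   ('o \<Rightarrow> 'm) \<Rightarrow> ('p \<Rightarrow> 'n) \<Rightarrow> ('p, 'n, 'p, 'n) func \<Rightarrow> ('o, 'm, 'o, 'm) func \<Rightarrow> bool" where
  "spherical_functor K C A E\<^sub>C D B E\<^sub>D S R L \<eta> \<epsilon> T Q \<longleftrightarrow>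
     exact_functor K C D S \<and> exact_functor K D C R \<and> exact_functor K D C L \<and>
     has_dg_lift K C A E\<^sub>C D B E\<^sub>D S \<and>
     has_dg_lift K D B E\<^sub>D C A E\<^sub>C R \<and> has_dg_lift K D B E\<^sub>D C A E\<^sub>C L \<and>
     adjunction C D S R \<eta> \<epsilon> \<and> (\<exists>\<eta>' \<epsilon>'. adjunction D C L S \<eta>' \<epsilon>') \<and>
     is_twist K D B E\<^sub>D S R \<epsilon> T \<and> exact_autoequivalence K D T \<and>
     is_cotwist K C A E\<^sub>C S R \<eta> Q \<and> exact_autoequivalence K C Q \<and>
     nat_isomorphic D C R (shift_pow C (- 1) \<circ>\<circ> L \<circ>\<circ> T) \<and>
     nat_isomorphic D C R (shift_pow C 1 \<circ>\<circ> Q \<circ>\<circ> L)"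

end

theory Submission
  imports Defs
begin

text \<open>Write \<open>P = C\<^sub>S[2]\<close>. Conditions (3) and (4) give \<open>R T\<^sub>S \<cong> P R\<close>, hence \<open>R T\<^sub>S\<^sup>n \<cong> P\<^sup>n R\<close>.
  As exact functors do not increase complexity and the image of \<open>R\<close> generates, this bounds the
  complexity of \<open>P\<^sup>n\<close> by a constant multiple of that of \<open>T\<^sub>S\<^sup>n\<close>, so \<open>h\<^sub>t(P) \<le> h\<^sub>t(T\<^sub>S)\<close> for all \<open>t\<close>.
  Conversely, the triangles \<open>S R T\<^sub>S\<^sup>n G \<rightarrow> T\<^sub>S\<^sup>n G \<rightarrow> T\<^sub>S\<^sup>n\<^sup>+\<^sup>1 G\<close> and \<open>S R T\<^sub>S\<^sup>n \<cong> S P\<^sup>n R\<close> bound the increments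
  of the complexity of \<open>T\<^sub>S\<^sup>n G\<close> by a multiple of the complexity of \<open>P\<^sup>n\<close>. Summing up gives
  \<open>h\<^sub>t(T\<^sub>S) \<le> h\<^sub>t(P)\<close> if the latter is nonnegative.\<close>

section \<open>Linear categories\<close>

text \<open>Complexity depends only on isomorphism classes of objects, so natural isomorphisms are
  used through their components, and the dg structure enters once, to produce an exact triangle
  \<open>S R X \<rightarrow> X \<rightarrow> T\<^sub>S X\<close> for each object. The obstacle is
  the summand \<open>F'\<close> in the definition of complexity. Towers exist only for objects
  having the given one as a retract, and cones are not functorial, so it is not evident that
  retractions of two vertices of a triangle extend to the third. \<open>cone_retract\<close> settles
  this; subadditivity of complexity under extensions rests on it, and on that in turn the rule
  \<open>cx t E G \<le> cx t E F * cx t F G\<close>, from which all estimates are chains. Since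
  \<open>entropy\<close> is a definite description, convergence and independence of the generator
  have to be established before any inequality. Inequalities between limits are then proved as
  bounds \<open>a n \<le> c * exp (r * n)\<close> for every \<open>r\<close> above the larger limit:
  constant factors disappear and the value \<open>-\<infinity>\<close> needs no special
  treatment.\<close>

lemma linear_map_group_hom:
  assumes "linear_map K M N f" "Module.module K M" "Module.module K N"
  shows "abelian_group_hom M N f"
proof -
  have "abelian_group M" "abelian_group N"
    using assms(2,3) by (auto simp: Module.module_def)
  moreover have "f \<in> hom (add_monoid M) (add_monoid N)"
    using assms(1) by (auto simp: linear_map_def hom_def)
  ultimately show ?thesis
    by (auto intro!: abelian_group_homI group_hom.intro group_hom_axioms.intro
        dest: abelian_group.a_group)
qed

section \<open>Arrows and the additive structure of composition\<close>

context linear_category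
begin

text \<open>The axioms of the locale hold only between objects of \<open>C\<close>, and morphism
  sets of different pairs may overlap. Carrying both endpoints along with the morphism lets the
  simplifier discharge all typing conditions.\<close>

definition arr :: "'o \<Rightarrow> 'o \<Rightarrow> 'm \<Rightarrow> bool" where
  "arr X Y f \<longleftrightarrow> X \<in> Obj C \<and> Y \<in> Obj C \<and> f \<in> mor C X Y"

lemma arr_obj: "arr X Y f \<Longrightarrow> X \<in> Obj C" "arr X Y f \<Longrightarrow> Y \<in> Obj C"
  and arr_mor: "arr X Y f \<Longrightarrow> f \<in> mor C X Y"
  by (auto simp: arr_def)

lemma arrI: "\<lbrakk>X \<in> Obj C; Y \<in> Obj C; f \<in> mor C X Y\<rbrakk> \<Longrightarrow> arr X Y f"
  by (auto simp: arr_def)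

lemma Hom_group: "\<lbrakk>X \<in> Obj C; Y \<in> Obj C\<rbrakk> \<Longrightarrow> abelian_group (Hom C X Y)"
  using Hom_module[of X Y] by (rule Module.module.axioms(2))

lemma arr_group: "arr X Y f \<Longrightarrow> abelian_group (Hom C X Y)"
  by (simp add: Hom_group arr_def)

lemma arr_id [simp]: "X \<in> Obj C \<Longrightarrow> arr X X (Idm C X)"
  by (simp add: arr_def Idm_closed)

lemma arr_zero [simp]: "\<lbrakk>X \<in> Obj C; Y \<in> Obj C\<rbrakk> \<Longrightarrow> arr X Y \<zero>\<^bsub>Hom C X Y\<^esub>"
  by (simp add: arr_def Hom_group abelian_groupE)

lemma arr_add [simp]: "\<lbrakk>arr X Y f; arr X Y g\<rbrakk> \<Longrightarrow> arr X Y (f \<oplus>\<^bsub>Hom C X Y\<^esub> g)"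
  by (simp add: arr_def Hom_group abelian_groupE)

lemma arr_neg [simp]: "arr X Y f \<Longrightarrow> arr X Y (\<ominus>\<^bsub>Hom C X Y\<^esub> f)"
  using arr_group[of X Y f] by (simp add: arr_def abelian_group.a_inv_closed)

lemma arr_minus [simp]: "\<lbrakk>arr X Y f; arr X Y g\<rbrakk> \<Longrightarrow> arr X Y (f \<ominus>\<^bsub>Hom C X Y\<^esub> g)"
  by (simp add: a_minus_def arr_add arr_neg)

lemma comp_left_hom:
  assumes "arr Y Z g" "X \<in> Obj C"
  shows "abelian_group_hom (Hom C X Y) (Hom C X Z) (Comp C X Y Z g)"
  using assms Comp_bilinear[of X Y Z] Hom_module
  by (auto intro!: linear_map_group_hom[of K] simp: bilinear_map_def arr_def)

lemma comp_right_hom: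
  assumes "arr X Y f" "Z \<in> Obj C"
  shows "abelian_group_hom (Hom C Y Z) (Hom C X Z) (\<lambda>g. Comp C X Y Z g f)"
  using assms Comp_bilinear[of X Y Z] Hom_module
  by (auto intro!: linear_map_group_hom[of K] simp: bilinear_map_def arr_def)

lemma arr_comp [simp]: "\<lbrakk>arr X Y f; arr Y Z g\<rbrakk> \<Longrightarrow> arr X Z (Comp C X Y Z g f)"
  using abelian_group_hom.hom_closed[OF comp_left_hom[of Y Z g X]] by (auto simp: arr_def)

lemma comp_assoc: "\<lbrakk>arr W X f; arr X Y g; arr Y Z h\<rbrakk> \<Longrightarrow>
    Comp C W X Z (Comp C X Y Z h g) f = Comp C W Y Z h (Comp C W X Y g f)"
  by (auto simp: arr_def intro: Comp_assoc)

lemma comp_id_left [simp]: "arr X Y f \<Longrightarrow> Comp C X Y Y (Idm C Y) f = f"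
  and comp_id_right [simp]: "arr X Y f \<Longrightarrow> Comp C X X Y f (Idm C X) = f"
  by (auto simp: arr_def Idm_left Idm_right)

lemma comp_add_left: "\<lbrakk>arr X Y f; arr Y Z g; arr Y Z g'\<rbrakk> \<Longrightarrow>
    Comp C X Y Z (g \<oplus>\<^bsub>Hom C Y Z\<^esub> g') f = Comp C X Y Z g f \<oplus>\<^bsub>Hom C X Z\<^esub> Comp C X Y Z g' f"
  using abelian_group_hom.hom_add[OF comp_right_hom[of X Y f Z]] by (auto simp: arr_def)

lemma comp_add_right: "\<lbrakk>arr X Y f; arr X Y f'; arr Y Z g\<rbrakk> \<Longrightarrow>
    Comp C X Y Z g (f \<oplus>\<^bsub>Hom C X Y\<^esub> f') = Comp C X Y Z g f \<oplus>\<^bsub>Hom C X Z\<^esub> Comp C X Y Z g f'"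
  using abelian_group_hom.hom_add[OF comp_left_hom[of Y Z g X]] by (auto simp: arr_def)

lemma comp_neg_left: "\<lbrakk>arr X Y f; arr Y Z g\<rbrakk> \<Longrightarrow>
    Comp C X Y Z (\<ominus>\<^bsub>Hom C Y Z\<^esub> g) f = \<ominus>\<^bsub>Hom C X Z\<^esub> Comp C X Y Z g f"
  using abelian_group_hom.hom_a_inv[OF comp_right_hom[of X Y f Z]] by (auto simp: arr_def)

lemma comp_neg_right: "\<lbrakk>arr X Y f; arr Y Z g\<rbrakk> \<Longrightarrow>
    Comp C X Y Z g (\<ominus>\<^bsub>Hom C X Y\<^esub> f) = \<ominus>\<^bsub>Hom C X Z\<^esub> Comp C X Y Z g f"
  using abelian_group_hom.hom_a_inv[OF comp_left_hom[of Y Z g X]] by (auto simp: arr_def)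

lemma comp_zero_left [simp]: "\<lbrakk>arr X Y f; Z \<in> Obj C\<rbrakk> \<Longrightarrow>
    Comp C X Y Z \<zero>\<^bsub>Hom C Y Z\<^esub> f = \<zero>\<^bsub>Hom C X Z\<^esub>"
  using abelian_group_hom.hom_zero[OF comp_right_hom[of X Y f Z]] by auto

lemma comp_zero_right [simp]: "\<lbrakk>arr Y Z g; X \<in> Obj C\<rbrakk> \<Longrightarrow>
    Comp C X Y Z g \<zero>\<^bsub>Hom C X Y\<^esub> = \<zero>\<^bsub>Hom C X Z\<^esub>"
  using abelian_group_hom.hom_zero[OF comp_left_hom[of Y Z g X]] by auto

lemma comp_minus_left: "\<lbrakk>arr X Y f; arr Y Z g; arr Y Z g'\<rbrakk> \<Longrightarrow>
    Comp C X Y Z (g \<ominus>\<^bsub>Hom C Y Z\<^esub> g') f = Comp C X Y Z g f \<ominus>\<^bsub>Hom C X Z\<^esub> Comp C X Y Z g' f"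
  by (simp add: a_minus_def comp_add_left comp_neg_left arr_neg)

lemma comp_minus_right: "\<lbrakk>arr X Y f; arr X Y f'; arr Y Z g\<rbrakk> \<Longrightarrow>
    Comp C X Y Z g (f \<ominus>\<^bsub>Hom C X Y\<^esub> f') = Comp C X Y Z g f \<ominus>\<^bsub>Hom C X Z\<^esub> Comp C X Y Z g f'"
  by (simp add: a_minus_def comp_add_right comp_neg_right arr_neg)

lemma minus_self: "arr X Y f \<Longrightarrow> f \<ominus>\<^bsub>Hom C X Y\<^esub> f = \<zero>\<^bsub>Hom C X Y\<^esub>"
  using arr_group[of X Y f] by (simp add: arr_def a_minus_def abelian_group.r_neg)

lemma minus_zero: "arr X Y f \<Longrightarrow> f \<ominus>\<^bsub>Hom C X Y\<^esub> \<zero>\<^bsub>Hom C X Y\<^esub> = f"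
proof -
  assume f: "arr X Y f"
  interpret H: abelian_group "Hom C X Y" using f by (rule arr_group)
  show ?thesis using f by (simp add: arr_def a_minus_def)
qed

lemma add_zero:
  assumes "arr X Y f"
  shows "f \<oplus>\<^bsub>Hom C X Y\<^esub> \<zero>\<^bsub>Hom C X Y\<^esub> = f" "\<zero>\<^bsub>Hom C X Y\<^esub> \<oplus>\<^bsub>Hom C X Y\<^esub> f = f"
proof -
  interpret H: abelian_group "Hom C X Y" using assms by (rule arr_group)
  show "f \<oplus>\<^bsub>Hom C X Y\<^esub> \<zero>\<^bsub>Hom C X Y\<^esub> = f" "\<zero>\<^bsub>Hom C X Y\<^esub> \<oplus>\<^bsub>Hom C X Y\<^esub> f = f"
    using assms by (simp_all add: arr_def)
qed

lemma minus_minus: "\<lbrakk>arr X Y f; arr X Y g\<rbrakk> \<Longrightarrow> f \<ominus>\<^bsub>Hom C X Y\<^esub> (f \<ominus>\<^bsub>Hom C X Y\<^esub> g) = g"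
proof -
  assume f: "arr X Y f" and g: "arr X Y g"
  interpret H: abelian_group "Hom C X Y" using f by (rule arr_group)
  show ?thesis using f g by (simp add: arr_def a_minus_def H.minus_add H.r_neg2)
qed

lemma minus_eq_zero_iff: "\<lbrakk>arr X Y f; arr X Y g\<rbrakk> \<Longrightarrow> f \<ominus>\<^bsub>Hom C X Y\<^esub> g = \<zero>\<^bsub>Hom C X Y\<^esub> \<longleftrightarrow> f = g"
proof -
  assume f: "arr X Y f" and g: "arr X Y g"
  show ?thesis
  proof
    assume "f \<ominus>\<^bsub>Hom C X Y\<^esub> g = \<zero>\<^bsub>Hom C X Y\<^esub>"
    then show "f = g" using minus_minus[OF f g] minus_zero[OF f] by simp
  qed (simp add: minus_self g)
qed

lemma neg_neg [simp]: "arr X Y f \<Longrightarrow> \<ominus>\<^bsub>Hom C X Y\<^esub> (\<ominus>\<^bsub>Hom C X Y\<^esub> f) = f"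
  using arr_group[of X Y f] by (simp add: arr_def abelian_group.minus_minus)

lemma neg_zero [simp]: "\<lbrakk>X \<in> Obj C; Y \<in> Obj C\<rbrakk> \<Longrightarrow> \<ominus>\<^bsub>Hom C X Y\<^esub> \<zero>\<^bsub>Hom C X Y\<^esub> = \<zero>\<^bsub>Hom C X Y\<^esub>"
  using abelian_group.minus_equality[OF Hom_group[of X Y], of "\<zero>\<^bsub>Hom C X Y\<^esub>" "\<zero>\<^bsub>Hom C X Y\<^esub>"]
  by (simp add: Hom_group abelian_groupE)

lemma neg_eq_zero_iff: "arr X Y f \<Longrightarrow> \<ominus>\<^bsub>Hom C X Y\<^esub> f = \<zero>\<^bsub>Hom C X Y\<^esub> \<longleftrightarrow> f = \<zero>\<^bsub>Hom C X Y\<^esub>"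
  using neg_neg[of X Y f] neg_zero[of X Y] arr_obj[of X Y f] by fastforce

text \<open>The inverse is a parameter, so that cancelling an isomorphism is rewriting with two
  equations instead of unpacking the existential in \<open>is_iso\<close>.\<close>

definition inv_pair :: "'o \<Rightarrow> 'o \<Rightarrow> 'm \<Rightarrow> 'm \<Rightarrow> bool" where
  "inv_pair X Y f g \<longleftrightarrow> arr X Y f \<and> arr Y X g \<and>
     Comp C X Y X g f = Idm C X \<and> Comp C Y X Y f g = Idm C Y"

lemma inv_pair_sym: "inv_pair X Y f g \<Longrightarrow> inv_pair Y X g f"
  by (auto simp: inv_pair_def)

lemma inv_pair_id: "X \<in> Obj C \<Longrightarrow> inv_pair X X (Idm C X) (Idm C X)"
  by (auto simp: inv_pair_def)

text \<open>Only a one-sided inverse is assumed, so the rule serves retractions as well as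
  isomorphisms.\<close>

lemma comp_cancel_left: "\<lbrakk>arr X Y f; arr Y X g; Comp C X Y X g f = Idm C X; arr W X h\<rbrakk> \<Longrightarrow>
    Comp C W Y X g (Comp C W X Y f h) = h"
  by (simp add: comp_assoc[symmetric])

lemma comp_cancel_right: "\<lbrakk>arr X Y f; arr Y X g; Comp C X Y X g f = Idm C X; arr X W h\<rbrakk> \<Longrightarrow>
    Comp C X Y W (Comp C Y X W h g) f = h"
  by (simp add: comp_assoc)

lemma comp_retracts:
  assumes "arr X Y f" "arr Y X g" "Comp C X Y X g f = Idm C X"
    and "arr Y Z f'" "arr Z Y g'" "Comp C Y Z Y g' f' = Idm C Y"
  shows "Comp C X Z X (Comp C Z Y X g g') (Comp C X Y Z f' f) = Idm C X"
  using assms by (simp add: comp_assoc comp_cancel_left[of Y Z f' g'])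

lemma inv_pair_trans:
  assumes "inv_pair X Y f g" "inv_pair Y Z f' g'"
  shows "inv_pair X Z (Comp C X Y Z f' f) (Comp C Z Y X g g')"
  using assms unfolding inv_pair_def by (simp add: comp_retracts)

lemma is_iso_inv_pair: "\<lbrakk>X \<in> Obj C; Y \<in> Obj C\<rbrakk> \<Longrightarrow> is_iso C X Y f \<longleftrightarrow> (\<exists>g. inv_pair X Y f g)"
  by (auto simp: is_iso_def inv_pair_def arr_def)

lemma inv_pair_is_iso: "inv_pair X Y f g \<Longrightarrow> is_iso C X Y f"
  by (auto simp: is_iso_def inv_pair_def arr_def)

lemma isomorphic_iff: "isomorphic C X Y \<longleftrightarrow> (\<exists>f g. inv_pair X Y f g)"
  by (auto simp: isomorphic_def is_iso_def inv_pair_def arr_def)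

lemma isomorphic_refl [simp]: "X \<in> Obj C \<Longrightarrow> isomorphic C X X"
  using inv_pair_id isomorphic_iff by blast

lemma isomorphic_sym: "isomorphic C X Y \<Longrightarrow> isomorphic C Y X"
  using inv_pair_sym isomorphic_iff by blast

lemma isomorphic_trans [trans]: "\<lbrakk>isomorphic C X Y; isomorphic C Y Z\<rbrakk> \<Longrightarrow> isomorphic C X Z"
  unfolding isomorphic_iff by (elim exE) (rule exI, rule exI, rule inv_pair_trans)

lemma isomorphic_obj: "isomorphic C X Y \<Longrightarrow> X \<in> Obj C" "isomorphic C X Y \<Longrightarrow> Y \<in> Obj C"
  by (auto simp: isomorphic_def)

text \<open>A direct summand without a chosen complement. Transitivity and images under functors
  become immediate; in a triangulated category \<open>retract_biproduct\<close> recovers the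
  complement.\<close>

definition retract :: "'o \<Rightarrow> 'o \<Rightarrow> bool" where
  "retract X Y \<longleftrightarrow> (\<exists>i p. arr X Y i \<and> arr Y X p \<and> Comp C X Y X p i = Idm C X)"

lemma retract_obj: "retract X Y \<Longrightarrow> X \<in> Obj C" "retract X Y \<Longrightarrow> Y \<in> Obj C"
  by (auto simp: retract_def arr_def)

lemma isomorphic_retract: "isomorphic C X Y \<Longrightarrow> retract X Y"
  by (auto simp: isomorphic_iff retract_def inv_pair_def)

lemma retract_refl [simp]: "X \<in> Obj C \<Longrightarrow> retract X X"
  by (simp add: isomorphic_retract)

lemma retract_trans [trans]: "\<lbrakk>retract X Y; retract Y Z\<rbrakk> \<Longrightarrow> retract X Z"
proof -
  assume "retract X Y" "retract Y Z"
  then obtain i p i' p' where "arr X Y i" "arr Y X p" "Comp C X Y X p i = Idm C X"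
    "arr Y Z i'" "arr Z Y p'" "Comp C Y Z Y p' i' = Idm C Y"
    unfolding retract_def by blast
  then show ?thesis unfolding retract_def by (intro exI conjI, rule_tac[3] comp_retracts, simp_all)
qed

lemma biproduct_retract: "is_biproduct C X Y B \<Longrightarrow> retract X B" "is_biproduct C X Y B \<Longrightarrow> retract Y B"
  by (auto simp: is_biproduct_def retract_def arr_def)

text \<open>If the identity of \<open>Z\<close> vanishes, composing with it shows that every
  morphism into or out of \<open>Z\<close> vanishes.\<close>

lemma zero_obj_iff: "is_zero_obj C Z \<longleftrightarrow> Z \<in> Obj C \<and> Idm C Z = \<zero>\<^bsub>Hom C Z Z\<^esub>"
proof
  assume Z: "is_zero_obj C Z"
  then show "Z \<in> Obj C \<and> Idm C Z = \<zero>\<^bsub>Hom C Z Z\<^esub>"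
    using arr_id[of Z] arr_zero[of Z Z] by (auto simp: is_zero_obj_def arr_def)
next
  assume Z: "Z \<in> Obj C \<and> Idm C Z = \<zero>\<^bsub>Hom C Z Z\<^esub>"
  have "f = \<zero>\<^bsub>Hom C X Z\<^esub>" if "arr X Z f" for X f
    using Z that by (metis arr_obj(1) comp_id_left comp_zero_left)
  moreover have "f = \<zero>\<^bsub>Hom C Z X\<^esub>" if "arr Z X f" for X f
    using Z that by (metis arr_obj(2) comp_id_right comp_zero_right)
  ultimately show "is_zero_obj C Z"
    using Z arr_zero unfolding is_zero_obj_def arr_def
    apply (intro conjI ballI)
    apply blast
    subgoal for X by (rule ex1I[of _ "\<zero>\<^bsub>Hom C X Z\<^esub>"]) blast+
    subgoal for X by (rule ex1I[of _ "\<zero>\<^bsub>Hom C Z X\<^esub>"]) blast+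
    done
qed

lemma zero_obj_obj: "is_zero_obj C Z \<Longrightarrow> Z \<in> Obj C"
  by (simp add: is_zero_obj_def)

lemma to_zero_obj: "\<lbrakk>is_zero_obj C Z; arr X Z f\<rbrakk> \<Longrightarrow> f = \<zero>\<^bsub>Hom C X Z\<^esub>"
  using arr_zero[of X Z] by (auto simp: is_zero_obj_def arr_def)

lemma retract_zero_obj: "\<lbrakk>retract X Z; is_zero_obj C Z\<rbrakk> \<Longrightarrow> is_zero_obj C X"
proof -
  assume "retract X Z" and Z: "is_zero_obj C Z"
  then obtain i p where ip: "arr X Z i" "arr Z X p" "Comp C X Z X p i = Idm C X"
    by (auto simp: retract_def)
  then have "i = \<zero>\<^bsub>Hom C X Z\<^esub>" using Z by (simp add: to_zero_obj)
  then show ?thesis using ip by (simp add: zero_obj_iff arr_obj)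
qed

end

section \<open>Linear functors on arrows, retracts and zero objects\<close>

locale linear_functor_between =
  dom: linear_category K C + cod: linear_category K D
  for K :: "'k ring" and C :: "('k, 'o, 'm, 'z) lin_cat_scheme"
    and D :: "('k, 'p, 'n, 'y) lin_cat_scheme" +
  fixes F :: "('o, 'm, 'p, 'n) func"
  assumes linear: "linear_functor K C D F"
begin

lemma fob_closed [simp]: "X \<in> Obj C \<Longrightarrow> fob F X \<in> Obj D"
  using linear by (auto simp: linear_functor_def)

lemma fmor_hom: "\<lbrakk>X \<in> Obj C; Y \<in> Obj C\<rbrakk> \<Longrightarrow>
    abelian_group_hom (Hom C X Y) (Hom D (fob F X) (fob F Y)) (fmor F X Y)"
  using linear dom.Hom_module cod.Hom_module
  by (intro linear_map_group_hom[of K]) (auto simp: linear_functor_def)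

lemma fmor_arr [simp]: "dom.arr X Y f \<Longrightarrow> cod.arr (fob F X) (fob F Y) (fmor F X Y f)"
  using abelian_group_hom.hom_closed[OF fmor_hom[of X Y]]
  by (auto simp: dom.arr_def cod.arr_def)

lemma fmor_neg: "dom.arr X Y f \<Longrightarrow>
    fmor F X Y (\<ominus>\<^bsub>Hom C X Y\<^esub> f) = \<ominus>\<^bsub>Hom D (fob F X) (fob F Y)\<^esub> fmor F X Y f"
  using abelian_group_hom.hom_a_inv[OF fmor_hom[of X Y]] by (auto simp: dom.arr_def)

lemma fmor_zero: "\<lbrakk>X \<in> Obj C; Y \<in> Obj C\<rbrakk> \<Longrightarrow>
    fmor F X Y \<zero>\<^bsub>Hom C X Y\<^esub> = \<zero>\<^bsub>Hom D (fob F X) (fob F Y)\<^esub>"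
  using abelian_group_hom.hom_zero[OF fmor_hom[of X Y]] by auto

lemma fmor_id: "X \<in> Obj C \<Longrightarrow> fmor F X X (Idm C X) = Idm D (fob F X)"
  using linear by (auto simp: linear_functor_def)

lemma fmor_comp: "\<lbrakk>dom.arr X Y f; dom.arr Y Z g\<rbrakk> \<Longrightarrow>
    fmor F X Z (Comp C X Y Z g f) =
    Comp D (fob F X) (fob F Y) (fob F Z) (fmor F Y Z g) (fmor F X Y f)"
  using linear unfolding linear_functor_def dom.arr_def by blast

lemma fmor_retract:
  "\<lbrakk>dom.arr X Y i; dom.arr Y X p; Comp C X Y X p i = Idm C X\<rbrakk> \<Longrightarrow>
    Comp D (fob F X) (fob F Y) (fob F X) (fmor F Y X p) (fmor F X Y i) = Idm D (fob F X)"
  using fmor_comp[of X Y i X p] fmor_id[of X] by (simp add: dom.arr_obj)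

lemma fmor_inv_pair: "dom.inv_pair X Y f g \<Longrightarrow>
    cod.inv_pair (fob F X) (fob F Y) (fmor F X Y f) (fmor F Y X g)"
  by (auto simp: dom.inv_pair_def cod.inv_pair_def fmor_retract)

lemma fob_isomorphic: "isomorphic C X Y \<Longrightarrow> isomorphic D (fob F X) (fob F Y)"
  unfolding dom.isomorphic_iff cod.isomorphic_iff by (elim exE) (rule exI, rule exI, rule fmor_inv_pair)

lemma fob_retract: "dom.retract X Y \<Longrightarrow> cod.retract (fob F X) (fob F Y)"
  using fmor_retract fmor_arr unfolding dom.retract_def cod.retract_def by (elim exE conjE) (intro exI conjI)

lemma fob_zero_obj: "is_zero_obj C Z \<Longrightarrow> is_zero_obj D (fob F Z)"
  using fmor_id[of Z] fmor_zero[of Z Z] by (simp add: cod.zero_obj_iff dom.zero_obj_iff)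

end

lemma nat_isomorphic_obj:
  assumes "nat_isomorphic C D F G" "X \<in> Obj C" "fob F X \<in> Obj D" "fob G X \<in> Obj D"
  shows "isomorphic D (fob F X) (fob G X)"
  using assms by (auto simp: nat_isomorphic_def nat_iso_def isomorphic_def)

section \<open>Triangulated categories\<close>

context linear_category
begin

lemma quasi_inverse_faithful:
  assumes FG: "linear_functor K C C F" "linear_functor K C C G"
    and "nat_isomorphic C C (G \<circ>\<circ> F) fid"
    and f: "arr X Y f" and g: "arr X Y g" and eq: "fmor F X Y f = fmor F X Y g"
  shows "f = g"
proof -
  interpret F: linear_functor_between K C C F using FG by unfold_locales
  interpret G: linear_functor_between K C C G using FG by unfold_locales
  have XY: "X \<in> Obj C" "Y \<in> Obj C" using f by (auto simp: arr_def)
  obtain \<alpha> where \<alpha>: "nat_iso C C (G \<circ>\<circ> F) fid \<alpha>"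
    using assms(3) by (auto simp: nat_isomorphic_def)
  have nat: "Comp C (fob G (fob F X)) X Y k (\<alpha> X) =
      Comp C (fob G (fob F X)) (fob G (fob F Y)) Y (\<alpha> Y) (fmor G (fob F X) (fob F Y) (fmor F X Y k))"
    if "arr X Y k" for k
    using that \<alpha> by (auto simp: nat_iso_def nat_trans_def fid_def fcomp_def arr_def)
  have "is_iso C (fob G (fob F X)) X (\<alpha> X)"
    using \<alpha> XY by (auto simp: nat_iso_def fid_def fcomp_def)
  then obtain a where a: "inv_pair (fob G (fob F X)) X (\<alpha> X) a"
    using XY by (auto simp: is_iso_inv_pair)
  have "Comp C X (fob G (fob F X)) Y (Comp C (fob G (fob F X)) X Y k (\<alpha> X)) a = k"
    if "arr X Y k" for k
    using a that by (simp add: inv_pair_def comp_assoc)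
  then show ?thesis using nat[OF f] nat[OF g] f g eq by metis
qed

text \<open>Conjugating \<open>G k\<close> by the natural isomorphism from
  \<open>G \<circ>\<circ> F\<close> to the identity gives a candidate \<open>f\<close>, for which
  naturality yields \<open>G (F f) = G k\<close>. Faithfulness of \<open>G\<close>, obtained from
  the other natural isomorphism, then gives \<open>F f = k\<close>.\<close>

lemma quasi_inverse_full:
  assumes FG: "linear_functor K C C F" "linear_functor K C C G"
    and GF_id: "nat_isomorphic C C (G \<circ>\<circ> F) fid" and FG_id: "nat_isomorphic C C (F \<circ>\<circ> G) fid"
    and XY: "X \<in> Obj C" "Y \<in> Obj C" and k: "arr (fob F X) (fob F Y) k"
  shows "\<exists>f. arr X Y f \<and> fmor F X Y f = k"
proof -
  interpret F: linear_functor_between K C C F using FG by unfold_locales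
  interpret G: linear_functor_between K C C G using FG by unfold_locales
  let ?X = "fob G (fob F X)" and ?Y = "fob G (fob F Y)"
  obtain \<alpha> where \<alpha>: "nat_iso C C (G \<circ>\<circ> F) fid \<alpha>"
    using GF_id by (auto simp: nat_isomorphic_def)
  have nat: "Comp C ?X X Y f (\<alpha> X) =
      Comp C ?X ?Y Y (\<alpha> Y) (fmor G (fob F X) (fob F Y) (fmor F X Y f))"
    if "arr X Y f" for f
    using that \<alpha> by (auto simp: nat_iso_def nat_trans_def fid_def fcomp_def arr_def)
  have "is_iso C ?X X (\<alpha> X)" "is_iso C ?Y Y (\<alpha> Y)"
    using \<alpha> XY by (auto simp: nat_iso_def fid_def fcomp_def)
  then obtain a b where a: "inv_pair ?X X (\<alpha> X) a" and b: "inv_pair ?Y Y (\<alpha> Y) b"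
    using XY by (auto simp: is_iso_inv_pair)
  have Gk: "arr ?X ?Y (fmor G (fob F X) (fob F Y) k)" using k by simp
  define f where "f = Comp C X ?X Y (Comp C ?X ?Y Y (\<alpha> Y) (fmor G (fob F X) (fob F Y) k)) a"
  have f: "arr X Y f" using a b Gk by (simp add: f_def inv_pair_def)
  have "Comp C ?X X Y f (\<alpha> X) = Comp C ?X ?Y Y (\<alpha> Y) (fmor G (fob F X) (fob F Y) k)"
    using a b Gk by (simp add: f_def inv_pair_def comp_cancel_right[of ?X X "\<alpha> X" a])
  then have "Comp C ?X ?Y Y (\<alpha> Y) (fmor G (fob F X) (fob F Y) (fmor F X Y f)) =
      Comp C ?X ?Y Y (\<alpha> Y) (fmor G (fob F X) (fob F Y) k)"
    using nat[OF f] by simp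
  then have "Comp C ?X Y ?Y b (Comp C ?X ?Y Y (\<alpha> Y) (fmor G (fob F X) (fob F Y) (fmor F X Y f))) =
      Comp C ?X Y ?Y b (Comp C ?X ?Y Y (\<alpha> Y) (fmor G (fob F X) (fob F Y) k))"
    by simp
  then have "fmor G (fob F X) (fob F Y) (fmor F X Y f) = fmor G (fob F X) (fob F Y) k"
    using b f Gk by (simp add: inv_pair_def comp_cancel_left[of ?Y Y "\<alpha> Y" b])
  then have "fmor F X Y f = k"
    using quasi_inverse_faithful[OF FG(2,1) FG_id] f k F.fmor_arr by blast
  then show ?thesis using f by blast
qed

end

section \<open>Rotation and shifting of exact triangles\<close>

sublocale triangulated_category \<subseteq> Sh: linear_functor_between K C C "Shift C"
  by unfold_locales (rule Shift_functor)

sublocale triangulated_category \<subseteq> Un: linear_functor_between K C C "Unshift C"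
  by unfold_locales (rule Unshift_functor)

context triangulated_category
begin

abbreviation sh :: "'o \<Rightarrow> 'o" where "sh \<equiv> fob (Shift C)"
abbreviation un :: "'o \<Rightarrow> 'o" where "un \<equiv> fob (Unshift C)"
abbreviation shm :: "'o \<Rightarrow> 'o \<Rightarrow> 'm \<Rightarrow> 'm" where "shm \<equiv> fmor (Shift C)"

lemma sh_un: "X \<in> Obj C \<Longrightarrow> isomorphic C (sh (un X)) X"
  using nat_isomorphic_obj[OF Shift_Unshift, of X] by (simp add: fid_def fcomp_def)

lemma un_sh: "X \<in> Obj C \<Longrightarrow> isomorphic C (un (sh X)) X"
  using nat_isomorphic_obj[OF Unshift_Shift, of X] by (simp add: fid_def fcomp_def)

lemma shift_faithful: "\<lbrakk>arr X Y f; arr X Y g; shm X Y f = shm X Y g\<rbrakk> \<Longrightarrow> f = g"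
  using quasi_inverse_faithful[OF Shift_functor Unshift_functor Unshift_Shift] by blast

lemma shift_full: "\<lbrakk>X \<in> Obj C; Y \<in> Obj C; arr (sh X) (sh Y) k\<rbrakk> \<Longrightarrow> \<exists>f. arr X Y f \<and> shm X Y f = k"
  using quasi_inverse_full[OF Shift_functor Unshift_functor Unshift_Shift Shift_Unshift] by blast

text \<open>Rotation puts a minus sign on the shifted morphism; here the sign is absorbed into the
  preimage.\<close>

lemma shift_full_neg:
  assumes "X \<in> Obj C" "Y \<in> Obj C" "arr (sh X) (sh Y) k"
  obtains f where "arr X Y f" "\<ominus>\<^bsub>Hom C (sh X) (sh Y)\<^esub> shm X Y f = k"
proof -
  obtain f where f: "arr X Y f" "shm X Y f = k" using shift_full assms by blast
  then have "\<ominus>\<^bsub>Hom C (sh X) (sh Y)\<^esub> shm X Y (\<ominus>\<^bsub>Hom C X Y\<^esub> f) = k"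
    using assms by (simp add: Sh.fmor_neg)
  then show ?thesis using f that arr_neg by blast
qed

lemma retract_unshift:
  assumes "retract (sh X) (sh Y)" "X \<in> Obj C" "Y \<in> Obj C"
  shows "retract X Y"
proof -
  have "retract X (un (sh X))" "retract (un (sh Y)) Y"
    using assms un_sh isomorphic_retract isomorphic_sym by blast+
  then show ?thesis using Un.fob_retract[OF assms(1)] retract_trans by blast
qed

lemma Tri_arr:
  assumes "(X, Y, Z, f, g, h) \<in> Tri C"
  shows "arr X Y f" "arr Y Z g" "arr Z (sh X) h"
  using Tri_is_triangle[OF assms] by (auto simp: is_triangle_def arr_def)

lemma Tri_rotate_iff:
  assumes "arr X Y f" "arr Y Z g" "arr Z (sh X) h"
  shows "(X, Y, Z, f, g, h) \<in> Tri C \<longleftrightarrow>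
    (Y, Z, sh X, g, h, \<ominus>\<^bsub>Hom C (sh X) (sh Y)\<^esub> shm X Y f) \<in> Tri C"
  using assms by (intro TR2) (auto simp: is_triangle_def arr_def)

lemma Tri_rotate:
  assumes "(X, Y, Z, f, g, h) \<in> Tri C"
  shows "(Y, Z, sh X, g, h, \<ominus>\<^bsub>Hom C (sh X) (sh Y)\<^esub> shm X Y f) \<in> Tri C"
  using assms Tri_rotate_iff[OF Tri_arr[OF assms]] by simp

lemma Tri_iso:
  assumes t: "(X, Y, Z, f, g, h) \<in> Tri C"
    and a: "inv_pair X X' a a'" and b: "inv_pair Y Y' b b'" and c: "inv_pair Z Z' c c'"
  shows "(X', Y', Z', Comp C X' X Y' (Comp C X Y Y' b f) a', Comp C Y' Y Z' (Comp C Y Z Z' c g) b',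
    Comp C Z' Z (sh X') (Comp C Z (sh X) (sh X') (shm X X' a) h) c') \<in> Tri C"
proof (rule TR1_iso[OF t])
  note fgh = Tri_arr[OF t]
  note ab = a[unfolded inv_pair_def] b[unfolded inv_pair_def] c[unfolded inv_pair_def]
  let ?f = "Comp C X' X Y' (Comp C X Y Y' b f) a'"
  let ?g = "Comp C Y' Y Z' (Comp C Y Z Z' c g) b'"
  let ?h = "Comp C Z' Z (sh X') (Comp C Z (sh X) (sh X') (shm X X' a) h) c'"
  have arrs: "arr X' Y' ?f" "arr Y' Z' ?g" "arr Z' (sh X') ?h"
    using fgh ab by simp_all
  have "Comp C X Y Y' b f = Comp C X X' Y' ?f a"
    "Comp C Y Z Z' c g = Comp C Y Y' Z' ?g b"
    "Comp C Z (sh X) (sh X') (shm X X' a) h = Comp C Z Z' (sh X') ?h c"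
    using fgh ab by (simp_all add: comp_cancel_right)
  then show "isomorphic_triangles C (Shift C) (X, Y, Z, f, g, h) (X', Y', Z', ?f, ?g, ?h)"
    using Tri_is_triangle[OF t] arrs inv_pair_is_iso[OF a] inv_pair_is_iso[OF b] inv_pair_is_iso[OF c]
    by (auto simp: isomorphic_triangles_def is_triangle_def arr_def)
qed

text \<open>A tower asks only for the existence of triangles on given objects, so the three
  morphisms are forgotten.\<close>

definition tri :: "'o \<Rightarrow> 'o \<Rightarrow> 'o \<Rightarrow> bool" where
  "tri X Y Z \<longleftrightarrow> (\<exists>f g h. (X, Y, Z, f, g, h) \<in> Tri C)"

lemma tri_obj: "tri X Y Z \<Longrightarrow> X \<in> Obj C" "tri X Y Z \<Longrightarrow> Y \<in> Obj C" "tri X Y Z \<Longrightarrow> Z \<in> Obj C"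
  unfolding tri_def by (elim exE, frule Tri_arr(1), erule arr_obj)+ (elim exE, frule Tri_arr(2), erule arr_obj)

lemma tri_iso:
  assumes "tri X Y Z" "isomorphic C X X'" "isomorphic C Y Y'" "isomorphic C Z Z'"
  shows "tri X' Y' Z'"
  using assms Tri_iso unfolding tri_def isomorphic_iff by blast

lemma tri_rotate: "tri X Y Z \<Longrightarrow> tri Y Z (sh X)"
  unfolding tri_def by (auto dest: Tri_rotate)

lemma Tri_shift_iff:
  assumes "arr X Y f" "arr Y Z g" "arr Z (sh X) h"
  shows "(X, Y, Z, f, g, h) \<in> Tri C \<longleftrightarrow>
    (sh X, sh Y, sh Z, \<ominus>\<^bsub>Hom C (sh X) (sh Y)\<^esub> shm X Y f,
      \<ominus>\<^bsub>Hom C (sh Y) (sh Z)\<^esub> shm Y Z g, \<ominus>\<^bsub>Hom C (sh Z) (sh (sh X))\<^esub> shm Z (sh X) h) \<in> Tri C"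
  using assms by (simp add: Tri_rotate_iff[of X] Tri_rotate_iff[of Y] Tri_rotate_iff[of Z])

text \<open>\<open>Unshift\<close> is given as a linear quasi-inverse, without an axiom about
  triangles. Its effect on them comes from this equivalence: the shift is full, so the morphisms of
  a shifted triangle have preimages, and three rotations can be undone.\<close>

lemma tri_shift_iff:
  assumes "X \<in> Obj C" "Y \<in> Obj C" "Z \<in> Obj C"
  shows "tri (sh X) (sh Y) (sh Z) \<longleftrightarrow> tri X Y Z"
proof
  assume "tri (sh X) (sh Y) (sh Z)"
  then obtain f' g' h' where t: "(sh X, sh Y, sh Z, f', g', h') \<in> Tri C" by (auto simp: tri_def)
  note fgh = Tri_arr[OF t]
  obtain f where f: "arr X Y f" "\<ominus>\<^bsub>Hom C (sh X) (sh Y)\<^esub> shm X Y f = f'"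
    using shift_full_neg assms fgh by metis
  obtain g where g: "arr Y Z g" "\<ominus>\<^bsub>Hom C (sh Y) (sh Z)\<^esub> shm Y Z g = g'"
    using shift_full_neg assms fgh by metis
  obtain h where h: "arr Z (sh X) h" "\<ominus>\<^bsub>Hom C (sh Z) (sh (sh X))\<^esub> shm Z (sh X) h = h'"
    using shift_full_neg assms fgh Sh.fob_closed by metis
  have "(X, Y, Z, f, g, h) \<in> Tri C"
    using t f g h by (simp add: Tri_shift_iff)
  then show "tri X Y Z" by (auto simp: tri_def)
next
  assume "tri X Y Z"
  then show "tri (sh X) (sh Y) (sh Z)" by (simp add: tri_rotate)
qed

lemma tri_shift: "tri X Y Z \<Longrightarrow> tri (sh X) (sh Y) (sh Z)"
  by (simp add: tri_rotate)

lemma tri_unshift: "tri X Y Z \<Longrightarrow> tri (un X) (un Y) (un Z)"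
  using tri_iso[of X Y Z "sh (un X)" "sh (un Y)" "sh (un Z)"] tri_obj[of X Y Z]
  by (simp add: tri_shift_iff[symmetric] isomorphic_sym sh_un)

text \<open>One rotation turns this into the triangle on the identity of \<open>X\<close>, because
  the shift of a zero object is a zero object.\<close>

lemma tri_zero_left:
  assumes Z: "is_zero_obj C Z" and X: "X \<in> Obj C"
  shows "(Z, X, X, \<zero>\<^bsub>Hom C Z X\<^esub>, Idm C X, \<zero>\<^bsub>Hom C X (sh Z)\<^esub>) \<in> Tri C"
proof -
  have "Z \<in> Obj C" using Z by (simp add: is_zero_obj_def)
  then show ?thesis
    using TR1_id[OF X Sh.fob_zero_obj[OF Z]] X by (simp add: Tri_rotate_iff Sh.fmor_zero)
qed

text \<open>\<open>k\<close> and the zero map form a square from the given triangle to the triangle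
  on a zero object, \<open>W\<close> and \<open>W\<close>; the third map supplied by TR3 is the
  factorisation.\<close>

lemma weak_cokernel:
  assumes t: "(X, Y, Z, f, g, h) \<in> Tri C" and k: "arr Y W k"
    and kf: "Comp C X Y W k f = \<zero>\<^bsub>Hom C X W\<^esub>"
  obtains v where "arr Z W v" "k = Comp C Y Z W v g"
proof -
  obtain N where N: "is_zero_obj C N" using zero_obj by blast
  note NO = zero_obj_obj[OF N]
  note fgh = Tri_arr[OF t]
  note obj = arr_obj[OF fgh(1)] arr_obj[OF k] arr_obj[OF fgh(2)]
  have sq: "Comp C X Y W k f = Comp C X N W \<zero>\<^bsub>Hom C N W\<^esub> \<zero>\<^bsub>Hom C X N\<^esub>"
    using kf NO obj by simp
  have "\<zero>\<^bsub>Hom C X N\<^esub> \<in> mor C X N" using NO obj arr_mor by simp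
  then show ?thesis
    using TR3[OF t tri_zero_left[OF N obj(4)] _ arr_mor[OF k] sq] that k obj
    by (metis arrI comp_id_left)
qed

text \<open>TR3 completes only the third map of a morphism of triangles. Both triangles are
  therefore rotated until the unknown is a map \<open>sh W \<rightarrow> sh X\<close>, which is
  brought back by fullness of the shift; both sides of the resulting equation carry the same sign,
  and faithfulness removes the shift.\<close>

lemma weak_kernel:
  assumes t: "(X, Y, Z, f, g, h) \<in> Tri C" and y: "arr W Y y"
    and gy: "Comp C W Y Z g y = \<zero>\<^bsub>Hom C W Z\<^esub>"
  obtains k where "arr W X k" "y = Comp C W X Y f k"
proof -
  obtain N where N: "is_zero_obj C N" using zero_obj by blast
  note NO = zero_obj_obj[OF N]
  note fgh = Tri_arr[OF t]
  note obj = arr_obj[OF fgh(1)] arr_obj[OF y] arr_obj[OF fgh(2)]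
  have sq: "Comp C W N Z \<zero>\<^bsub>Hom C N Z\<^esub> \<zero>\<^bsub>Hom C W N\<^esub> = Comp C W Y Z g y"
    using gy NO obj by simp
  have "\<zero>\<^bsub>Hom C N Z\<^esub> \<in> mor C N Z" using NO obj arr_mor by simp
  then obtain c where c: "arr (sh W) (sh X) c"
    and eq: "Comp C (sh W) (sh W) (sh Y) (shm W Y y) (\<ominus>\<^bsub>Hom C (sh W) (sh W)\<^esub> shm W W (Idm C W))
      = Comp C (sh W) (sh X) (sh Y) (\<ominus>\<^bsub>Hom C (sh X) (sh Y)\<^esub> shm X Y f) c"
    using TR3[OF Tri_rotate[OF TR1_id[OF obj(3) N]] Tri_rotate[OF t] arr_mor[OF y] _ sq]
    by (metis arrI Sh.fob_closed obj(1,3))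
  obtain k where k: "arr W X k" "shm W X k = c" using shift_full obj c by blast
  have "\<ominus>\<^bsub>Hom C (sh W) (sh Y)\<^esub> shm W Y y = \<ominus>\<^bsub>Hom C (sh W) (sh Y)\<^esub> shm W Y (Comp C W X Y f k)"
    using eq k c fgh y obj by (simp add: Sh.fmor_comp Sh.fmor_id comp_neg_left comp_neg_right)
  from arg_cong[OF this, of "a_inv (Hom C (sh W) (sh Y))"]
  have "shm W Y y = shm W Y (Comp C W X Y f k)"
    using k fgh y by simp
  then show ?thesis using shift_faithful[OF y, of "Comp C W X Y f k"] k fgh that by simp
qed

text \<open>Comparing the triangle on the identity of \<open>X\<close> with the given one by means
  of the identity and \<open>f\<close>, TR3 factors the composite through a zero object.\<close>

lemma Tri_comp_zero:
  assumes t: "(X, Y, Z, f, g, h) \<in> Tri C"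
  shows "Comp C X Y Z g f = \<zero>\<^bsub>Hom C X Z\<^esub>"
proof -
  obtain N where N: "is_zero_obj C N" using zero_obj by blast
  note NO = zero_obj_obj[OF N]
  note fgh = Tri_arr[OF t]
  note obj = arr_obj[OF fgh(1)] arr_obj[OF fgh(2)]
  have "\<exists>c\<in>mor C N Z. Comp C X N Z c \<zero>\<^bsub>Hom C X N\<^esub> = Comp C X Y Z g f"
    using TR3[OF TR1_id[OF obj(1) N] t, of "Idm C X" f] fgh obj arr_mor Idm_closed by auto
  then show ?thesis using NO obj arrI by force
qed

lemma tri_zero_right_retract: "\<lbrakk>tri X Z Y; is_zero_obj C Y\<rbrakk> \<Longrightarrow> retract Z X"
proof -
  assume "tri X Z Y" and Y: "is_zero_obj C Y"
  then obtain f g h where t: "(X, Z, Y, f, g, h) \<in> Tri C" by (auto simp: tri_def)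
  note fgh = Tri_arr[OF t]
  have "Comp C Z Z Y g (Idm C Z) = \<zero>\<^bsub>Hom C Z Y\<^esub>" using fgh Y to_zero_obj by simp
  then obtain k where "arr Z X k" "Idm C Z = Comp C Z X Z f k"
    using weak_kernel[OF t] arr_obj[OF fgh(2)] arr_id by blast
  then show ?thesis using fgh unfolding retract_def by metis
qed

text \<open>The endomorphism \<open>u = c' c\<close> of \<open>Z\<close> supplied by TR3 satisfies \<open>u g = g\<close> and \<open>h u = h\<close>.
  By the first equation \<open>u - 1 = v h\<close> for some \<open>v\<close>, and by the second \<open>1 - v h\<close> is a left
  inverse of \<open>u\<close>.\<close>

lemma cone_retract:
  assumes t: "(X, Y, Z, f, g, h) \<in> Tri C" and t': "(X', Y', Z', f', g', h') \<in> Tri C"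
    and i: "arr X X' i" "arr X' X p" "Comp C X X' X p i = Idm C X"
    and j: "arr Y Y' j" "arr Y' Y q" "Comp C Y Y' Y q j = Idm C Y"
    and sq: "Comp C X Y Y' j f = Comp C X X' Y' f' i" "Comp C X' Y' Y q f' = Comp C X' X Y f p"
  shows "retract Z Z'"
proof -
  note fgh = Tri_arr[OF t] and fgh' = Tri_arr[OF t']
  have obj: "X \<in> Obj C" "Y \<in> Obj C" "Z \<in> Obj C" "X' \<in> Obj C" "Y' \<in> Obj C" "Z' \<in> Obj C"
    using fgh fgh' by (auto simp: arr_obj)
  obtain c where c: "arr Z Z' c" "Comp C Y Z Z' c g = Comp C Y Y' Z' g' j"
    "Comp C Z (sh X) (sh X') (shm X X' i) h = Comp C Z Z' (sh X') h' c"
    using TR3[OF t t' arr_mor[OF i(1)] arr_mor[OF j(1)] sq(1)] arrI obj by metis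
  obtain c' where c': "arr Z' Z c'" "Comp C Y' Z' Z c' g' = Comp C Y' Y Z g q"
    "Comp C Z' (sh X') (sh X) (shm X' X p) h' = Comp C Z' Z (sh X) h c'"
    using TR3[OF t' t arr_mor[OF i(2)] arr_mor[OF j(2)] sq(2)] arrI obj by metis
  define u where "u = Comp C Z Z' Z c' c"
  have u: "arr Z Z u" using c c' by (simp add: u_def)
  have "Comp C Y Z Z u g = Comp C Y Z' Z c' (Comp C Y Y' Z' g' j)"
    using c c' fgh by (simp add: u_def comp_assoc)
  also have "\<dots> = Comp C Y Y' Z (Comp C Y' Y Z g q) j"
    using c' fgh' j by (simp add: comp_assoc[symmetric])
  also have "\<dots> = g" using fgh j by (simp add: comp_assoc)
  finally have ug: "Comp C Y Z Z u g = g" .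
  have "Comp C Z Z (sh X) h u = Comp C Z Z' (sh X) (Comp C Z' (sh X') (sh X) (shm X' X p) h') c"
    using c c' fgh by (simp add: u_def comp_assoc)
  also have "\<dots> = Comp C Z (sh X') (sh X) (shm X' X p) (Comp C Z (sh X) (sh X') (shm X X' i) h)"
    using c fgh' i by (simp add: comp_assoc)
  also have "\<dots> = h"
    using fgh i by (simp add: comp_assoc[symmetric] Sh.fmor_retract)
  finally have hu: "Comp C Z Z (sh X) h u = h" .
  have "Comp C Y Z Z (u \<ominus>\<^bsub>Hom C Z Z\<^esub> Idm C Z) g = \<zero>\<^bsub>Hom C Y Z\<^esub>"
    using fgh u ug obj by (simp add: comp_minus_left minus_self)
  then obtain v where v: "arr (sh X) Z v" "u \<ominus>\<^bsub>Hom C Z Z\<^esub> Idm C Z = Comp C Z (sh X) Z v h"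
    using weak_cokernel[OF Tri_rotate[OF t], of Z "u \<ominus>\<^bsub>Hom C Z Z\<^esub> Idm C Z"] u obj by auto
  define w where "w = Idm C Z \<ominus>\<^bsub>Hom C Z Z\<^esub> Comp C Z (sh X) Z v h"
  have w: "arr Z Z w" using v fgh obj by (simp add: w_def)
  have "Comp C Z Z Z w u = u \<ominus>\<^bsub>Hom C Z Z\<^esub> Comp C Z (sh X) Z v h"
    using u v fgh obj hu by (simp add: w_def comp_minus_left comp_assoc)
  also have "\<dots> = Idm C Z"
    using u v(2) obj minus_minus[of Z Z u "Idm C Z"] by simp
  finally have "Comp C Z Z' Z (Comp C Z' Z Z w c') c = Idm C Z"
    using c c' w by (simp add: u_def comp_assoc)
  then show ?thesis using c c' w unfolding retract_def by (metis arr_comp)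
qed

text \<open>\<open>Tri_unrotate\<close> requires a third vertex that is literally a shift; the cone
  is replaced by an isomorphic object of that form.\<close>

lemma cone_shift:
  assumes f: "arr X Y f"
  obtains W g h where "W \<in> Obj C" "(X, Y, sh W, f, g, h) \<in> Tri C"
proof -
  note obj = arr_obj[OF f]
  obtain V g h where t: "(X, Y, V, f, g, h) \<in> Tri C" using TR1_cone obj arr_mor[OF f] by blast
  then have V: "V \<in> Obj C" using arr_obj(2)[OF Tri_arr(2)[OF t]] by simp
  then obtain a b where "inv_pair V (sh (un V)) a b"
    using sh_un isomorphic_sym isomorphic_iff by blast
  from Tri_iso[OF t inv_pair_id[OF obj(1)] inv_pair_id[OF obj(2)] this] f
  have "\<exists>g h. (X, Y, sh (un V), f, g, h) \<in> Tri C" by auto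
  then show ?thesis using that V Un.fob_closed by blast
qed

lemma Tri_unrotate:
  assumes t: "(Y, Z, sh X, g, h, k) \<in> Tri C" and X: "X \<in> Obj C"
  obtains f where "(X, Y, Z, f, g, h) \<in> Tri C"
proof -
  note ghk = Tri_arr[OF t]
  obtain f where "arr X Y f" "\<ominus>\<^bsub>Hom C (sh X) (sh Y)\<^esub> shm X Y f = k"
    using shift_full_neg X ghk(3) arr_obj[OF ghk(1)] by metis
  then show ?thesis using t ghk that Tri_rotate_iff[of X Y f Z g h] by simp
qed

text \<open>TR1 completes a morphism placed first in a triangle. Rotating back twice completes one
  that is placed last.\<close>

lemma fibre:
  assumes h: "arr Z (sh X) h" and X: "X \<in> Obj C"
  obtains Y f g where "(X, Y, Z, f, g, h) \<in> Tri C"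
proof -
  obtain Y u v where Y: "Y \<in> Obj C" and t: "(Z, sh X, sh Y, h, u, v) \<in> Tri C"
    using cone_shift[OF h] by metis
  obtain g where "(Y, Z, sh X, g, h, u) \<in> Tri C" using Tri_unrotate[OF t Y] by metis
  then show ?thesis using Tri_unrotate X that by metis
qed

text \<open>An extension is governed by its connecting morphism. That of the new triangle is
  \<open>h\<close> conjugated with the retraction data; after two rotations \<open>sh Z\<close> and
  \<open>sh Z'\<close> are the cones of \<open>h\<close> and \<open>h'\<close>, and
  \<open>cone_retract\<close> compares them.\<close>

lemma tri_retract:
  assumes "tri X Z Y" "retract X X'" "retract Y Y'"
  obtains Z' where "tri X' Z' Y'" "retract Z Z'"
proof -
  obtain f g h where t: "(X, Z, Y, f, g, h) \<in> Tri C" using assms(1) by (auto simp: tri_def)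
  note fgh = Tri_arr[OF t]
  obtain i p where i: "arr X X' i" "arr X' X p" "Comp C X X' X p i = Idm C X"
    using assms(2) by (auto simp: retract_def)
  obtain j q where j: "arr Y Y' j" "arr Y' Y q" "Comp C Y Y' Y q j = Idm C Y"
    using assms(3) by (auto simp: retract_def)
  define h' where "h' = Comp C Y' (sh X) (sh X') (shm X X' i) (Comp C Y' Y (sh X) h q)"
  have h': "arr Y' (sh X') h'" using fgh i j by (simp add: h'_def)
  obtain Z' f' g' where t': "(X', Z', Y', f', g', h') \<in> Tri C"
    using fibre[OF h' retract_obj(2)[OF assms(2)]] by metis
  have "Comp C Y (sh X) (sh X') (shm X X' i) h = Comp C Y Y' (sh X') h' j"
    "Comp C Y' (sh X') (sh X) (shm X' X p) h' = Comp C Y' Y (sh X) h q"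
    using fgh i j by (simp_all add: h'_def comp_assoc comp_cancel_left Sh.fmor_retract)
  then have "retract (sh Z) (sh Z')"
    using i j by (intro cone_retract[OF Tri_rotate[OF Tri_rotate[OF t]] Tri_rotate[OF Tri_rotate[OF t']]
      j, of "shm X X' i" "shm X' X p"]) (simp_all add: Sh.fmor_retract)
  then have "retract Z Z'"
    using retract_unshift arr_obj[OF fgh(1)] arr_obj[OF Tri_arr(1)[OF t']] by blast
  then show ?thesis using t' that by (auto simp: tri_def)
qed

text \<open>Reassociates an iterated extension, so that the top piece \<open>E\<close> of
  \<open>Y\<close> becomes the top piece of \<open>Z\<close>. The shift of \<open>W\<close> is the
  cone of the composite \<open>Z \<rightarrow> Y \<rightarrow> E\<close>, and TR4 relates it to the
  cones of the two factors.\<close>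

lemma octahedral:
  assumes "tri X Z Y" "tri Y' Y E"
  obtains W where "tri W Z E" "tri X W Y'"
proof -
  obtain f g h where t: "(X, Z, Y, f, g, h) \<in> Tri C" using assms(1) by (auto simp: tri_def)
  obtain f' g' h' where t': "(Y', Y, E, f', g', h') \<in> Tri C" using assms(2) by (auto simp: tri_def)
  have "arr Z E (Comp C Z Y E g' g)" using Tri_arr(2)[OF t] Tri_arr(2)[OF t'] by simp
  then obtain W k k' where W: "W \<in> Obj C"
    and t'': "(Z, E, sh W, Comp C Z Y E g' g, k, k') \<in> Tri C"
    using cone_shift by metis
  have "tri (sh X) (sh W) (sh Y')"
    using TR4[OF Tri_rotate[OF t] Tri_rotate[OF t'] t''] unfolding tri_def by blast
  then have "tri X W Y'" using tri_shift_iff W tri_obj assms by blast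
  moreover have "tri W Z E" using Tri_unrotate[OF t'' W] unfolding tri_def by metis
  ultimately show ?thesis using that by blast
qed

text \<open>The complement is the cone of the split monomorphism \<open>i\<close>. Since the shift
  of \<open>i\<close> is split as well, the connecting morphism vanishes, and hence \<open>g\<close>
  has a section.\<close>

lemma retract_biproduct:
  assumes "retract X Z"
  obtains Y where "is_biproduct C X Y Z"
proof -
  obtain i p where i: "arr X Z i" and p: "arr Z X p" and pi: "Comp C X Z X p i = Idm C X"
    using assms by (auto simp: retract_def)
  obtain Y g h where t: "(X, Z, Y, i, g, h) \<in> Tri C"
    using TR1_cone arr_mor[OF i] arr_obj[OF i] by blast
  note fgh = Tri_arr[OF t]
  have obj: "X \<in> Obj C" "Y \<in> Obj C" "Z \<in> Obj C" using fgh by (auto simp: arr_obj)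
  have gi: "Comp C X Z Y g i = \<zero>\<^bsub>Hom C X Y\<^esub>" using Tri_comp_zero[OF t] .
  have "Comp C Y (sh X) (sh Z) (\<ominus>\<^bsub>Hom C (sh X) (sh Z)\<^esub> shm X Z i) h = \<zero>\<^bsub>Hom C Y (sh Z)\<^esub>"
    using Tri_comp_zero[OF Tri_rotate[OF Tri_rotate[OF t]]] .
  then have ih: "Comp C Y (sh X) (sh Z) (shm X Z i) h = \<zero>\<^bsub>Hom C Y (sh Z)\<^esub>"
    using fgh i by (simp add: comp_neg_left neg_eq_zero_iff)
  have "h = Comp C Y (sh Z) (sh X) (shm Z X p) (Comp C Y (sh X) (sh Z) (shm X Z i) h)"
    using fgh i p pi by (simp add: comp_cancel_left Sh.fmor_retract)
  then have "h = \<zero>\<^bsub>Hom C Y (sh X)\<^esub>" using ih p obj by simp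
  then obtain j where j: "arr Y Z j" "Idm C Y = Comp C Y Z Y g j"
    using weak_kernel[OF Tri_rotate[OF t], of Y "Idm C Y"] obj by (metis arr_id comp_id_right arr_zero Sh.fob_closed)
  \<comment> \<open>The section \<open>j\<close> need not be annihilated by \<open>p\<close>;
    removing its component in the image of \<open>i\<close> achieves this and leaves
    \<open>g j\<close> unchanged, as \<open>g i = 0\<close>.\<close>
  define j' where "j' = j \<ominus>\<^bsub>Hom C Y Z\<^esub> Comp C Y X Z i (Comp C Y Z X p j)"
  have j': "arr Y Z j'" using i p j by (simp add: j'_def)
  have pj': "Comp C Y Z X p j' = \<zero>\<^bsub>Hom C Y X\<^esub>"
    using i p j pi by (simp add: j'_def comp_minus_right comp_cancel_left minus_self)
  have "Comp C Y Z Y g (Comp C Y X Z i (Comp C Y Z X p j)) = \<zero>\<^bsub>Hom C Y Y\<^esub>"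
    using i p j fgh gi obj by (simp add: comp_assoc[symmetric])
  then have gj': "Comp C Y Z Y g j' = Idm C Y"
    using i p j fgh obj by (simp add: j'_def comp_minus_right minus_zero)
  define s where "s = Comp C Z X Z i p \<oplus>\<^bsub>Hom C Z Z\<^esub> Comp C Z Y Z j' g"
  have s: "arr Z Z s" using i p j' fgh by (simp add: s_def)
  \<comment> \<open>\<open>y\<close> is the defect of the decomposition of the identity. It is
    killed by \<open>g\<close>, so it has the form \<open>i k\<close>, and then
    \<open>k = p y = 0\<close>.\<close>
  define y where "y = Idm C Z \<ominus>\<^bsub>Hom C Z Z\<^esub> s"
  have y: "arr Z Z y" using s obj by (simp add: y_def)
  have "Comp C Z Z X p s = p"
    using i p j' fgh pi pj' obj by (simp add: s_def comp_add_right comp_assoc[symmetric] add_zero)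
  then have py: "Comp C Z Z X p y = \<zero>\<^bsub>Hom C Z X\<^esub>"
    using p s obj by (simp add: y_def comp_minus_right minus_self)
  have "Comp C Z Z Y g s = g"
    using i p j' fgh gi gj' obj by (simp add: s_def comp_add_right comp_assoc[symmetric] add_zero)
  then have "Comp C Z Z Y g y = \<zero>\<^bsub>Hom C Z Y\<^esub>"
    using fgh s obj by (simp add: y_def comp_minus_right minus_self)
  then obtain k where k: "arr Z X k" "y = Comp C Z X Z i k"
    using weak_kernel[OF t y] by blast
  then have "y = \<zero>\<^bsub>Hom C Z Z\<^esub>"
    using i p pi py obj by (simp add: comp_cancel_left)
  then have s_id: "s = Idm C Z" using minus_eq_zero_iff[of Z Z "Idm C Z" s] s obj by (simp add: y_def)
  have "is_biproduct C X Y Z"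
    unfolding is_biproduct_def
    apply (intro conjI, (rule obj)+)
    apply (rule bexI[of _ i], rule bexI[of _ j'], rule bexI[of _ p], rule bexI[of _ g])
    using i p j' fgh pi pj' gi gj' s_id by (simp_all add: arr_mor s_def)
  then show ?thesis using that by blast
qed

end

section \<open>Towers and complexity\<close>

context triangulated_category
begin

abbreviation sp :: "int \<Rightarrow> 'o \<Rightarrow> 'o" where "sp n \<equiv> fob (shift_pow C n)"

lemma sp_0 [simp]: "sp 0 X = X"
  by (simp add: shift_pow_def fid_def)

lemma sp_up: "0 \<le> n \<Longrightarrow> sp (n + 1) X = sh (sp n X)"
  by (simp add: shift_pow_def nat_add_distrib fcomp_def)

lemma sp_down: "n \<le> 0 \<Longrightarrow> sp (n - 1) X = un (sp n X)"
proof -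
  assume "n \<le> 0"
  then have "nat (- (n - 1)) = Suc (nat (- n))" by simp
  then show ?thesis using \<open>n \<le> 0\<close> by (cases "n = 0") (auto simp: shift_pow_def fcomp_def fid_def)
qed

lemma sp_closed [simp]: "X \<in> Obj C \<Longrightarrow> sp n X \<in> Obj C"
  by (induction n rule: int_induct[where k = 0]) (auto simp: sp_up sp_down)

lemma sp_isomorphic: "isomorphic C X Y \<Longrightarrow> isomorphic C (sp n X) (sp n Y)"
  by (induction n rule: int_induct[where k = 0])
    (auto simp: sp_up sp_down Sh.fob_isomorphic Un.fob_isomorphic)

lemma sp_retract: "retract X Y \<Longrightarrow> retract (sp n X) (sp n Y)"
  by (induction n rule: int_induct[where k = 0])
    (auto simp: sp_up sp_down Sh.fob_retract Un.fob_retract)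

lemma sp_zero_obj: "is_zero_obj C X \<Longrightarrow> is_zero_obj C (sp n X)"
  by (induction n rule: int_induct[where k = 0])
    (auto simp: sp_up sp_down Sh.fob_zero_obj Un.fob_zero_obj)

lemma sp_tri: "tri X Y Z \<Longrightarrow> tri (sp n X) (sp n Y) (sp n Z)"
  by (induction n rule: int_induct[where k = 0]) (auto simp: sp_up sp_down tri_shift tri_unshift)

text \<open>Negative powers iterate \<open>Unshift\<close>, so for \<open>n < 0\<close> a shift and
  an unshift have to cancel, which they do only up to isomorphism.\<close>

lemma sh_sp: "X \<in> Obj C \<Longrightarrow> isomorphic C (sh (sp n X)) (sp (n + 1) X)"
  using sp_up[of n X] sp_down[of "n + 1" X] by (cases "0 \<le> n") (auto intro: sh_un)

lemma un_sp: "X \<in> Obj C \<Longrightarrow> isomorphic C (un (sp n X)) (sp (n - 1) X)"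
  using sp_down[of n X] sp_up[of "n - 1" X] by (cases "n \<le> 0") (auto intro: un_sh)

lemma sp_sp:
  assumes "X \<in> Obj C"
  shows "isomorphic C (sp m (sp n X)) (sp (m + n) X)"
proof (induction m rule: int_induct[where k = 0])
  case base
  then show ?case using assms by simp
next
  case (step1 i)
  then have "isomorphic C (sp (i + 1) (sp n X)) (sh (sp (i + n) X))"
    by (simp add: sp_up Sh.fob_isomorphic)
  then show ?case using isomorphic_trans[OF _ sh_sp[OF assms, of "i + n"]] by (simp add: ac_simps)
next
  case (step2 i)
  then have "isomorphic C (sp (i - 1) (sp n X)) (un (sp (i + n) X))"
    by (simp add: sp_down Un.fob_isomorphic)
  then show ?case using isomorphic_trans[OF _ un_sp[OF assms, of "i + n"]] by (simp add: algebra_simps)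
qed

lemma sp_commute: "X \<in> Obj C \<Longrightarrow> isomorphic C (sp m (sp n X)) (sp n (sp m X))"
  using isomorphic_trans[OF sp_sp[of X m n], of "sp n (sp m X)"] isomorphic_sym[OF sp_sp[of X n m]]
  by (simp add: add.commute)

text \<open>Replaces the indexed family of a tower by rule induction. The list grows at its end
  because the last triangle of a tower is the one containing its top.\<close>

inductive built :: "'o \<Rightarrow> int list \<Rightarrow> 'o \<Rightarrow> bool" for E where
  nil: "is_zero_obj C X \<Longrightarrow> built E [] X"
| snoc: "\<lbrakk>built E ns X; tri X Y (sp n E)\<rbrakk> \<Longrightarrow> built E (ns @ [n]) Y"

lemma built_obj: "built E ns X \<Longrightarrow> X \<in> Obj C"
  by (induction rule: built.induct) (auto dest: tri_obj zero_obj_obj)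

lemma built_iff_tower: "built E ns X \<longleftrightarrow> (\<exists>A. is_tower C E ns A \<and> A (length ns) = X)"
proof
  assume "built E ns X"
  then show "\<exists>A. is_tower C E ns A \<and> A (length ns) = X"
  proof (induction rule: built.induct)
    case (nil X)
    then show ?case by (intro exI[of _ "\<lambda>_. X"]) (simp add: is_tower_def)
  next
    case (snoc ns X Y n)
    then obtain A where A: "is_tower C E ns A" "A (length ns) = X" by blast
    show ?case
      using A snoc.hyps(2)
      by (intro exI[of _ "A(Suc (length ns) := Y)"])
        (auto simp: is_tower_def tri_def nth_append less_Suc_eq)
  qed
next
  assume "\<exists>A. is_tower C E ns A \<and> A (length ns) = X"
  then obtain A where "is_tower C E ns A" "A (length ns) = X" by blast
  then show "built E ns X"
  proof (induction ns arbitrary: X rule: rev_induct)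
    case Nil
    then show ?case by (auto simp: is_tower_def intro: built.nil)
  next
    case (snoc n ns)
    have "is_tower C E ns A"
      using snoc.prems(1) by (auto simp: is_tower_def nth_append split: if_splits)
    then have "built E ns (A (length ns))" by (rule snoc.IH) simp
    moreover have "\<exists>f g h. (A (length ns), A (Suc (length ns)), sp ((ns @ [n]) ! length ns) E, f, g, h) \<in> Tri C"
      using snoc.prems(1) by (simp only: is_tower_def length_append_singleton lessI)
    then have "tri (A (length ns)) X (sp n E)" using snoc.prems(2) by (simp add: tri_def)
    ultimately show ?case by (rule built.snoc)
  qed
qed

text \<open>The summand \<open>F'\<close> in the definition of complexity is absorbed: a direct
  summand of the top of a tower is the same as a retract of it.\<close>

definition reach :: "'o \<Rightarrow> int list \<Rightarrow> 'o \<Rightarrow> bool" where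
  "reach E ns X \<longleftrightarrow> (\<exists>Z. built E ns Z \<and> retract X Z)"

lemma reach_iff_tower:
  "reach E ns X \<longleftrightarrow> (\<exists>X' A. is_tower C E ns A \<and> is_biproduct C X X' (A (length ns)))"
  unfolding reach_def built_iff_tower using biproduct_retract(1) retract_biproduct by metis

lemma built_reach: "built E ns X \<Longrightarrow> reach E ns X"
  unfolding reach_def using built_obj retract_refl by blast

lemma reach_obj: "reach E ns X \<Longrightarrow> X \<in> Obj C"
  by (auto simp: reach_def retract_obj)

lemma reach_retract: "\<lbrakk>reach E ns Y; retract X Y\<rbrakk> \<Longrightarrow> reach E ns X"
  unfolding reach_def using retract_trans by blast

lemma reach_isomorphic: "\<lbrakk>reach E ns X; isomorphic C X Y\<rbrakk> \<Longrightarrow> reach E ns Y"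
  using reach_retract isomorphic_retract isomorphic_sym by blast

lemma reach_Nil_iff: "reach E [] X \<longleftrightarrow> is_zero_obj C X"
proof
  assume "reach E [] X"
  then obtain Z where "built E [] Z" "retract X Z" by (auto simp: reach_def)
  then show "is_zero_obj C X" using retract_zero_obj by (auto elim: built.cases)
qed (auto intro: built_reach built.nil)

lemma reach_refl: "E \<in> Obj C \<Longrightarrow> reach E [0] E"
proof -
  assume E: "E \<in> Obj C"
  obtain N where N: "is_zero_obj C N" using zero_obj by blast
  have "tri N E (sp 0 E)" using tri_zero_left[OF N E] by (auto simp: tri_def)
  from built.snoc[OF built.nil[OF N] this] show ?thesis by (simp add: built_reach)
qed

lemma built_isomorphic_base:
  "\<lbrakk>built E ns X; isomorphic C E E'\<rbrakk> \<Longrightarrow> built E' ns X"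
proof (induction rule: built.induct)
  case (snoc ns X Y n)
  then have "tri X Y (sp n E')"
    using tri_iso[OF snoc.hyps(2)] tri_obj[OF snoc.hyps(2)] sp_isomorphic by simp
  then show ?case using snoc built.snoc by blast
qed (rule built.nil)

lemma reach_isomorphic_base: "\<lbrakk>reach E ns X; isomorphic C E E'\<rbrakk> \<Longrightarrow> reach E' ns X"
  unfolding reach_def using built_isomorphic_base by blast

lemma built_shift:
  "\<lbrakk>built E ns X; E \<in> Obj C\<rbrakk> \<Longrightarrow> built E (map ((+) m) ns) (sp m X)"
proof (induction rule: built.induct)
  case (nil X)
  then show ?case by (simp add: built.nil sp_zero_obj)
next
  case (snoc ns X Y n)
  have t: "tri (sp m X) (sp m Y) (sp m (sp n E))" using sp_tri snoc.hyps(2) by blast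
  then have "tri (sp m X) (sp m Y) (sp (m + n) E)"
    using tri_iso[OF t] tri_obj[OF t] sp_sp snoc.prems by simp
  then show ?case using snoc by (simp add: built.snoc)
qed

lemma reach_shift: "\<lbrakk>reach E ns X; E \<in> Obj C\<rbrakk> \<Longrightarrow> reach E (map ((+) m) ns) (sp m X)"
  unfolding reach_def using built_shift sp_retract by blast

text \<open>Shifting the base together with the target keeps the list. Thus
  \<open>shift_pow C m\<close> can be treated like an exact functor on the level of objects, where
  the signs acquired by shifted triangles are invisible.\<close>

lemma built_shift_base:
  "\<lbrakk>built E ns X; E \<in> Obj C\<rbrakk> \<Longrightarrow> built (sp m E) ns (sp m X)"
proof (induction rule: built.induct)
  case (nil X)
  then show ?case by (simp add: built.nil sp_zero_obj)
next
  case (snoc ns X Y n)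
  have t: "tri (sp m X) (sp m Y) (sp m (sp n E))" using sp_tri snoc.hyps(2) by blast
  then have "tri (sp m X) (sp m Y) (sp n (sp m E))"
    using tri_iso[OF t] tri_obj[OF t] sp_commute snoc.prems by simp
  then show ?case using snoc by (simp add: built.snoc)
qed

lemma reach_shift_base: "\<lbrakk>reach E ns X; E \<in> Obj C\<rbrakk> \<Longrightarrow> reach (sp m E) ns (sp m X)"
  unfolding reach_def using built_shift_base sp_retract by blast

text \<open>Induction along the tower of \<open>Y\<close>, whose top piece is peeled off with
  \<open>octahedral\<close>. The induction hypothesis yields the remaining part \<open>W\<close>
  only as a retract of a built object; \<open>tri_retract\<close> puts the top piece back on that
  object. For \<open>Y\<close> zero, \<open>Z\<close> is a retract of \<open>X\<close>.\<close>

lemma built_extension: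
  "\<lbrakk>built E ns Y; built E ms X; tri X Z Y\<rbrakk> \<Longrightarrow> reach E (ms @ ns) Z"
proof (induction arbitrary: Z rule: built.induct)
  case (nil Y)
  then show ?case using tri_zero_right_retract unfolding reach_def by auto
next
  case (snoc ns Y' Y n)
  obtain W where W: "tri W Z (sp n E)" "tri X W Y'"
    using octahedral[OF snoc.prems(2) snoc.hyps(2)] by blast
  obtain W' where W': "built E (ms @ ns) W'" "retract W W'"
    using snoc.IH[OF snoc.prems(1) W(2)] by (auto simp: reach_def)
  obtain Z' where "tri W' Z' (sp n E)" "retract Z Z'"
    using tri_retract[OF W(1) W'(2) retract_refl] tri_obj[OF W(1)] by metis
  then show ?case using built.snoc[OF W'(1)] unfolding reach_def by auto
qed

lemma reach_extension:
  assumes "reach E ms X" "reach E ns Y" "tri X Z Y"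
  shows "reach E (ms @ ns) Z"
proof -
  obtain X' Y' where XY: "built E ms X'" "retract X X'" "built E ns Y'" "retract Y Y'"
    using assms by (auto simp: reach_def)
  obtain Z' where "tri X' Z' Y'" "retract Z Z'"
    using tri_retract[OF assms(3) XY(2,4)] by metis
  then show ?thesis using built_extension[OF XY(3,1)] reach_retract by blast
qed

text \<open>Substitution of towers: each piece of the tower of \<open>G\<close>, a shift of
  \<open>F\<close> by \<open>n\<close>, is replaced by the tower of \<open>F\<close> shifted by
  \<open>n\<close>.\<close>

lemma reach_trans:
  assumes "reach E ms F" "E \<in> Obj C" "reach F ns G"
  shows "reach E (concat (map (\<lambda>n. map ((+) n) ms) ns)) G"
proof -
  obtain H where H: "built F ns H" "retract G H" using assms(3) by (auto simp: reach_def)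
  from H(1) have "reach E (concat (map (\<lambda>n. map ((+) n) ms) ns)) H"
  proof (induction rule: built.induct)
    case (nil X)
    then show ?case by (simp add: reach_Nil_iff)
  next
    case (snoc ns X Y n)
    then show ?case
      using reach_extension[OF snoc.IH reach_shift[OF assms(1,2), of n] snoc.hyps(2)] by simp
  qed
  then show ?thesis using H(2) reach_retract by blast
qed

text \<open>The objects reached from \<open>G\<close> form one of the subcategories in the
  intersection that defines a split-generator: shifting translates the list, a cone is an extension
  after rotation, and summands are built into \<open>reach\<close>.\<close>

lemma split_generator_reach:
  assumes G: "split_generator C G" and X: "X \<in> Obj C"
  obtains ns where "reach G ns X"
proof -
  have GO: "G \<in> Obj C" using G by (simp add: split_generator_def)
  let ?P = "{X. \<exists>ns. reach G ns X}"
  have shift: "sp m Y \<in> ?P" if "Y \<in> ?P" for Y m using that reach_shift GO by blast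
  have sh1: "sh Y = sp 1 Y" "un Y = sp (- 1) Y" for Y
    using sp_up[of 0 Y] sp_down[of 0 Y] by simp_all
  have "G \<in> ?P" using reach_refl GO by blast
  moreover have "full_triangulated_subcategory C ?P"
    unfolding full_triangulated_subcategory_def
  proof (intro conjI ballI allI impI)
    show "?P \<subseteq> Obj C" using reach_obj by blast
    show "?P \<noteq> {}" using \<open>G \<in> ?P\<close> by blast
    show "sh Y \<in> ?P" "un Y \<in> ?P" if "Y \<in> ?P" for Y using shift[OF that] unfolding sh1 by blast+
  next
    fix X Y Z f g h assume "(X, Y, Z, f, g, h) \<in> Tri C \<and> X \<in> ?P \<and> Y \<in> ?P"
    moreover from this have "tri Y Z (sh X)" using tri_rotate unfolding tri_def by blast
    ultimately show "Z \<in> ?P" using shift[of X 1] reach_extension unfolding sh1 by blast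
  qed
  moreover have "closed_under_summands C ?P"
    unfolding closed_under_summands_def using reach_retract biproduct_retract by blast
  ultimately have "\<Inter> {P. full_triangulated_subcategory C P \<and> closed_under_summands C P \<and> G \<in> P} \<subseteq> ?P"
    by blast
  then have "X \<in> ?P" using G X unfolding split_generator_def by blast
  then show ?thesis using that by blast
qed

text \<open>A list represents a Laurent polynomial with natural coefficients, evaluated at
  \<open>exp t\<close>. Extension of towers corresponds to addition and substitution of towers to
  multiplication.\<close>

definition weight :: "real \<Rightarrow> int list \<Rightarrow> real" where
  "weight t ns = (\<Sum>n\<leftarrow>ns. exp (real_of_int n * t))"

lemma weight_nonneg [simp]: "0 \<le> weight t ns"
  unfolding weight_def by (rule sum_list_nonneg) auto

lemma weight_append: "weight t (ms @ ns) = weight t ms + weight t ns"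
  by (simp add: weight_def)

lemma weight_shift: "weight t (map ((+) m) ns) = exp (real_of_int m * t) * weight t ns"
  by (simp add: weight_def o_def distrib_right exp_add sum_list_const_mult)

lemma weight_concat: "weight t (concat (map (\<lambda>n. map ((+) n) ms) ns)) = weight t ms * weight t ns"
  by (induction ns) (simp_all add: weight_append weight_shift algebra_simps, simp_all add: weight_def algebra_simps)

text \<open>An empty tower says nothing about its base, so membership of \<open>E\<close> is
  demanded explicitly.\<close>

definition reachable :: "'o \<Rightarrow> 'o \<Rightarrow> bool" where
  "reachable E X \<longleftrightarrow> E \<in> Obj C \<and> (\<exists>ns. reach E ns X)"

text \<open>Equal to the complexity only if \<open>reachable E X\<close>; otherwise \<open>Inf {}\<close> is a junk value.\<close>

definition cx :: "real \<Rightarrow> 'o \<Rightarrow> 'o \<Rightarrow> real" where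
  "cx t E X = Inf {weight t ns | ns. reach E ns X}"

lemma cx_bdd: "bdd_below {weight t ns | ns. reach E ns X}"
  by (rule bdd_belowI[of _ 0]) auto

lemma cx_le: "reach E ns X \<Longrightarrow> cx t E X \<le> weight t ns"
  unfolding cx_def using cx_bdd by (auto intro!: cInf_lower)

lemma cx_greatest: "\<lbrakk>reachable E X; \<And>ns. reach E ns X \<Longrightarrow> c \<le> weight t ns\<rbrakk> \<Longrightarrow> c \<le> cx t E X"
  unfolding cx_def reachable_def by (intro cInf_greatest) auto

lemma cx_nonneg: "reachable E X \<Longrightarrow> 0 \<le> cx t E X"
  by (rule cx_greatest) simp_all

lemma cx_zero_obj:
  assumes "is_zero_obj C X" "E \<in> Obj C"
  shows "cx t E X = 0"
proof -
  have "reach E [] X" using assms by (simp add: reach_Nil_iff)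
  then show ?thesis
    using cx_le[of E "[]" X t] cx_nonneg[of E X t] assms by (auto simp: reachable_def weight_def)
qed

text \<open>The separate clause of \<open>complexity\<close> for zero objects agrees with the
  infimum, since the empty tower has weight 0.\<close>

lemma complexity_eq_cx:
  assumes "reachable E X"
  shows "complexity C t E X = ereal (cx t E X)"
proof (cases "is_zero_obj C X")
  case True
  then show ?thesis using assms by (simp add: complexity_def cx_zero_obj reachable_def)
next
  case False
  have "complexity C t E X = Inf (ereal ` {weight t ns | ns. reach E ns X})"
    using False unfolding complexity_def weight_def reach_iff_tower
    by (auto intro!: arg_cong[of _ _ Inf])
  also have "\<dots> = ereal (cx t E X)"
    unfolding cx_def using assms cx_bdd by (subst ereal_Inf') (auto simp: reachable_def)
  finally show ?thesis .
qed

lemma cx_mono: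
  assumes "reachable E X" "\<And>ns. reach E ns X \<Longrightarrow> reach E' ns X'"
  shows "cx t E' X' \<le> cx t E X"
  using assms by (intro cx_greatest) (auto intro: cx_le)

lemma reachable_trans: "\<lbrakk>reachable E F; reachable F G\<rbrakk> \<Longrightarrow> reachable E G"
  unfolding reachable_def using reach_trans by blast

text \<open>The two infima are taken one after the other by dividing the product bound by the other
  factor, so vanishing factors are treated apart.\<close>

lemma cx_trans:
  assumes "reachable E F" "reachable F G"
  shows "cx t E G \<le> cx t E F * cx t F G"
proof -
  have *: "cx t E G \<le> weight t ms * weight t ns" if "reach E ms F" "reach F ns G" for ms ns
    using cx_le[OF reach_trans[OF that(1) _ that(2)], of t] assms
    by (simp add: weight_concat reachable_def)
  have **: "cx t E G \<le> weight t ms * cx t F G" if ms: "reach E ms F" for ms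
  proof (cases "weight t ms = 0")
    \<comment> \<open>Only the empty list has weight 0. Any single tower from \<open>F\<close> to
      \<open>G\<close> then already gives \<open>cx t E G \<le> 0\<close>.\<close>
    case True
    then show ?thesis using * ms assms(2) unfolding reachable_def by fastforce
  next
    case False
    then have pos: "weight t ms > 0" using weight_nonneg[of t ms] by linarith
    have "cx t E G / weight t ms \<le> cx t F G"
    proof (rule cx_greatest[OF assms(2)])
      fix ns assume "reach F ns G"
      from *[OF ms this] pos show "cx t E G / weight t ms \<le> weight t ns"
        by (simp add: pos_divide_le_eq mult.commute)
    qed
    then show ?thesis using pos by (simp add: pos_divide_le_eq mult.commute)
  qed
  show ?thesis
  proof (cases "cx t F G = 0")
    case True
    then show ?thesis using ** assms(1) unfolding reachable_def by fastforce
  next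
    case False
    then have pos: "cx t F G > 0" using cx_nonneg[OF assms(2), of t] by linarith
    have "cx t E G / cx t F G \<le> cx t E F"
      using ** pos by (intro cx_greatest[OF assms(1)]) (simp add: pos_divide_le_eq)
    then show ?thesis using pos by (simp add: pos_divide_le_eq)
  qed
qed

lemma cx_extension:
  assumes "reachable E X" "reachable E Y" "tri X Z Y"
  shows "cx t E Z \<le> cx t E X + cx t E Y"
proof -
  have *: "cx t E Z \<le> weight t ms + weight t ns" if "reach E ms X" "reach E ns Y" for ms ns
    using cx_le[OF reach_extension[OF that assms(3)], of t] by (simp add: weight_append)
  have "cx t E Z - weight t ms \<le> cx t E Y" if "reach E ms X" for ms
    using *[OF that] by (intro cx_greatest[OF assms(2)]) (simp add: algebra_simps)
  then have "cx t E Z - cx t E Y \<le> cx t E X"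
    by (intro cx_greatest[OF assms(1)]) (simp add: algebra_simps)
  then show ?thesis by simp
qed

lemma reachable_shift: "reachable E X \<Longrightarrow> reachable E (sp m X)"
  unfolding reachable_def using reach_shift by blast

lemma cx_shift:
  assumes "reachable E X"
  shows "cx t E (sp m X) \<le> exp (real_of_int m * t) * cx t E X"
proof -
  have "cx t E (sp m X) / exp (real_of_int m * t) \<le> cx t E X"
    using cx_le[OF reach_shift[of E _ X m], of _ t] assms
    by (intro cx_greatest[OF assms]) (simp add: weight_shift divide_le_eq mult.commute reachable_def)
  then show ?thesis by (simp add: divide_le_eq mult.commute)
qed

lemma reachable_isomorphic: "\<lbrakk>reachable E X; isomorphic C E E'; isomorphic C X X'\<rbrakk> \<Longrightarrow> reachable E' X'"
  unfolding reachable_def using reach_isomorphic reach_isomorphic_base isomorphic_obj by blast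

lemma cx_isomorphic:
  assumes "reachable E X" "isomorphic C E E'" "isomorphic C X X'"
  shows "cx t E' X' = cx t E X"
proof (rule antisym)
  show "cx t E' X' \<le> cx t E X"
    using assms by (intro cx_mono) (auto intro: reach_isomorphic reach_isomorphic_base)
  show "cx t E X \<le> cx t E' X'"
    using assms reachable_isomorphic[OF assms]
    by (intro cx_mono) (auto intro: reach_isomorphic reach_isomorphic_base isomorphic_sym)
qed

lemma split_generator_reachable: "\<lbrakk>split_generator C G; X \<in> Obj C\<rbrakk> \<Longrightarrow> reachable G X"
  by (rule split_generator_reach[of G X]) (auto simp: reachable_def split_generator_def)

text \<open>At \<open>t = 0\<close> the weight is the length of the tower, and only zero objects are
  reached in no steps.\<close>

lemma cx_0_ge_1:
  assumes "reachable E X" "\<not> is_zero_obj C X"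
  shows "1 \<le> cx 0 E X"
proof (rule cx_greatest[OF assms(1)])
  fix ns assume "reach E ns X"
  then have "ns \<noteq> []" using assms(2) reach_Nil_iff by blast
  then show "1 \<le> weight 0 ns" by (cases ns) (auto simp: weight_def sum_list_triv)
qed

end

section \<open>Images of towers under exact functors\<close>

locale exact_functor_between =
  dom: triangulated_category K C + cod: triangulated_category K D
  for K :: "'k ring" and C :: "('k, 'o, 'm) tri_cat" and D :: "('k, 'p, 'n) tri_cat" +
  fixes F :: "('o, 'm, 'p, 'n) func"
  assumes exact: "exact_functor K C D F"

sublocale exact_functor_between \<subseteq> linear_functor_between K C D F
  using exact by unfold_locales (simp add: exact_functor_def)

context exact_functor_between
begin

lemma fob_shift: "X \<in> Obj C \<Longrightarrow> isomorphic D (fob F (dom.sh X)) (cod.sh (fob F X))"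
  using exact nat_isomorphic_obj[of C D "F \<circ>\<circ> Shift C" "Shift D \<circ>\<circ> F" X]
  by (auto simp: exact_functor_def nat_isomorphic_def fcomp_def)

text \<open>Exactness provides a comparison with \<open>Shift\<close> alone. The one with
  \<open>Unshift\<close> results from inserting \<open>un (sh _)\<close> outside, moving
  \<open>sh\<close> through \<open>F\<close>, and cancelling \<open>sh (un X)\<close>
  inside.\<close>

lemma fob_unshift:
  assumes X: "X \<in> Obj C"
  shows "isomorphic D (fob F (dom.un X)) (cod.un (fob F X))"
proof -
  have "isomorphic D (fob F (dom.un X)) (cod.un (cod.sh (fob F (dom.un X))))"
    using X by (simp add: cod.isomorphic_sym cod.un_sh)
  also have "isomorphic D \<dots> (cod.un (fob F (dom.sh (dom.un X))))"
    using X by (simp add: cod.Un.fob_isomorphic cod.isomorphic_sym fob_shift)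
  also have "isomorphic D \<dots> (cod.un (fob F X))"
    using X by (simp add: cod.Un.fob_isomorphic fob_isomorphic dom.sh_un)
  finally show ?thesis .
qed

lemma fob_sp:
  assumes X: "X \<in> Obj C"
  shows "isomorphic D (fob F (dom.sp n X)) (cod.sp n (fob F X))"
proof (induction n rule: int_induct[where k = 0])
  case base
  then show ?case using X by simp
next
  case (step1 i)
  then show ?case
    using cod.isomorphic_trans[OF fob_shift cod.Sh.fob_isomorphic] X by (simp add: dom.sp_up cod.sp_up)
next
  case (step2 i)
  then show ?case
    using cod.isomorphic_trans[OF fob_unshift cod.Un.fob_isomorphic] X by (simp add: dom.sp_down cod.sp_down)
qed

lemma fob_tri:
  assumes "dom.tri X Y Z"
  shows "cod.tri (fob F X) (fob F Y) (fob F Z)"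
proof -
  obtain f g h where t: "(X, Y, Z, f, g, h) \<in> Tri C" using assms by (auto simp: dom.tri_def)
  obtain \<phi> where "\<forall>\<tau>\<in>Tri C. map_triangle C D F \<phi> \<tau> \<in> Tri D"
    using exact by (auto simp: exact_functor_def)
  then have "map_triangle C D F \<phi> (X, Y, Z, f, g, h) \<in> Tri D" using t by blast
  then show ?thesis by (auto simp: map_triangle_def cod.tri_def)
qed

lemma built_fob: "\<lbrakk>dom.built E ns X; E \<in> Obj C\<rbrakk> \<Longrightarrow> cod.built (fob F E) ns (fob F X)"
proof (induction rule: dom.built.induct)
  case (nil X)
  then show ?case by (simp add: cod.built.nil fob_zero_obj)
next
  case (snoc ns X Y n)
  have t: "cod.tri (fob F X) (fob F Y) (fob F (dom.sp n E))" using fob_tri snoc.hyps(2) by blast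
  then have "cod.tri (fob F X) (fob F Y) (cod.sp n (fob F E))"
    using cod.tri_iso[OF t] cod.tri_obj[OF t] fob_sp snoc.prems by simp
  then show ?case using snoc by (simp add: cod.built.snoc)
qed

lemma reach_fob: "\<lbrakk>dom.reach E ns X; E \<in> Obj C\<rbrakk> \<Longrightarrow> cod.reach (fob F E) ns (fob F X)"
  unfolding dom.reach_def cod.reach_def using built_fob fob_retract by blast

lemma reachable_fob: "dom.reachable E X \<Longrightarrow> cod.reachable (fob F E) (fob F X)"
  using reach_fob fob_closed by (auto simp: dom.reachable_def cod.reachable_def)

lemma cx_fob: "dom.reachable E X \<Longrightarrow> cod.cx t (fob F E) (fob F X) \<le> dom.cx t E X"
  unfolding cod.cx_def[of t "fob F E"]
  using reach_fob by (auto simp: dom.reachable_def cod.cx_def[symmetric] intro!: dom.cx_greatest cod.cx_le)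

end

section \<open>Homotopy categories of dg categories\<close>

context dg_category
begin

definition darr :: "'o \<Rightarrow> 'o \<Rightarrow> int \<Rightarrow> 'm \<Rightarrow> bool" where
  "darr X Y n f \<longleftrightarrow> X \<in> dObj A \<and> Y \<in> dObj A \<and> f \<in> dmor A X Y n"

definition cyc :: "'o \<Rightarrow> 'o \<Rightarrow> int \<Rightarrow> 'm \<Rightarrow> bool" where
  "cyc X Y n f \<longleftrightarrow> X \<in> dObj A \<and> Y \<in> dObj A \<and> f \<in> cocycles A X Y n"

definition cob :: "'o \<Rightarrow> 'o \<Rightarrow> int \<Rightarrow> 'm \<Rightarrow> bool" where
  "cob X Y n f \<longleftrightarrow> X \<in> dObj A \<and> Y \<in> dObj A \<and> f \<in> coboundaries A X Y n"

lemma darr_obj: "darr X Y n f \<Longrightarrow> X \<in> dObj A" "darr X Y n f \<Longrightarrow> Y \<in> dObj A"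
  by (auto simp: darr_def)

lemma cyc_obj: "cyc X Y n f \<Longrightarrow> X \<in> dObj A" "cyc X Y n f \<Longrightarrow> Y \<in> dObj A"
  by (auto simp: cyc_def)

lemma cyc_darr: "cyc X Y n f \<Longrightarrow> darr X Y n f"
  by (auto simp: cyc_def darr_def cocycles_def)

lemma cyc_Diff: "cyc X Y n f \<Longrightarrow> Diff A X Y n f = \<zero>\<^bsub>dHom A X Y (n + 1)\<^esub>"
  by (auto simp: cyc_def cocycles_def)

lemma cycI: "\<lbrakk>darr X Y n f; Diff A X Y n f = \<zero>\<^bsub>dHom A X Y (n + 1)\<^esub>\<rbrakk> \<Longrightarrow> cyc X Y n f"
  by (auto simp: cyc_def darr_def cocycles_def)

lemma dHom_group: "\<lbrakk>X \<in> dObj A; Y \<in> dObj A\<rbrakk> \<Longrightarrow> abelian_group (dHom A X Y n)"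
  using dHom_module[of X Y n] by (rule Module.module.axioms(2))

lemma Diff_hom:
  "\<lbrakk>X \<in> dObj A; Y \<in> dObj A\<rbrakk> \<Longrightarrow> abelian_group_hom (dHom A X Y n) (dHom A X Y (n + 1)) (Diff A X Y n)"
  using Diff_linear dHom_module by (blast intro: linear_map_group_hom)

lemma darr_Diff: "darr X Y n f \<Longrightarrow> darr X Y (n + 1) (Diff A X Y n f)"
  using abelian_group_hom.hom_closed[OF Diff_hom[of X Y n]] by (auto simp: darr_def)

lemma dcomp_left_hom:
  assumes "darr Y Z m g" "X \<in> dObj A"
  shows "abelian_group_hom (dHom A X Y n) (dHom A X Z (m + n)) (dComp A X Y Z m n g)"
  using assms dComp_bilinear[of X Y Z m n] dHom_module
  by (auto intro!: linear_map_group_hom[of K] simp: bilinear_map_def darr_def)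

lemma dcomp_right_hom:
  assumes "darr X Y n f" "Z \<in> dObj A"
  shows "abelian_group_hom (dHom A Y Z m) (dHom A X Z (m + n)) (\<lambda>g. dComp A X Y Z m n g f)"
  using assms dComp_bilinear[of X Y Z m n] dHom_module
  by (auto intro!: linear_map_group_hom[of K] simp: bilinear_map_def darr_def)

lemma darr_comp: "\<lbrakk>darr X Y n f; darr Y Z m g\<rbrakk> \<Longrightarrow> darr X Z (m + n) (dComp A X Y Z m n g f)"
  using abelian_group_hom.hom_closed[OF dcomp_left_hom[of Y Z m g X n]] by (auto simp: darr_def)

lemma darr_zero: "\<lbrakk>X \<in> dObj A; Y \<in> dObj A\<rbrakk> \<Longrightarrow> darr X Y n \<zero>\<^bsub>dHom A X Y n\<^esub>"
  by (simp add: darr_def dHom_group abelian_groupE)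

lemma dcomp_zero_right: "\<lbrakk>darr Y Z m g; X \<in> dObj A\<rbrakk> \<Longrightarrow>
    dComp A X Y Z m n g \<zero>\<^bsub>dHom A X Y n\<^esub> = \<zero>\<^bsub>dHom A X Z (m + n)\<^esub>"
  using abelian_group_hom.hom_zero[OF dcomp_left_hom[of Y Z m g X n]] by simp

lemma dcomp_zero_left: "\<lbrakk>darr X Y n f; Z \<in> dObj A\<rbrakk> \<Longrightarrow>
    dComp A X Y Z m n \<zero>\<^bsub>dHom A Y Z m\<^esub> f = \<zero>\<^bsub>dHom A X Z (m + n)\<^esub>"
  using abelian_group_hom.hom_zero[OF dcomp_right_hom[of X Y n f Z m]] by simp

lemma dcomp_add_right: "\<lbrakk>darr Y Z m g; darr X Y n f; darr X Y n f'\<rbrakk> \<Longrightarrow>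
    dComp A X Y Z m n g (f \<oplus>\<^bsub>dHom A X Y n\<^esub> f') =
    dComp A X Y Z m n g f \<oplus>\<^bsub>dHom A X Z (m + n)\<^esub> dComp A X Y Z m n g f'"
  using abelian_group_hom.hom_add[OF dcomp_left_hom[of Y Z m g X n]] by (simp add: darr_def)

lemma dcomp_add_left: "\<lbrakk>darr X Y n f; darr Y Z m g; darr Y Z m g'\<rbrakk> \<Longrightarrow>
    dComp A X Y Z m n (g \<oplus>\<^bsub>dHom A Y Z m\<^esub> g') f =
    dComp A X Y Z m n g f \<oplus>\<^bsub>dHom A X Z (m + n)\<^esub> dComp A X Y Z m n g' f"
  using abelian_group_hom.hom_add[OF dcomp_right_hom[of X Y n f Z m]] by (simp add: darr_def)

lemma koszul_zero: "\<lbrakk>X \<in> dObj A; Y \<in> dObj A\<rbrakk> \<Longrightarrow>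
    koszul (dHom A X Y n) k \<zero>\<^bsub>dHom A X Y n\<^esub> = \<zero>\<^bsub>dHom A X Y n\<^esub>"
  using abelian_group.minus_equality[OF dHom_group[of X Y n], of "\<zero>\<^bsub>dHom A X Y n\<^esub>" "\<zero>\<^bsub>dHom A X Y n\<^esub>"]
  by (simp add: koszul_def dHom_group abelian_groupE)

lemma dadd_zero:
  assumes "darr X Y n f"
  shows "f \<oplus>\<^bsub>dHom A X Y n\<^esub> \<zero>\<^bsub>dHom A X Y n\<^esub> = f" "\<zero>\<^bsub>dHom A X Y n\<^esub> \<oplus>\<^bsub>dHom A X Y n\<^esub> f = f"
proof -
  interpret H: abelian_group "dHom A X Y n" using assms by (auto simp: darr_def intro: dHom_group)
  show "f \<oplus>\<^bsub>dHom A X Y n\<^esub> \<zero>\<^bsub>dHom A X Y n\<^esub> = f" "\<zero>\<^bsub>dHom A X Y n\<^esub> \<oplus>\<^bsub>dHom A X Y n\<^esub> f = f"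
    using assms by (simp_all add: darr_def)
qed

lemma cyc_comp:
  assumes f: "cyc X Y n f" and g: "cyc Y Z m g"
  shows "cyc X Z (m + n) (dComp A X Y Z m n g f)"
proof (rule cycI)
  note fg = cyc_darr[OF f] cyc_darr[OF g]
  note obj = cyc_obj[OF f] cyc_obj[OF g]
  show "darr X Z (m + n) (dComp A X Y Z m n g f)" using fg by (rule darr_comp)
  have "dComp A X Y Z (m + 1) n \<zero>\<^bsub>dHom A Y Z (m + 1)\<^esub> f = \<zero>\<^bsub>dHom A X Z (m + n + 1)\<^esub>"
    using dcomp_zero_left[OF fg(1) obj(4), of "m + 1"] by (simp add: algebra_simps)
  moreover have "dComp A X Y Z m (n + 1) g \<zero>\<^bsub>dHom A X Y (n + 1)\<^esub> = \<zero>\<^bsub>dHom A X Z (m + n + 1)\<^esub>"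
    using dcomp_zero_right[OF fg(2) obj(1), of "n + 1"] by (simp add: algebra_simps)
  ultimately show "Diff A X Z (m + n) (dComp A X Y Z m n g f) = \<zero>\<^bsub>dHom A X Z (m + n + 1)\<^esub>"
    using Leibniz[of X Y Z f n g m] fg obj dadd_zero[OF darr_zero[of X Z "m + n + 1"]]
    by (simp add: darr_def cyc_Diff[OF f] cyc_Diff[OF g] koszul_zero)
qed

lemma cob_obtain:
  assumes "cob X Y n b"
  obtains b' where "darr X Y (n - 1) b'" "b = Diff A X Y (n - 1) b'"
  using assms by (auto simp: cob_def coboundaries_def darr_def)

lemma cob_Diff: "darr X Y n f \<Longrightarrow> m = n + 1 \<Longrightarrow> cob X Y m (Diff A X Y n f)"
  by (auto simp: cob_def coboundaries_def darr_def)

lemma cob_cyc: "cob X Y n b \<Longrightarrow> cyc X Y n b"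
proof -
  assume "cob X Y n b"
  then obtain b' where b: "darr X Y (n - 1) b'" "b = Diff A X Y (n - 1) b'" by (rule cob_obtain)
  show "cyc X Y n b"
  proof (rule cycI)
    show "darr X Y n b" using darr_Diff[OF b(1)] b(2) by simp
    show "Diff A X Y n b = \<zero>\<^bsub>dHom A X Y (n + 1)\<^esub>"
      using Diff_Diff[of X Y b' "n - 1"] b by (simp add: darr_def)
  qed
qed

lemma cob_subgroup:
  assumes "X \<in> dObj A" "Y \<in> dObj A"
  shows "abelian_subgroup (coboundaries A X Y n) (dHom A X Y n)"
proof (rule abelian_subgroupI3)
  interpret D: abelian_group_hom "dHom A X Y (n - 1)" "dHom A X Y (n - 1 + 1)" "Diff A X Y (n - 1)"
    using assms by (rule Diff_hom)
  have "subgroup (Diff A X Y (n - 1) ` carrier (add_monoid (dHom A X Y (n - 1))))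
      (add_monoid (dHom A X Y (n - 1 + 1)))"
    using D.a_group_hom by (rule group_hom.img_is_subgroup)
  then show "additive_subgroup (coboundaries A X Y n) (dHom A X Y n)"
    by (simp add: coboundaries_def additive_subgroup_def)
  show "abelian_group (dHom A X Y n)" using assms by (rule dHom_group)
qed

lemma cob_neg: "cob X Y n b \<Longrightarrow> cob X Y n (\<ominus>\<^bsub>dHom A X Y n\<^esub> b)"
  using additive_subgroup.a_inv_closed[OF abelian_subgroup.axioms(1)[OF cob_subgroup[of X Y n]], of b]
    dHom_group[of X Y n]
  by (auto simp: cob_def)

lemma cob_comp_left:
  assumes b: "cob Y Z m b" and f: "cyc X Y n f"
  shows "cob X Z (m + n) (dComp A X Y Z m n b f)"
proof -
  obtain c where c: "darr Y Z (m - 1) c" "b = Diff A Y Z (m - 1) c" using b by (rule cob_obtain)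
  note obj = cyc_obj[OF f] darr_obj[OF c(1)]
  have "dComp A X Y Z (m - 1) (n + 1) c \<zero>\<^bsub>dHom A X Y (n + 1)\<^esub> = \<zero>\<^bsub>dHom A X Z (m + n)\<^esub>"
    using dcomp_zero_right[OF c(1) obj(1), of "n + 1"] by (simp add: algebra_simps)
  then have "Diff A X Z (m - 1 + n) (dComp A X Y Z (m - 1) n c f) = dComp A X Y Z m n b f"
    using Leibniz[of X Y Z f n c "m - 1"] c obj f cyc_darr[OF f]
      dadd_zero(1)[OF darr_comp[OF cyc_darr[OF f] cyc_darr[OF cob_cyc[OF b]]]]
    by (simp add: darr_def cyc_Diff[OF f] koszul_zero)
  then show ?thesis
    using cob_Diff[OF darr_comp[OF cyc_darr[OF f] c(1)], of "m + n"] by simp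
qed

text \<open>By the Leibniz rule \<open>g d(c)\<close> is \<open>d(g c)\<close> up to the Koszul sign
  of \<open>g\<close>, and coboundaries are closed under negation. Composing on the other side, as
  in \<open>cob_comp_left\<close>, produces no sign.\<close>

lemma cob_comp_right:
  assumes b: "cob X Y n b" and g: "cyc Y Z m g"
  shows "cob X Z (m + n) (dComp A X Y Z m n g b)"
proof -
  obtain c where c: "darr X Y (n - 1) c" "b = Diff A X Y (n - 1) c" using b by (rule cob_obtain)
  note obj = cyc_obj[OF g] darr_obj[OF c(1)]
  interpret H: abelian_group "dHom A X Z (m + n)" using obj by (auto intro: dHom_group)
  have gb: "darr X Z (m + n) (dComp A X Y Z m n g b)"
    using darr_comp[OF cyc_darr[OF cob_cyc[OF b]] cyc_darr[OF g]] .
  \<comment> \<open>The degree is an argument of \<open>dHom\<close>, so the degree expressions of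
    the Leibniz rule are normalised before the modules can be identified.\<close>
  have d: "m + (n - 1) + 1 = m + n" "m + 1 + (n - 1) = m + n" by simp_all
  have "dComp A X Y Z (m + 1) (n - 1) \<zero>\<^bsub>dHom A Y Z (m + 1)\<^esub> c = \<zero>\<^bsub>dHom A X Z (m + n)\<^esub>"
    using dcomp_zero_left[OF c(1) obj(2), of "m + 1"] unfolding d .
  then have "Diff A X Z (m + (n - 1)) (dComp A X Y Z m (n - 1) g c) =
      \<zero>\<^bsub>dHom A X Z (m + n)\<^esub> \<oplus>\<^bsub>dHom A X Z (m + n)\<^esub> koszul (dHom A X Z (m + n)) m (dComp A X Y Z m n g b)"
    using Leibniz[of X Y Z c "n - 1" g m] c obj cyc_darr[OF g] unfolding d
    by (simp add: darr_def cyc_Diff[OF g])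
  also have "\<dots> = koszul (dHom A X Z (m + n)) m (dComp A X Y Z m n g b)"
    using gb by (simp add: koszul_def darr_def)
  finally have "cob X Z (m + n) (koszul (dHom A X Z (m + n)) m (dComp A X Y Z m n g b))"
    using cob_Diff[OF darr_comp[OF c(1) cyc_darr[OF g]], of "m + n"] by simp
  then show ?thesis
    using cob_neg[of X Z "m + n" "\<ominus>\<^bsub>dHom A X Z (m + n)\<^esub> dComp A X Y Z m n g b"] gb
    by (auto simp: koszul_def darr_def split: if_splits)
qed

text \<open>The Leibniz rule for the identity composed with itself shows that its differential
  equals twice itself.\<close>

lemma cyc_id: "X \<in> dObj A \<Longrightarrow> cyc X X 0 (dIdm A X)"
proof (rule cycI)
  assume X: "X \<in> dObj A"
  then show i: "darr X X 0 (dIdm A X)" by (simp add: darr_def dIdm_closed)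
  interpret H: abelian_group "dHom A X X 1" using X by (simp add: dHom_group)
  have d: "darr X X 1 (Diff A X X 0 (dIdm A X))" using darr_Diff[OF i] by simp
  have "Diff A X X 0 (dIdm A X) = Diff A X X 0 (dIdm A X) \<oplus>\<^bsub>dHom A X X 1\<^esub> Diff A X X 0 (dIdm A X)"
    using Leibniz[of X X X "dIdm A X" 0 "dIdm A X" 0] X i d
    by (simp add: darr_def dIdm_left dIdm_right koszul_def)
  then have "Diff A X X 0 (dIdm A X) = \<zero>\<^bsub>dHom A X X 1\<^esub>"
    using d H.r_neg1[of "Diff A X X 0 (dIdm A X)" "Diff A X X 0 (dIdm A X)"]
    by (simp add: darr_def H.l_neg)
  then show "Diff A X X 0 (dIdm A X) = \<zero>\<^bsub>dHom A X X (0 + 1)\<^esub>" by simp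
qed

lemma hclass_eqI:
  assumes f: "darr X Y 0 f" and b: "cob X Y 0 b"
  shows "hclass A X Y (b \<oplus>\<^bsub>dHom A X Y 0\<^esub> f) = hclass A X Y f"
proof -
  have "b \<oplus>\<^bsub>dHom A X Y 0\<^esub> f \<in> hclass A X Y f"
    using b by (auto simp: hclass_def a_r_coset_def' cob_def)
  then show ?thesis
    using abelian_subgroup.a_repr_independence'[OF cob_subgroup[of X Y 0]] f
    unfolding hclass_def darr_def by metis
qed

lemma hclass_self: "darr X Y 0 f \<Longrightarrow> f \<in> hclass A X Y f"
  using abelian_subgroup.a_rcos_self[OF cob_subgroup[of X Y 0]] by (auto simp: hclass_def darr_def)

lemma hclass_obtain:
  assumes "g \<in> hclass A X Y f" "darr X Y 0 f"
  obtains b where "cob X Y 0 b" "g = b \<oplus>\<^bsub>dHom A X Y 0\<^esub> f"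
  using assms by (auto simp: hclass_def a_r_coset_def' cob_def darr_def)

lemma cyc_add:
  assumes "cyc X Y n f" "cyc X Y n g"
  shows "cyc X Y n (f \<oplus>\<^bsub>dHom A X Y n\<^esub> g)"
proof (rule cycI)
  have obj: "X \<in> dObj A" "Y \<in> dObj A" using assms by (auto simp: cyc_def)
  show "darr X Y n (f \<oplus>\<^bsub>dHom A X Y n\<^esub> g)"
    using assms[THEN cyc_darr] dHom_group[of X Y n] by (simp add: darr_def abelian_groupE)
  show "Diff A X Y n (f \<oplus>\<^bsub>dHom A X Y n\<^esub> g) = \<zero>\<^bsub>dHom A X Y (n + 1)\<^esub>"
    using abelian_group_hom.hom_add[OF Diff_hom[OF obj, of n], of f g] assms[THEN cyc_darr] assms[THEN cyc_Diff]
      dadd_zero(1)[OF darr_zero[OF obj, of "n + 1"]]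
    by (simp add: darr_def)
qed

lemma hclass_mem:
  assumes "g \<in> hclass A X Y f" "cyc X Y 0 f"
  shows "cyc X Y 0 g" "hclass A X Y g = hclass A X Y f"
proof -
  obtain b where b: "cob X Y 0 b" "g = b \<oplus>\<^bsub>dHom A X Y 0\<^esub> f"
    using hclass_obtain[OF assms(1) cyc_darr[OF assms(2)]] by blast
  show "cyc X Y 0 g" unfolding b(2) using cob_cyc[OF b(1)] assms(2) by (rule cyc_add)
  show "hclass A X Y g = hclass A X Y f" unfolding b(2) using cyc_darr[OF assms(2)] b(1) by (rule hclass_eqI)
qed

text \<open>The operations of \<open>H0 A\<close> form the closure of all results on
  representatives. When these lie in one class the closure is that class, so well-definedness
  reduces to a congruence on cocycles.\<close>

lemma hclosure_eq:
  assumes "S \<noteq> {}" "\<And>g. g \<in> S \<Longrightarrow> hclass A X Y g = c"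
  shows "hclosure A X Y S = c"
proof -
  have "hclosure A X Y S = (\<Union>g\<in>S. hclass A X Y g)"
    by (auto simp: hclass_def a_r_coset_def' set_add_def')
  then show ?thesis using assms by auto
qed

lemma hclass_comp_cong:
  assumes f: "cyc X Y 0 f" "cyc X Y 0 f'" "hclass A X Y f = hclass A X Y f'"
    and g: "cyc Y Z 0 g" "cyc Y Z 0 g'" "hclass A Y Z g = hclass A Y Z g'"
  shows "hclass A X Z (dComp A X Y Z 0 0 g f) = hclass A X Z (dComp A X Y Z 0 0 g' f')"
proof -
  obtain b where b: "cob X Y 0 b" "f = b \<oplus>\<^bsub>dHom A X Y 0\<^esub> f'"
    by (rule hclass_obtain[of f X Y f']) (use hclass_self[OF cyc_darr[OF f(1)]] f cyc_darr in auto)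
  obtain c where c: "cob Y Z 0 c" "g = c \<oplus>\<^bsub>dHom A Y Z 0\<^esub> g'"
    by (rule hclass_obtain[of g Y Z g']) (use hclass_self[OF cyc_darr[OF g(1)]] g cyc_darr in auto)
  have "dComp A X Y Z 0 0 g f = dComp A X Y Z 0 0 c f \<oplus>\<^bsub>dHom A X Z 0\<^esub> dComp A X Y Z 0 0 g' f"
    using dcomp_add_left[of X Y 0 f Z 0 c g'] c f g cob_cyc cyc_darr by simp
  then have 1: "hclass A X Z (dComp A X Y Z 0 0 g f) = hclass A X Z (dComp A X Y Z 0 0 g' f)"
    using hclass_eqI[OF _ cob_comp_left[OF c(1) f(1), simplified]]
      darr_comp[OF f(1)[THEN cyc_darr] g(2)[THEN cyc_darr]] by simp
  have "dComp A X Y Z 0 0 g' f = dComp A X Y Z 0 0 g' b \<oplus>\<^bsub>dHom A X Z 0\<^esub> dComp A X Y Z 0 0 g' f'"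
    using dcomp_add_right[of Y Z 0 g' X 0 b f'] b f g cob_cyc cyc_darr by simp
  then have 2: "hclass A X Z (dComp A X Y Z 0 0 g' f) = hclass A X Z (dComp A X Y Z 0 0 g' f')"
    using hclass_eqI[OF _ cob_comp_right[OF b(1) g(2), simplified]]
      darr_comp[OF f(2)[THEN cyc_darr] g(2)[THEN cyc_darr]] by simp
  from 1 2 show ?thesis by (rule trans)
qed

lemma H0_comp:
  assumes f: "cyc X Y 0 f" and g: "cyc Y Z 0 g"
  shows "Comp (H0 A) X Y Z (hclass A Y Z g) (hclass A X Y f) = hclass A X Z (dComp A X Y Z 0 0 g f)"
proof -
  have "hclosure A X Z {dComp A X Y Z 0 0 g' f' | g' f'. g' \<in> hclass A Y Z g \<and> f' \<in> hclass A X Y f}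
      = hclass A X Z (dComp A X Y Z 0 0 g f)"
  proof (rule hclosure_eq)
    show "{dComp A X Y Z 0 0 g' f' | g' f'. g' \<in> hclass A Y Z g \<and> f' \<in> hclass A X Y f} \<noteq> {}"
      using hclass_self[OF cyc_darr[OF f]] hclass_self[OF cyc_darr[OF g]] by blast
  next
    fix h assume "h \<in> {dComp A X Y Z 0 0 g' f' | g' f'. g' \<in> hclass A Y Z g \<and> f' \<in> hclass A X Y f}"
    then obtain g' f' where h: "h = dComp A X Y Z 0 0 g' f'"
      and g': "g' \<in> hclass A Y Z g" and f': "f' \<in> hclass A X Y f" by blast
    show "hclass A X Z h = hclass A X Z (dComp A X Y Z 0 0 g f)"
      unfolding h by (rule hclass_comp_cong) (use f g hclass_mem[OF f' f] hclass_mem[OF g' g] in auto)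
  qed
  then show ?thesis by (simp add: H0_def)
qed

lemma H0_Obj [simp]: "Obj (H0 A) = dObj A"
  and H0_Idm [simp]: "Idm (H0 A) X = hclass A X X (dIdm A X)"
  by (simp_all add: H0_def)

lemma H0_mor_iff:
  "\<lbrakk>X \<in> dObj A; Y \<in> dObj A\<rbrakk> \<Longrightarrow> c \<in> mor (H0 A) X Y \<longleftrightarrow> (\<exists>f. cyc X Y 0 f \<and> c = hclass A X Y f)"
  by (auto simp: H0_def H0_Hom_def cyc_def)

lemma H0_comp_closed:
  "\<lbrakk>X \<in> dObj A; Y \<in> dObj A; Z \<in> dObj A; c \<in> mor (H0 A) X Y; d \<in> mor (H0 A) Y Z\<rbrakk> \<Longrightarrow>
    Comp (H0 A) X Y Z d c \<in> mor (H0 A) X Z"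
proof -
  assume obj: "X \<in> dObj A" "Y \<in> dObj A" "Z \<in> dObj A"
    and "c \<in> mor (H0 A) X Y" "d \<in> mor (H0 A) Y Z"
  then obtain f g where f: "cyc X Y 0 f" "c = hclass A X Y f" and g: "cyc Y Z 0 g" "d = hclass A Y Z g"
    by (auto simp: H0_mor_iff)
  then show ?thesis using cyc_comp[OF f(1) g(1)] obj by (auto simp: H0_mor_iff H0_comp)
qed

text \<open>The laws of composition in \<open>H0 A\<close> that enter the transport of triangles are
  checked directly on representing cocycles.\<close>

lemma H0_assoc:
  assumes "W \<in> dObj A" "X \<in> dObj A" "Y \<in> dObj A" "Z \<in> dObj A"
    and "c \<in> mor (H0 A) W X" "d \<in> mor (H0 A) X Y" "e \<in> mor (H0 A) Y Z"
  shows "Comp (H0 A) W X Z (Comp (H0 A) X Y Z e d) c = Comp (H0 A) W Y Z e (Comp (H0 A) W X Y d c)"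
proof -
  obtain f g h where c: "cyc W X 0 f" "c = hclass A W X f" and d: "cyc X Y 0 g" "d = hclass A X Y g"
    and e: "cyc Y Z 0 h" "e = hclass A Y Z h"
    using assms by (auto simp: H0_mor_iff)
  have "dComp A W X Z 0 0 (dComp A X Y Z 0 0 h g) f = dComp A W Y Z 0 0 h (dComp A W X Y 0 0 g f)"
    using dComp_assoc[of W X Y Z f 0 g 0 h 0] assms c(1) d(1) e(1) by (simp add: cyc_def cocycles_def)
  then show ?thesis
    using c d e cyc_comp[OF c(1) d(1)] cyc_comp[OF d(1) e(1)] by (simp add: H0_comp)
qed

lemma H0_id_left:
  "\<lbrakk>X \<in> dObj A; Y \<in> dObj A; c \<in> mor (H0 A) X Y\<rbrakk> \<Longrightarrow> Comp (H0 A) X Y Y (Idm (H0 A) Y) c = c"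
  by (auto simp: H0_mor_iff H0_comp cyc_id dIdm_left cyc_darr[unfolded darr_def])

lemma H0_cancel:
  assumes "W \<in> dObj A" "X \<in> dObj A" "Y \<in> dObj A"
    and "c \<in> mor (H0 A) W Y" "d \<in> mor (H0 A) Y X" "e \<in> mor (H0 A) X Y"
    and "Comp (H0 A) Y X Y e d = Idm (H0 A) Y"
  shows "Comp (H0 A) W X Y e (Comp (H0 A) W Y X d c) = c"
  using H0_assoc[of W Y X Y c d e] H0_id_left[of W Y c] assms by simp

end

section \<open>Shifts and standard triangles in the homotopy category\<close>

context pretriangulated_dg_category
begin

lemma dg_shift_spec: "X \<in> dObj A \<Longrightarrow> is_dg_shift A n X (sh_ob A n X) (sh_to A n X) (sh_from A n X)"
proof -
  assume "X \<in> dObj A"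
  then have "\<exists>t. (\<lambda>(Y, \<sigma>, \<rho>). is_dg_shift A n X Y \<sigma> \<rho>) t" using shifts[of X n] by auto
  then have "(\<lambda>(Y, \<sigma>, \<rho>). is_dg_shift A n X Y \<sigma> \<rho>) (dg_shift A n X)"
    unfolding dg_shift_def by (rule someI_ex)
  then show ?thesis by (simp add: sh_ob_def sh_to_def sh_from_def case_prod_beta)
qed

lemma sh_ob_closed [simp]: "X \<in> dObj A \<Longrightarrow> sh_ob A n X \<in> dObj A"
  using dg_shift_spec[of X n] by (simp add: is_dg_shift_def)

lemma sh_to_cyc: "X \<in> dObj A \<Longrightarrow> cyc X (sh_ob A n X) (- n) (sh_to A n X)"
  using dg_shift_spec[of X n] by (simp add: is_dg_shift_def cyc_def)

lemma sh_from_cyc: "X \<in> dObj A \<Longrightarrow> cyc (sh_ob A n X) X n (sh_from A n X)"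
  using dg_shift_spec[of X n] by (simp add: is_dg_shift_def cyc_def)

abbreviation shconj :: "int \<Rightarrow> 'o \<Rightarrow> 'o \<Rightarrow> 'm \<Rightarrow> 'm" where
  "shconj n X Y f \<equiv> dComp A (sh_ob A n X) X (sh_ob A n Y) (- n) n
    (dComp A X Y (sh_ob A n Y) (- n) 0 (sh_to A n Y) f) (sh_from A n X)"

lemma conj_cyc: "cyc X Y 0 f \<Longrightarrow> cyc (sh_ob A n X) (sh_ob A n Y) 0 (shconj n X Y f)"
  using cyc_comp[OF sh_from_cyc[of X n] cyc_comp[OF _ sh_to_cyc[of Y n]], of 0 f] by (simp add: cyc_obj)

lemma conj_cob: "cob X Y 0 f \<Longrightarrow> cob (sh_ob A n X) (sh_ob A n Y) 0 (shconj n X Y f)"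
  using cob_comp_left[OF cob_comp_right[OF _ sh_to_cyc[of Y n]] sh_from_cyc[of X n], of 0 f] by (simp add: cob_def)

lemma conj_hclass_cong:
  assumes f: "cyc X Y 0 f" and g: "cyc X Y 0 g" and eq: "hclass A X Y f = hclass A X Y g"
  shows "hclass A (sh_ob A n X) (sh_ob A n Y) (shconj n X Y f) =
    hclass A (sh_ob A n X) (sh_ob A n Y) (shconj n X Y g)"
proof -
  note obj = cyc_obj[OF f]
  note to = cyc_darr[OF sh_to_cyc[OF obj(2), of n]] and fr = cyc_darr[OF sh_from_cyc[OF obj(1), of n]]
  obtain b where b: "cob X Y 0 b" "f = b \<oplus>\<^bsub>dHom A X Y 0\<^esub> g"
    by (rule hclass_obtain[of f X Y g]) (use hclass_self[OF cyc_darr[OF f]] g eq cyc_darr in auto)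
  note bd = cyc_darr[OF cob_cyc[OF b(1)]]
  have "dComp A X Y (sh_ob A n Y) (- n) 0 (sh_to A n Y) f =
      dComp A X Y (sh_ob A n Y) (- n) 0 (sh_to A n Y) b \<oplus>\<^bsub>dHom A X (sh_ob A n Y) (- n)\<^esub>
      dComp A X Y (sh_ob A n Y) (- n) 0 (sh_to A n Y) g"
    using dcomp_add_right[OF to bd cyc_darr[OF g]] b by simp
  then have "shconj n X Y f = shconj n X Y b \<oplus>\<^bsub>dHom A (sh_ob A n X) (sh_ob A n Y) 0\<^esub> shconj n X Y g"
    using dcomp_add_left[OF fr, of _ "- n"] darr_comp[OF bd to] darr_comp[OF cyc_darr[OF g] to] by simp
  then show ?thesis using hclass_eqI[OF cyc_darr[OF conj_cyc[OF g]] conj_cob[OF b(1)]] by simp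
qed

lemma H0_shift_class:
  assumes f: "cyc X Y 0 f"
  shows "fmor (H0_shift A n) X Y (hclass A X Y f) = hclass A (sh_ob A n X) (sh_ob A n Y) (shconj n X Y f)"
proof -
  have "hclosure A (sh_ob A n X) (sh_ob A n Y) {shconj n X Y g | g. g \<in> hclass A X Y f} =
      hclass A (sh_ob A n X) (sh_ob A n Y) (shconj n X Y f)"
  proof (rule hclosure_eq)
    show "{shconj n X Y g | g. g \<in> hclass A X Y f} \<noteq> {}"
      using hclass_self[OF cyc_darr[OF f]] by blast
  next
    fix h assume "h \<in> {shconj n X Y g | g. g \<in> hclass A X Y f}"
    then obtain g where h: "h = shconj n X Y g" and g: "g \<in> hclass A X Y f" by blast
    show "hclass A (sh_ob A n X) (sh_ob A n Y) h = hclass A (sh_ob A n X) (sh_ob A n Y) (shconj n X Y f)"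
      unfolding h by (rule conj_hclass_cong[OF hclass_mem(1)[OF g f] f hclass_mem(2)[OF g f]])
  qed
  then show ?thesis by (simp add: H0_shift_def)
qed

lemma H0_shift_closed:
  "\<lbrakk>X \<in> dObj A; Y \<in> dObj A; c \<in> mor (H0 A) X Y\<rbrakk> \<Longrightarrow>
    fmor (H0_shift A n) X Y c \<in> mor (H0 A) (sh_ob A n X) (sh_ob A n Y)"
proof -
  assume obj: "X \<in> dObj A" "Y \<in> dObj A" and "c \<in> mor (H0 A) X Y"
  then obtain f where f: "cyc X Y 0 f" "c = hclass A X Y f" by (auto simp: H0_mor_iff)
  then show ?thesis using conj_cyc[OF f(1), of n] obj by (auto simp: H0_mor_iff H0_shift_class)
qed

text \<open>With \<open>\<sigma>\<close> and \<open>\<rho>\<close> the structure morphisms of the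
  chosen shifts, the composite of the shifted representatives is \<open>(\<sigma> f \<rho>)
  (\<sigma> g \<rho>) = \<sigma> (f (\<rho> \<sigma>) g) \<rho>\<close>. The inner
  \<open>\<rho> \<sigma>\<close> is cohomologous to the identity, then so is \<open>f g\<close> by
  assumption, and finally the outer \<open>\<sigma> \<rho>\<close>.\<close>

lemma H0_shift_right_inverse:
  assumes obj: "X \<in> dObj A" "Y \<in> dObj A" and c: "c \<in> mor (H0 A) X Y" and d: "d \<in> mor (H0 A) Y X"
    and cd: "Comp (H0 A) Y X Y c d = Idm (H0 A) Y"
  shows "Comp (H0 A) (sh_ob A n Y) (sh_ob A n X) (sh_ob A n Y)
    (fmor (H0_shift A n) X Y c) (fmor (H0_shift A n) Y X d) = Idm (H0 A) (sh_ob A n Y)"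
proof -
  let ?X = "sh_ob A n X" and ?Y = "sh_ob A n Y"
  obtain f g where f: "cyc X Y 0 f" "c = hclass A X Y f" and g: "cyc Y X 0 g" "d = hclass A Y X g"
    using assms by (auto simp: H0_mor_iff)
  note fd = cyc_darr[OF f(1)] and gd = cyc_darr[OF g(1)]
  note toX = sh_to_cyc[OF obj(1), of n] and toY = sh_to_cyc[OF obj(2), of n]
    and frX = sh_from_cyc[OF obj(1), of n] and frY = sh_from_cyc[OF obj(2), of n]
  let ?w = "dComp A X ?X X n (- n) (sh_from A n X) (sh_to A n X)"
  have w: "cyc X X 0 ?w" using cyc_comp[OF toX frX] by simp
  have w_id: "hclass A X X ?w = hclass A X X (dIdm A X)"
    using dg_shift_spec[OF obj(1), of n] by (simp add: is_dg_shift_def)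
  let ?fw = "dComp A X X Y 0 0 f ?w"
  let ?u = "dComp A Y X Y 0 0 ?fw g"
  have fw: "cyc X Y 0 ?fw" using cyc_comp[OF w f(1)] by simp
  have u: "cyc Y Y 0 ?u" using cyc_comp[OF g(1) fw] by simp
  have fw_f: "hclass A X Y ?fw = hclass A X Y f"
    using hclass_comp_cong[OF w cyc_id[OF obj(1)] w_id f(1) f(1) refl] dIdm_right[of X Y f 0] fd obj
    by (simp add: darr_def)
  have "hclass A Y Y ?u = hclass A Y Y (dComp A Y X Y 0 0 f g)"
    using hclass_comp_cong[OF g(1) g(1) refl fw f(1) fw_f] .
  also have "\<dots> = hclass A Y Y (dIdm A Y)" using cd f g by (simp add: H0_comp)
  finally have u_id: "hclass A Y Y ?u = hclass A Y Y (dIdm A Y)" .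
  have assoc: "dComp A V W Z' (l + m) k (dComp A W Y' Z' l m h' g') f' =
      dComp A V Y' Z' l (m + k) h' (dComp A V W Y' m k g' f')"
    if "darr V W k f'" "darr W Y' m g'" "darr Y' Z' l h'" for V W Y' Z' k l m f' g' h'
    using that dComp_assoc[of V W Y' Z' f' k g' m h' l] by (auto simp: darr_def)
  note toXd = cyc_darr[OF toX] and toYd = cyc_darr[OF toY] and frXd = cyc_darr[OF frX] and frYd = cyc_darr[OF frY]
  let ?tf = "dComp A X Y ?Y (- n) 0 (sh_to A n Y) f"
  let ?tg = "dComp A Y X ?X (- n) 0 (sh_to A n X) g"
  have tf: "darr X ?Y (- n) ?tf" using darr_comp[OF fd toYd] by simp
  have tg: "darr Y ?X (- n) ?tg" using darr_comp[OF gd toXd] by simp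
  have wd: "darr X X 0 ?w" using cyc_darr[OF w] .
  have wg: "darr Y X 0 (dComp A Y X X 0 0 ?w g)" using darr_comp[OF gd wd] by simp
  have "dComp A ?Y ?X ?Y 0 0 (shconj n X Y f) (shconj n Y X g) =
      dComp A ?Y X ?Y (- n) n ?tf (dComp A ?Y ?X X n 0 (sh_from A n X) (shconj n Y X g))"
    using assoc[OF cyc_darr[OF conj_cyc[OF g(1)]] frXd tf] by simp
  also have "dComp A ?Y ?X X n 0 (sh_from A n X) (shconj n Y X g) =
      dComp A ?Y Y X 0 n (dComp A Y ?X X n (- n) (sh_from A n X) ?tg) (sh_from A n Y)"
    using assoc[OF frYd tg frXd] by simp
  also have "dComp A Y ?X X n (- n) (sh_from A n X) ?tg = dComp A Y X X 0 0 ?w g"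
    using assoc[OF gd toXd frXd] by simp
  also have "dComp A ?Y X ?Y (- n) n ?tf (dComp A ?Y Y X 0 n (dComp A Y X X 0 0 ?w g) (sh_from A n Y)) =
      dComp A ?Y Y ?Y (- n) n (dComp A Y X ?Y (- n) 0 ?tf (dComp A Y X X 0 0 ?w g)) (sh_from A n Y)"
    using assoc[OF frYd wg tf] by simp
  also have "dComp A Y X ?Y (- n) 0 ?tf (dComp A Y X X 0 0 ?w g) =
      dComp A Y Y ?Y (- n) 0 (sh_to A n Y) (dComp A Y X Y 0 0 f (dComp A Y X X 0 0 ?w g))"
    using assoc[OF wg fd toYd] by simp
  also have "dComp A Y X Y 0 0 f (dComp A Y X X 0 0 ?w g) = ?u"
    using assoc[OF gd wd fd] by simp
  finally have eq: "dComp A ?Y ?X ?Y 0 0 (shconj n X Y f) (shconj n Y X g) = shconj n Y Y ?u" .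
  have "dComp A Y Y ?Y (- n) 0 (sh_to A n Y) (dIdm A Y) = sh_to A n Y"
    using dIdm_right[of Y ?Y "sh_to A n Y" "- n"] toYd by (simp add: darr_def)
  then have id: "hclass A ?Y ?Y (shconj n Y Y (dIdm A Y)) = hclass A ?Y ?Y (dIdm A ?Y)"
    using dg_shift_spec[OF obj(2), of n] by (simp add: is_dg_shift_def)
  have "Comp (H0 A) ?Y ?X ?Y (fmor (H0_shift A n) X Y c) (fmor (H0_shift A n) Y X d) =
      hclass A ?Y ?Y (shconj n Y Y ?u)"
    using f g eq H0_comp[OF conj_cyc[OF g(1)] conj_cyc[OF f(1)]] by (simp add: H0_shift_class)
  also have "\<dots> = Idm (H0 A) ?Y"
    using conj_hclass_cong[OF u cyc_id[OF obj(2)] u_id] id by simp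
  finally show ?thesis .
qed

lemma standard_triangle_closed:
  assumes c: "is_dg_cone A X Y f Z i s p"
  shows "X \<in> dObj A" "Y \<in> dObj A" "Z \<in> dObj A"
    "hclass A X Y f \<in> mor (H0 A) X Y" "hclass A Y Z i \<in> mor (H0 A) Y Z"
    "hclass A Z (sh_ob A 1 X) (dComp A Z X (sh_ob A 1 X) (- 1) 1 (sh_to A 1 X) p)
      \<in> mor (H0 A) Z (sh_ob A 1 X)"
proof -
  show obj: "X \<in> dObj A" "Y \<in> dObj A" "Z \<in> dObj A" using c by (auto simp: is_dg_cone_def)
  show "hclass A X Y f \<in> mor (H0 A) X Y" "hclass A Y Z i \<in> mor (H0 A) Y Z"
    using c obj by (auto simp: is_dg_cone_def H0_mor_iff cyc_def)
  \<comment> \<open>The second component of the cone differential is minus the differential of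
    \<open>p\<close>; removing the sign shows that \<open>p\<close> is closed.\<close>
  have "p \<in> dmor A Z X 1" and dp: "\<ominus>\<^bsub>dHom A Z X 2\<^esub> Diff A Z X 1 p = \<zero>\<^bsub>dHom A Z X 2\<^esub>"
    using c by (auto simp: is_dg_cone_def cone_cocycles_def cone_Diff_def)
  then have p: "darr Z X 1 p" using obj by (simp add: darr_def)
  interpret H: abelian_group "dHom A Z X 2" using obj by (simp add: dHom_group)
  have "Diff A Z X 1 p \<in> dmor A Z X 2" using darr_Diff[OF p] by (simp add: darr_def)
  then have "Diff A Z X 1 p = \<zero>\<^bsub>dHom A Z X 2\<^esub>"
    using dp H.minus_minus[of "Diff A Z X 1 p"] H.r_neg[of "Diff A Z X 1 p"] by simp
  then have "cyc Z X 1 p" using p by (intro cycI) simp_all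
  from cyc_comp[OF this sh_to_cyc[OF obj(1), of 1]]
  show "hclass A Z (sh_ob A 1 X) (dComp A Z X (sh_ob A 1 X) (- 1) 1 (sh_to A 1 X) p)
      \<in> mor (H0 A) Z (sh_ob A 1 X)"
    using obj by (auto simp: H0_mor_iff)
qed

end

section \<open>From dg cones to exact triangles\<close>

lemma H0_tri_simps [simp]:
  "Obj (H0_tri A) = Obj (H0 A)" "Hom (H0_tri A) = Hom (H0 A)" "Comp (H0_tri A) = Comp (H0 A)"
  "Idm (H0_tri A) = Idm (H0 A)" "Shift (H0_tri A) = H0_shift A 1"
  by (simp_all add: H0_tri_def)

lemma is_iso_H0_tri: "is_iso (H0_tri A) X Y f \<longleftrightarrow> is_iso (H0 A) X Y f"
  by (simp add: is_iso_def)

lemma is_isoE: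
  assumes "is_iso C X Y f"
  obtains g where "f \<in> mor C X Y" "g \<in> mor C Y X" "Comp C X Y X g f = Idm C X" "Comp C Y X Y f g = Idm C Y"
  using assms unfolding is_iso_def by blast

text \<open>The morphisms of the standard triangle are transported along \<open>a\<close>,
  \<open>b\<close>, \<open>c\<close> and lifted by fullness of \<open>E\<close>. The lifted triangle
  is exact because a triangulated equivalence also reflects exactness.\<close>

lemma (in triangulated_category) tri_from_dg_cone:
  assumes B: "pretriangulated_dg_category K B" and E: "triangulated_equivalence K C (H0_tri B) E"
    and cone: "is_dg_cone B X' Y' f' Z' i' s p"
    and obj: "X \<in> Obj C" "Y \<in> Obj C" "Z \<in> Obj C"
    and a: "is_iso (H0 B) (fob E X) X' a" and b: "is_iso (H0 B) (fob E Y) Y' b"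
    and c: "is_iso (H0 B) (fob E Z) Z' c"
  shows "tri X Y Z"
proof -
  interpret B: pretriangulated_dg_category K B by (rule B)
  note [simp] = H0_tri_simps
  define H where "H = H0 B"
  define F where "F = hclass B X' Y' f'"
  define G where "G = hclass B Y' Z' i'"
  define P where "P = hclass B Z' (sh_ob B 1 X') (dComp B Z' X' (sh_ob B 1 X') (- 1) 1 (sh_to B 1 X') p)"
  let ?S = "sh_ob B 1" and ?s = "fmor (H0_shift B 1)"
  let ?X = "fob E X" and ?Y = "fob E Y" and ?Z = "fob E Z"
  note std = B.standard_triangle_closed[OF cone, folded H_def F_def G_def P_def]
  have Eob: "fob E W \<in> dObj B" if "W \<in> Obj C" for W
    using E that by (auto simp: triangulated_equivalence_def equivalence_functor_def linear_functor_def)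
  have full: "\<exists>f\<in>mor C V W. fmor E V W f = k"
    if "V \<in> Obj C" "W \<in> Obj C" "k \<in> mor H (fob E V) (fob E W)" for V W k
  proof -
    have "bij_betw (fmor E V W) (mor C V W) (mor H (fob E V) (fob E W))"
      using E that by (auto simp: triangulated_equivalence_def equivalence_functor_def H_def)
    then have "k \<in> fmor E V W ` mor C V W" using that(3) by (simp add: bij_betw_imp_surj_on)
    then show ?thesis by blast
  qed
  obtain \<phi> where \<phi>: "nat_iso C (H0_tri B) (E \<circ>\<circ> Shift C) (Shift (H0_tri B) \<circ>\<circ> E) \<phi>"
    and refl: "\<And>\<tau>. is_triangle C (Shift C) \<tau> \<Longrightarrow> \<tau> \<in> Tri C \<longleftrightarrow> map_triangle C (H0_tri B) E \<phi> \<tau> \<in> Tri (H0_tri B)"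
    using E unfolding triangulated_equivalence_def by blast
  have S: "fob (H0_shift B 1) W = ?S W" for W by (simp add: H0_shift_def)
  have "is_iso H (fob E (sh X)) (?S ?X) (\<phi> X)"
    using \<phi> obj by (simp add: nat_iso_def fcomp_def is_iso_H0_tri S H_def)
  then obtain \<phi>' where \<phi>': "\<phi> X \<in> mor H (fob E (sh X)) (?S ?X)" "\<phi>' \<in> mor H (?S ?X) (fob E (sh X))"
    "Comp H (?S ?X) (fob E (sh X)) (?S ?X) (\<phi> X) \<phi>' = Idm H (?S ?X)" by (rule is_isoE)
  obtain a' where a': "a \<in> mor H ?X X'" "a' \<in> mor H X' ?X" "Comp H X' ?X X' a a' = Idm H X'"
    using a unfolding H_def by (rule is_isoE)
  obtain b' where b': "b \<in> mor H ?Y Y'" "b' \<in> mor H Y' ?Y" "Comp H Y' ?Y Y' b b' = Idm H Y'"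
    using b unfolding H_def by (rule is_isoE)
  obtain c' where c': "c \<in> mor H ?Z Z'" "c' \<in> mor H Z' ?Z" "Comp H Z' ?Z Z' c c' = Idm H Z'"
    using c unfolding H_def by (rule is_isoE)
  \<comment> \<open>An isomorphism of triangles involves the shift of \<open>a\<close>; a right
    inverse of that shift is what the third square requires.\<close>
  have Sa: "?s ?X X' a \<in> mor H (?S ?X) (?S X')" "?s X' ?X a' \<in> mor H (?S X') (?S ?X)"
    "Comp H (?S X') (?S ?X) (?S X') (?s ?X X' a) (?s X' ?X a') = Idm H (?S X')"
    using a' std(1) Eob[OF obj(1)] B.H0_shift_closed B.H0_shift_right_inverse by (auto simp: H_def)
  note ob = std(1-3) Eob[OF obj(1)] Eob[OF obj(2)] Eob[OF obj(3)] B.sh_ob_closed[OF std(1), of 1]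
    B.sh_ob_closed[OF Eob[OF obj(1)], of 1] Eob[OF Sh.fob_closed[OF obj(1)]]
  note closed = B.H0_comp_closed[folded H_def] and cancel = B.H0_cancel[folded H_def]
  \<comment> \<open>\<open>f1\<close>, \<open>g1\<close> and \<open>h1\<close> solve the three
    squares with the standard triangle. \<open>h2\<close> is \<open>h1\<close> with the comparison
    \<open>\<phi> X\<close> undone, since \<open>map_triangle\<close> composes with
    \<open>\<phi> X\<close> again.\<close>
  define f1 where "f1 = Comp H ?X Y' ?Y b' (Comp H ?X X' Y' F a)"
  define g1 where "g1 = Comp H ?Y Z' ?Z c' (Comp H ?Y Y' Z' G b)"
  define h1 where "h1 = Comp H ?Z (?S X') (?S ?X) (?s X' ?X a') (Comp H ?Z Z' (?S X') P c)"
  define h2 where "h2 = Comp H ?Z (?S ?X) (fob E (sh X)) \<phi>' h1"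
  have Fa: "Comp H ?X X' Y' F a \<in> mor H ?X Y'" using closed[OF ob(4,1,2) a'(1) std(4)] .
  have Gb: "Comp H ?Y Y' Z' G b \<in> mor H ?Y Z'" using closed[OF ob(5,2,3) b'(1) std(5)] .
  have Pc: "Comp H ?Z Z' (?S X') P c \<in> mor H ?Z (?S X')" using closed[OF ob(6,3,7) c'(1) std(6)] .
  have f1: "f1 \<in> mor H ?X ?Y" unfolding f1_def using closed[OF ob(4,2,5) Fa b'(2)] .
  have g1: "g1 \<in> mor H ?Y ?Z" unfolding g1_def using closed[OF ob(5,3,6) Gb c'(2)] .
  have h1: "h1 \<in> mor H ?Z (?S ?X)" unfolding h1_def using closed[OF ob(6,7,8) Pc Sa(2)] .
  have h2: "h2 \<in> mor H ?Z (fob E (sh X))" unfolding h2_def using closed[OF ob(6,8,9) h1 \<phi>'(2)] .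
  have bf: "Comp H ?X ?Y Y' b f1 = Comp H ?X X' Y' F a"
    unfolding f1_def using cancel[OF ob(4,5,2) Fa b'(2,1,3)] .
  have cg: "Comp H ?Y ?Z Z' c g1 = Comp H ?Y Y' Z' G b"
    unfolding g1_def using cancel[OF ob(5,6,3) Gb c'(2,1,3)] .
  have ah: "Comp H ?Z (?S ?X) (?S X') (?s ?X X' a) h1 = Comp H ?Z Z' (?S X') P c"
    unfolding h1_def using cancel[OF ob(6,8,7) Pc Sa(2,1,3)] .
  have \<phi>h: "Comp H ?Z (fob E (sh X)) (?S ?X) (\<phi> X) h2 = h1"
    unfolding h2_def using cancel[OF ob(6,9,8) h1 \<phi>'(2,1,3)] .
  obtain f where f: "f \<in> mor C X Y" "fmor E X Y f = f1" using full obj f1 by blast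
  obtain g where g: "g \<in> mor C Y Z" "fmor E Y Z g = g1" using full obj g1 by blast
  obtain h where h: "h \<in> mor C Z (sh X)" "fmor E Z (sh X) h = h2"
    using full[OF obj(3) Sh.fob_closed[OF obj(1)] h2] by blast
  have map: "map_triangle C (H0_tri B) E \<phi> (X, Y, Z, f, g, h) = (?X, ?Y, ?Z, f1, g1, h1)"
    using \<phi>h by (simp add: map_triangle_def f g h S H_def)
  have "(X', Y', Z', F, G, P) \<in> standard_triangles B"
    using cone unfolding standard_triangles_def F_def G_def P_def by blast
  moreover have "isomorphic_triangles H (H0_shift B 1) (?X, ?Y, ?Z, f1, g1, h1) (X', Y', Z', F, G, P)"
    unfolding isomorphic_triangles_def is_triangle_def prod.case S
  proof (intro conjI exI)
    show "is_iso H ?X X' a" "is_iso H ?Y Y' b" "is_iso H ?Z Z' c" using a b c by (simp_all add: H_def)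
  qed (use bf cg ah f1 g1 h1 std ob in \<open>simp_all add: H_def\<close>)
  ultimately have "(?X, ?Y, ?Z, f1, g1, h1) \<in> Tri (H0_tri B)"
    by (auto simp: H0_tri_def H_def)
  then have "(X, Y, Z, f, g, h) \<in> Tri C"
    using refl[of "(X, Y, Z, f, g, h)"] map f g h obj by (simp add: is_triangle_def)
  then show ?thesis by (auto simp: tri_def)
qed

text \<open>The dg cone is evaluated at \<open>fob E X\<close>. The components at \<open>X\<close>
  of the isomorphisms belonging to the three dg lifts serve as \<open>a\<close>, \<open>b\<close>,
  \<open>c\<close> in \<open>tri_from_dg_cone\<close>.\<close>

lemma (in triangulated_category) functorial_cone_tri:
  assumes enh: "dg_enhancement K C B E" and T: "is_functorial_cone K C B E C B E F G \<alpha> T"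
    and obj: "X \<in> Obj C" "fob F X \<in> Obj C" "fob G X \<in> Obj C" "fob T X \<in> Obj C"
  shows "tri (fob F X) (fob G X) (fob T X)"
proof -
  obtain F' \<theta> G' \<psi> T' \<chi> \<alpha>' s p where
    F': "is_dg_lift K C B E C B E F F' \<theta>" and G': "is_dg_lift K C B E C B E G G' \<psi>"
    and T': "is_dg_lift K C B E C B E T T' \<chi>"
    and cone: "\<And>Y. Y \<in> dObj B \<Longrightarrow> \<exists>i. is_dg_cone B (dfob F' Y) (dfob G' Y) (\<alpha>' Y) (dfob T' Y) i (s Y) (p Y)"
    using T unfolding is_functorial_cone_def by blast
  have B: "pretriangulated_dg_category K B" and E: "triangulated_equivalence K C (H0_tri B) E"
    using enh by (auto simp: dg_enhancement_def)
  have "fob E X \<in> dObj B"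
    using E obj(1) pretriangulated_dg_category.axioms(1)[OF B]
    by (auto simp: triangulated_equivalence_def equivalence_functor_def linear_functor_def H0_tri_simps dg_category.H0_Obj)
  then obtain i where cone: "is_dg_cone B (dfob F' (fob E X)) (dfob G' (fob E X)) (\<alpha>' (fob E X))
      (dfob T' (fob E X)) i (s (fob E X)) (p (fob E X))"
    using cone by blast
  have iso: "is_iso (H0 B) (fob E (fob U X)) (dfob U' (fob E X)) (\<kappa> X)"
    if "is_dg_lift K C B E C B E U U' \<kappa>" for U U' \<kappa>
    using that obj(1) by (simp add: is_dg_lift_def nat_iso_def fcomp_def H0_func_def is_iso_H0_tri)
  show ?thesis
    by (rule tri_from_dg_cone[OF B E cone obj(2-4) iso[OF F'] iso[OF G'] iso[OF T']])
qed

section \<open>Growth rates and entropy\<close>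

definition log_rate :: "(nat \<Rightarrow> real) \<Rightarrow> nat \<Rightarrow> ereal" where
  "log_rate a n = ereal (1 / real n) * ereal_ln (ereal (a n))"

text \<open>The bound is asked for every \<open>n\<close>, so that it can be carried through
  inductions; the constant takes care of the initial terms.\<close>

definition growth :: "(nat \<Rightarrow> real) \<Rightarrow> real \<Rightarrow> bool" where
  "growth a r \<longleftrightarrow> (\<exists>c>0. \<forall>n. a n \<le> c * exp (r * real n))"

lemma log_rate_pos: "0 < a n \<Longrightarrow> log_rate a n = ereal (ln (a n) / real n)"
  by (simp add: log_rate_def ereal_ln_def)

lemma log_rate_nonpos: "\<lbrakk>a n \<le> 0; 0 < n\<rbrakk> \<Longrightarrow> log_rate a n = - \<infinity>"
  by (simp add: log_rate_def ereal_ln_def)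

lemma limit_imp_growth:
  assumes lim: "log_rate a \<longlonglongrightarrow> l" and r: "l < ereal r"
  shows "growth a r"
proof -
  obtain N where N: "\<And>n. n \<ge> N \<Longrightarrow> log_rate a n < ereal r"
    using order_tendstoD(2)[OF lim r] by (auto simp: eventually_sequentially)
  have large: "a n \<le> exp (r * real n)" if "n \<ge> Suc N" for n
  proof (cases "0 < a n")
    case True
    then have "ln (a n) < r * real n"
      using N[of n] that by (simp add: log_rate_pos divide_less_eq)
    then have "exp (ln (a n)) \<le> exp (r * real n)" by simp
    then show ?thesis using True by simp
  next
    case False
    then show ?thesis using exp_ge_zero[of "r * real n"] by linarith
  qed
  \<comment> \<open>The summand 1 covers the indices beyond \<open>N\<close>, and the finite sum
    covers each earlier index separately.\<close>
  define c where "c = 1 + (\<Sum>i\<le>N. \<bar>a i\<bar> * exp (- r * real i))"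
  have c1: "1 \<le> c" by (auto simp: c_def intro!: sum_nonneg)
  have "a n \<le> c * exp (r * real n)" for n
  proof (cases "n \<ge> Suc N")
    case True
    have "1 * exp (r * real n) \<le> c * exp (r * real n)" using c1 by (rule mult_right_mono) simp
    then show ?thesis using large[OF True] by linarith
  next
    case False
    have "\<bar>a n\<bar> * exp (- r * real n) \<le> (\<Sum>i\<le>N. \<bar>a i\<bar> * exp (- r * real i))"
      using False by (intro member_le_sum) auto
    then have "\<bar>a n\<bar> * exp (- r * real n) * exp (r * real n) \<le> c * exp (r * real n)"
      by (intro mult_right_mono) (auto simp: c_def)
    then have "\<bar>a n\<bar> \<le> c * exp (r * real n)" by (simp add: mult.assoc flip: exp_add)
    then show ?thesis by linarith
  qed
  then show ?thesis using c1 unfolding growth_def by (intro exI[of _ c]) auto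
qed

lemma growth_imp_limit_le:
  assumes lim: "log_rate a \<longlonglongrightarrow> l" and "growth a r"
  shows "l \<le> ereal r"
proof -
  obtain c where c: "c > 0" "\<And>n. a n \<le> c * exp (r * real n)"
    using assms(2) by (auto simp: growth_def)
  have le: "log_rate a n \<le> ereal (ln c / real n + r)" if "n \<ge> 1" for n
  proof (cases "0 < a n")
    case True
    then have "ln (a n) \<le> ln (c * exp (r * real n))" using c(2)[of n] c(1) by (simp add: ln_le_cancel_iff)
    also have "\<dots> = ln c + r * real n" using c(1) by (simp add: ln_mult)
    finally show ?thesis using True that by (simp add: log_rate_pos field_simps)
  next
    case False
    then show ?thesis using that by (simp add: log_rate_nonpos)
  qed
  have "(\<lambda>n. ln c / real n + r) \<longlonglongrightarrow> 0 + r"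
    by (intro tendsto_add tendsto_const lim_const_over_n)
  then have "(\<lambda>n. ereal (ln c / real n + r)) \<longlonglongrightarrow> ereal r" by simp
  from LIMSEQ_le[OF lim this] show ?thesis using le by blast
qed

text \<open>Only exponents strictly above \<open>l'\<close> have to be compared. The premise on
  \<open>r\<close> is passed on because it can supply further information, such as positivity of
  \<open>r\<close> when \<open>l'\<close> is nonnegative.\<close>

lemma limit_mono:
  assumes a: "log_rate a \<longlonglongrightarrow> l" and b: "log_rate b \<longlonglongrightarrow> l'"
    and le: "\<And>r. \<lbrakk>l' < ereal r; growth b r\<rbrakk> \<Longrightarrow> growth a r"
  shows "l \<le> l'"
proof (rule ccontr)
  assume "\<not> l \<le> l'"
  then have "l' < l" by simp
  then obtain r where r: "l' < ereal r" "ereal r < l" using ereal_dense2 by blast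
  have "l \<le> ereal r" by (rule growth_imp_limit_le[OF a le[OF r(1) limit_imp_growth[OF b r(1)]]])
  then show False using r(2) by simp
qed

lemma growth_mult:
  assumes "growth b r" "\<And>n. a n \<le> c * b n" "0 \<le> c"
  shows "growth a r"
proof -
  obtain d where d: "d > 0" "\<And>n. b n \<le> d * exp (r * real n)"
    using assms(1) by (auto simp: growth_def)
  \<comment> \<open>Adding 1 keeps the constant positive even for \<open>c = 0\<close>.\<close>
  have "a n \<le> (c * d + 1) * exp (r * real n)" for n
  proof -
    have "a n \<le> c * (d * exp (r * real n))"
      using assms(2)[of n] mult_left_mono[OF d(2)[of n] assms(3)] by linarith
    moreover have "(c * d + 1) * exp (r * real n) = c * (d * exp (r * real n)) + exp (r * real n)"
      by (simp add: algebra_simps)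
    ultimately show ?thesis using exp_gt_zero[of "r * real n"] by linarith
  qed
  then show ?thesis unfolding growth_def using d assms(3)
    by (intro exI[of _ "c * d + 1"]) (auto intro: add_nonneg_pos)
qed

text \<open>Solving the recursion needs \<open>r > 0\<close>; this is where the hypothesis that the entropy of
  \<open>C\<^sub>S[2]\<close> is nonnegative enters.\<close>

lemma growth_recursion:
  assumes b: "growth b r" and r: "0 < r" and c: "0 \<le> c"
    and rec: "\<And>n. a (Suc n) \<le> a n + c * b n"
  shows "growth a r"
proof -
  obtain d where d: "d > 0" "\<And>n. b n \<le> d * exp (r * real n)"
    using b by (auto simp: growth_def)
  \<comment> \<open>\<open>M\<close> dominates the initial value and satisfies
    \<open>c * d \<le> M * (exp r - 1)\<close>, which is exactly the room between
    \<open>M * exp (r * n)\<close> and the next bound.\<close>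
  define M where "M = \<bar>a 0\<bar> + 1 + c * d / (exp r - 1)"
  have e: "exp r - 1 > 0" using r by simp
  have "0 \<le> c * d / (exp r - 1)" using e c d(1) by (intro divide_nonneg_pos mult_nonneg_nonneg) auto
  then have M: "M > 0" "\<bar>a 0\<bar> \<le> M" unfolding M_def by linarith+
  have "c * d / (exp r - 1) \<le> M" by (simp add: M_def)
  then have cd: "c * d \<le> M * (exp r - 1)" using e by (simp add: pos_divide_le_eq)
  have "a n \<le> M * exp (r * real n)" for n
  proof (induction n)
    case 0
    then show ?case using M by simp
  next
    case (Suc n)
    have "c * b n \<le> c * d * exp (r * real n)"
      using mult_left_mono[OF d(2)[of n] c] by (simp add: mult.assoc)
    also have "\<dots> \<le> M * (exp r - 1) * exp (r * real n)" using cd by (intro mult_right_mono) auto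
    finally have "a (Suc n) \<le> M * exp (r * real n) + M * (exp r - 1) * exp (r * real n)"
      using rec[of n] Suc.IH by linarith
    also have "\<dots> = M * exp (r * real (Suc n))" by (simp add: algebra_simps exp_add)
    finally show ?case .
  qed
  then show ?thesis using M(1) unfolding growth_def by blast
qed

text \<open>Fekete's lemma; the infimum may be \<open>-\<infinity>\<close>, hence the extended
  reals. The lower estimate is immediate, and for the upper one \<open>n\<close> is divided with
  remainder by an index \<open>m\<close> whose quotient is close to the infimum.\<close>

lemma fekete:
  fixes u :: "nat \<Rightarrow> real"
  assumes sub: "\<And>m n. u (m + n) \<le> u m + u n"
  shows "(\<lambda>n. ereal (u n / real n)) \<longlonglongrightarrow> (INF n\<in>{1..}. ereal (u n / real n))" (is "_ \<longlonglongrightarrow> ?l")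
proof (rule order_tendstoI)
  fix x assume "x < ?l"
  then have "x < ereal (u n / real n)" if "n \<ge> 1" for n
    using that by (meson INF_lower atLeast_iff less_le_trans)
  then show "\<forall>\<^sub>F n in sequentially. x < ereal (u n / real n)" by (auto intro: eventually_sequentiallyI)
next
  fix y assume "?l < y"
  then obtain m where m: "m \<ge> 1" "ereal (u m / real m) < y" by (auto simp: INF_less_iff)
  then obtain z where z: "ereal (u m / real m) < ereal z" "ereal z < y" using ereal_dense2 by blast
  have multiple: "u (q * m + r) \<le> real q * u m + u r" for q r
  proof (induction q)
    case (Suc q)
    have "u (Suc q * m + r) \<le> u m + u (q * m + r)" using sub[of m "q * m + r"] by (simp add: add.assoc)
    then show ?case using Suc by (simp add: algebra_simps)
  qed simp
  \<comment> \<open>The absolute value of \<open>u m\<close> pays for replacing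
    \<open>n div m\<close> by \<open>n / m\<close>, the sum for the term at \<open>n mod m\<close>;
    both disappear after division by \<open>n\<close>.\<close>
  define M where "M = \<bar>u m\<bar> + (\<Sum>r<m. \<bar>u r\<bar>)"
  have le: "u n / real n \<le> u m / real m + M / real n" if n: "n \<ge> 1" for n
  proof -
    let ?q = "n div m" and ?r = "n mod m"
    have "u ?r \<le> (\<Sum>r<m. \<bar>u r\<bar>)"
      using member_le_sum[of ?r "{..<m}" "\<lambda>r. \<bar>u r\<bar>"] m(1) by force
    moreover have "u n \<le> real ?q * u m + u ?r" using multiple[of ?q ?r] by simp
    moreover have "real ?q * u m \<le> real n * (u m / real m) + \<bar>u m\<bar>"
    proof -
      have n_eq: "real n = real ?q * real m + real ?r"
        by (metis of_nat_add of_nat_mult div_mult_mod_eq)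
      have frac: "\<bar>real ?r / real m\<bar> \<le> 1"
        using m(1) mod_less_divisor[of m n] by (simp add: divide_le_eq)
      have "real ?q * u m = real n * (u m / real m) - (real ?r / real m) * u m"
        using m(1) unfolding n_eq by (simp add: field_simps)
      moreover have "\<bar>(real ?r / real m) * u m\<bar> \<le> \<bar>u m\<bar>"
        using frac by (simp only: abs_mult) (rule mult_left_le_one_le, auto)
      ultimately show ?thesis by linarith
    qed
    ultimately have "u n \<le> real n * (u m / real m) + M" by (simp add: M_def)
    then have "u n / real n \<le> (real n * (u m / real m) + M) / real n" by (rule divide_right_mono) simp
    then show ?thesis using n by (simp add: add_divide_distrib)
  qed
  have "(\<lambda>n. u m / real m + M / real n) \<longlonglongrightarrow> u m / real m + 0"
    by (intro tendsto_add tendsto_const lim_const_over_n)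
  then have "\<forall>\<^sub>F n in sequentially. u m / real m + M / real n < z"
    using z(1) by (intro order_tendstoD(2)[where y = "u m / real m + 0"]) simp_all
  then show "\<forall>\<^sub>F n in sequentially. ereal (u n / real n) < y"
    using eventually_ge_at_top[of 1]
  proof eventually_elim
    case (elim n)
    then have "ereal (u n / real n) < ereal z" using le[of n] by simp
    then show ?case using z(2) by (rule less_trans)
  qed
qed

text \<open>A vanishing term makes all later terms vanish, and then the limit is \<open>-\<infinity>\<close>.\<close>

lemma submultiplicative_limit:
  assumes nonneg: "\<And>n. 0 \<le> a n" and sub: "\<And>m n. a (m + n) \<le> a m * a n"
  obtains l where "log_rate a \<longlonglongrightarrow> l"
proof (cases "\<exists>m. a m = 0")
  case True
  then obtain m where m: "a m = 0" by blast
  have "a n = 0" if "n \<ge> m" for n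
    using sub[of m "n - m"] nonneg[of n] that m by simp
  then have "log_rate a n = - \<infinity>" if "n \<ge> Suc m" for n using that by (simp add: log_rate_nonpos)
  then have "log_rate a \<longlonglongrightarrow> - \<infinity>"
    by (intro tendsto_eventually) (auto intro: eventually_sequentiallyI)
  then show ?thesis using that by simp
next
  case False
  then have pos: "0 < a n" for n using nonneg[of n] by (metis less_eq_real_def)
  define u where "u n = ln (a n)" for n
  have "u (m + n) \<le> u m + u n" for m n
  proof -
    have "u (m + n) \<le> ln (a m * a n)" unfolding u_def using sub pos by (simp add: ln_le_cancel_iff)
    then show ?thesis using pos[of m] pos[of n] by (simp add: u_def ln_mult)
  qed
  from fekete[of u, OF this]
  moreover have "log_rate a = (\<lambda>n. ereal (u n / real n))" using pos by (simp add: fun_eq_iff log_rate_pos u_def)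
  ultimately have "log_rate a \<longlonglongrightarrow> (INF n\<in>{1..}. ereal (u n / real n))" by simp
  then show ?thesis by (rule that)
qed

lemma fpow_add: "fob (fpow F (m + n)) X = fob (fpow F m) (fob (fpow F n) X)"
  by (induction m) (simp_all add: fid_def fcomp_def)

section \<open>Entropy as the limit along the orbit of a generator\<close>

context triangulated_category
begin

text \<open>Stands in for exactness of an endofunctor. It passes to composites and holds for powers
  of the shift, so it applies to \<open>shift_pow C 2 \<circ>\<circ> C\<^sub>S\<close> without
  constructing a comparison isomorphism for the composite.\<close>

definition reach_preserving :: "('o, 'm, 'o, 'm) func \<Rightarrow> bool" where
  "reach_preserving F \<longleftrightarrow> (\<forall>X\<in>Obj C. fob F X \<in> Obj C) \<and>
    (\<forall>E ns X. E \<in> Obj C \<longrightarrow> reach E ns X \<longrightarrow> reach (fob F E) ns (fob F X))"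

lemma reach_preserving_fpow: "reach_preserving F \<Longrightarrow> reach_preserving (fpow F n)"
  by (induction n) (auto simp: reach_preserving_def fid_def fcomp_def)

lemma reach_preserving_closed: "\<lbrakk>reach_preserving F; X \<in> Obj C\<rbrakk> \<Longrightarrow> fob F X \<in> Obj C"
  by (simp add: reach_preserving_def)

lemma reach_preserving_reach:
  "\<lbrakk>reach_preserving F; E \<in> Obj C; reach E ns X\<rbrakk> \<Longrightarrow> reach (fob F E) ns (fob F X)"
  by (simp add: reach_preserving_def)

lemma reach_preserving_reachable:
  "\<lbrakk>reach_preserving F; reachable E X\<rbrakk> \<Longrightarrow> reachable (fob F E) (fob F X)"
  unfolding reachable_def using reach_preserving_reach reach_preserving_closed by metis

lemma reach_preserving_cx:
  "\<lbrakk>reach_preserving F; reachable E X\<rbrakk> \<Longrightarrow> cx t (fob F E) (fob F X) \<le> cx t E X"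
  by (intro cx_mono) (auto simp: reachable_def intro: reach_preserving_reach)

definition orbit_cx :: "('o, 'm, 'o, 'm) func \<Rightarrow> real \<Rightarrow> 'o \<Rightarrow> nat \<Rightarrow> real" where
  "orbit_cx F t G n = cx t G (fob (fpow F n) G)"

text \<open>Orbit complexities are submultiplicative: \<open>fpow F m\<close> maps a tower from
  \<open>G\<close> to the \<open>n\<close>-th iterate to a tower with the same list. Those of two
  generators bound each other up to a constant factor, so they have the same limit.\<close>

lemma entropy_limit:
  assumes F: "reach_preserving F" and G: "split_generator C G"
  shows "log_rate (orbit_cx F t G) \<longlonglongrightarrow> entropy C F t"
proof -
  have GO: "G \<in> Obj C" if "split_generator C G" for G using that by (simp add: split_generator_def)
  note Fn = reach_preserving_fpow[OF F]
  have reach_orbit: "reachable G (fob (fpow F n) H)" if "split_generator C G" "H \<in> Obj C" for G H n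
    using split_generator_reachable[OF that(1)] reach_preserving_closed[OF Fn that(2)] by blast
  have rate: "(\<lambda>n. ereal (1 / real n) * ereal_ln (complexity C t G (fob (fpow F n) G)))
      = log_rate (orbit_cx F t G)" if "split_generator C G" for G
    using complexity_eq_cx[OF reach_orbit[OF that GO[OF that]]]
    by (simp add: fun_eq_iff log_rate_def orbit_cx_def)
  have nonneg: "0 \<le> orbit_cx F t G n" if "split_generator C G" for G n
    unfolding orbit_cx_def by (rule cx_nonneg[OF reach_orbit[OF that GO[OF that]]])
  have sub: "orbit_cx F t G (m + n) \<le> orbit_cx F t G m * orbit_cx F t G n"
    if G: "split_generator C G" for G m n
  proof -
    have r: "reachable (fob (fpow F m) G) (fob (fpow F m) (fob (fpow F n) G))"
      using reach_preserving_reachable[OF Fn reach_orbit[OF G GO[OF G]]] by blast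
    have "orbit_cx F t G (m + n) \<le>
        cx t G (fob (fpow F m) G) * cx t (fob (fpow F m) G) (fob (fpow F m) (fob (fpow F n) G))"
      unfolding orbit_cx_def fpow_add using cx_trans[OF reach_orbit[OF G GO[OF G]] r] .
    also have "\<dots> \<le> orbit_cx F t G m * orbit_cx F t G n"
      unfolding orbit_cx_def
      using reach_preserving_cx[OF Fn reach_orbit[OF G GO[OF G]]] cx_nonneg[OF reach_orbit[OF G GO[OF G]]]
      by (rule mult_left_mono)
    finally show ?thesis .
  qed
  obtain l where l: "log_rate (orbit_cx F t G) \<longlonglongrightarrow> l"
    using submultiplicative_limit[OF nonneg[OF G] sub[OF G]] by blast
  \<comment> \<open>The base changes from \<open>H\<close> to \<open>G\<close> and the argument from
    the iterate of \<open>G\<close> to that of \<open>H\<close>. The second change costs at most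
    \<open>cx t G H\<close>, independently of \<open>n\<close>.\<close>
  have compare: "orbit_cx F t H n \<le> (cx t H G * cx t G H) * orbit_cx F t G n"
    if G: "split_generator C G" and H: "split_generator C H" for G H n
  proof -
    note GH = split_generator_reachable[OF G GO[OF H]] and HG = split_generator_reachable[OF H GO[OF G]]
    note GnG = reach_orbit[OF G GO[OF G], of n]
      and nGH = reach_preserving_reachable[OF Fn GH, of n]
    have "orbit_cx F t H n \<le> cx t H G * cx t G (fob (fpow F n) H)"
      unfolding orbit_cx_def using cx_trans[OF HG reachable_trans[OF GnG nGH]] .
    also have "\<dots> \<le> cx t H G * (orbit_cx F t G n * cx t (fob (fpow F n) G) (fob (fpow F n) H))"
      unfolding orbit_cx_def using cx_trans[OF GnG nGH] cx_nonneg[OF HG] by (rule mult_left_mono)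
    also have "\<dots> \<le> cx t H G * (orbit_cx F t G n * cx t G H)"
      using reach_preserving_cx[OF Fn GH] cx_nonneg[OF HG] cx_nonneg[OF GnG]
      by (intro mult_left_mono) (auto simp: orbit_cx_def)
    finally show ?thesis by (simp add: mult_ac)
  qed
  have all: "log_rate (orbit_cx F t H) \<longlonglongrightarrow> l" if H: "split_generator C H" for H
  proof -
    note rHG = split_generator_reachable[OF H GO[OF G]] and rGH = split_generator_reachable[OF G GO[OF H]]
    have c: "0 \<le> cx t H G * cx t G H" "0 \<le> cx t G H * cx t H G"
      using cx_nonneg[OF rHG] cx_nonneg[OF rGH] by auto
    obtain l' where l': "log_rate (orbit_cx F t H) \<longlonglongrightarrow> l'"
      using submultiplicative_limit[OF nonneg[OF H] sub[OF H]] by blast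
    have "l' \<le> l" by (rule limit_mono[OF l' l]) (rule growth_mult[OF _ compare[OF G H] c(1)])
    moreover have "l \<le> l'" by (rule limit_mono[OF l l']) (rule growth_mult[OF _ compare[OF H G] c(2)])
    ultimately show ?thesis using l' by simp
  qed
  have "entropy C F t = l"
    unfolding entropy_def
  proof (rule the_equality)
    show "\<forall>G. split_generator C G \<longrightarrow>
        (\<lambda>n. ereal (1 / real n) * ereal_ln (complexity C t G (fob (fpow F n) G))) \<longlonglongrightarrow> l"
      using all rate by simp
  next
    fix l' assume "\<forall>G. split_generator C G \<longrightarrow>
        (\<lambda>n. ereal (1 / real n) * ereal_ln (complexity C t G (fob (fpow F n) G))) \<longlonglongrightarrow> l'"
    \<comment> \<open>Uniqueness uses that a split-generator exists; otherwise every value would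
      satisfy the description.\<close>
    then have "log_rate (orbit_cx F t G) \<longlonglongrightarrow> l'" using G rate[OF G] by auto
    then show "l' = l" using l LIMSEQ_unique by blast
  qed
  then show ?thesis using l by simp
qed

end

section \<open>Twist and cotwist\<close>

context triangulated_category
begin

lemma exact_reach_preserving: "exact_functor K C C F \<Longrightarrow> reach_preserving F"
proof -
  assume "exact_functor K C C F"
  then interpret F: exact_functor_between K C C F by unfold_locales
  show ?thesis unfolding reach_preserving_def using F.reach_fob by simp
qed

lemma shift_reach_preserving: "reach_preserving (shift_pow C n)"
  by (simp add: reach_preserving_def reach_shift_base)

lemma reach_preserving_fcomp: "\<lbrakk>reach_preserving F; reach_preserving G\<rbrakk> \<Longrightarrow> reach_preserving (F \<circ>\<circ> G)"
  by (simp add: reach_preserving_def fcomp_def)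

text \<open>A zero object is reached from itself by the empty tower, and substituting empty towers
  into any tower leaves an empty one.\<close>

lemma zero_obj_reachable: "\<lbrakk>is_zero_obj C E; reachable E X\<rbrakk> \<Longrightarrow> is_zero_obj C X"
proof -
  assume E: "is_zero_obj C E" and "reachable E X"
  then obtain ns where ns: "reach E ns X" "E \<in> Obj C" by (auto simp: reachable_def)
  have EE: "reach E [] E" using E by (simp add: reach_Nil_iff)
  have "concat (map (\<lambda>n. map ((+) n) []) ns) = []" for ns :: "int list" by simp
  with reach_trans[OF EE ns(2,1)] have "reach E [] X" by (simp only:)
  then show ?thesis by (simp add: reach_Nil_iff)
qed

text \<open>By faithfulness: the identity of \<open>X\<close> and the zero endomorphism have the
  same image.\<close>

lemma equivalence_reflects_zero_obj:
  assumes F: "equivalence_functor K C C F" and X: "X \<in> Obj C" and Z: "is_zero_obj C (fob F X)"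
  shows "is_zero_obj C X"
proof -
  interpret F: linear_functor_between K C C F
    using F by unfold_locales (simp add: equivalence_functor_def)
  have "inj_on (fmor F X X) (mor C X X)"
    using F X by (auto simp: equivalence_functor_def bij_betw_def)
  moreover have "fmor F X X (Idm C X) = fmor F X X \<zero>\<^bsub>Hom C X X\<^esub>"
    using X Z by (simp add: F.fmor_id F.fmor_zero zero_obj_iff)
  ultimately have "Idm C X = \<zero>\<^bsub>Hom C X X\<^esub>"
    using arr_mor[OF arr_id[OF X]] arr_mor[OF arr_zero[OF X X]] by (rule inj_onD)
  then show ?thesis using X by (simp add: zero_obj_iff)
qed

lemma sp_reflects_zero_obj:
  assumes X: "X \<in> Obj C" and Z: "is_zero_obj C (sp n X)"
  shows "is_zero_obj C X"
proof -
  have "isomorphic C X (sp (- n) (sp n X))" using sp_sp[OF X, of "- n" n] by (simp add: isomorphic_sym)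
  then show ?thesis using retract_zero_obj[OF isomorphic_retract sp_zero_obj[OF Z]] by blast
qed

text \<open>The orbit of \<open>G\<close> stays away from zero objects, so each of its complexities
  is at least 1. A nonzero object is requested because otherwise every complexity is 0 and the
  entropy is \<open>-\<infinity>\<close>.\<close>

lemma entropy_0_nonneg:
  assumes F: "reach_preserving F" and G: "split_generator C G"
    and refl: "\<And>X. \<lbrakk>X \<in> Obj C; is_zero_obj C (fob F X)\<rbrakk> \<Longrightarrow> is_zero_obj C X"
    and X: "X \<in> Obj C" "\<not> is_zero_obj C X"
  shows "0 \<le> entropy C F 0"
proof -
  have GO: "G \<in> Obj C" using G by (simp add: split_generator_def)
  have nz: "\<not> is_zero_obj C (fob (fpow F n) G)" for n
  proof (induction n)
    case 0
    show ?case using zero_obj_reachable[OF _ split_generator_reachable[OF G X(1)]] X(2) by (auto simp: fid_def)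
  next
    case (Suc n)
    then show ?case
      using refl[OF reach_preserving_closed[OF reach_preserving_fpow[OF F] GO, of n]] by (auto simp: fcomp_def)
  qed
  \<comment> \<open>This includes \<open>n = 0\<close>, where division by zero makes the rate
    0.\<close>
  have "0 \<le> log_rate (orbit_cx F 0 G) n" for n
  proof -
    have "1 \<le> orbit_cx F 0 G n"
      unfolding orbit_cx_def
      by (rule cx_0_ge_1[OF split_generator_reachable[OF G reach_preserving_closed[OF reach_preserving_fpow[OF F] GO]] nz])
    then show ?thesis by (simp add: log_rate_pos)
  qed
  then show ?thesis
    using LIMSEQ_le_const[OF entropy_limit[OF F G, of 0], of 0] by blast
qed

end

section \<open>Comparison of the entropies of twist and cotwist\<close>

theorem corollary1p8:
  fixes K :: "'k ring"
    and C :: "('k, 'o, 'm) tri_cat" and D :: "('k, 'p, 'n) tri_cat"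
    and A :: "('k, 'a, 'b) dg_cat" and B :: "('k, 'c, 'd) dg_cat"
    and E\<^sub>C :: "('o, 'm, 'a, 'b set) func" and E\<^sub>D :: "('p, 'n, 'c, 'd set) func"
    and S :: "('o, 'm, 'p, 'n) func" and R L :: "('p, 'n, 'o, 'm) func"
    and \<eta> :: "'o \<Rightarrow> 'm" and \<epsilon> :: "'p \<Rightarrow> 'n"
    and T\<^sub>S :: "('p, 'n, 'p, 'n) func" and C\<^sub>S :: "('o, 'm, 'o, 'm) func"
  assumes "triangulated_category K C" and "triangulated_category K D"
    and "dg_enhancement K C A E\<^sub>C" and "dg_enhancement K D B E\<^sub>D"
    and "spherical_functor K C A E\<^sub>C D B E\<^sub>D S R L \<eta> \<epsilon> T\<^sub>S C\<^sub>S"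
    and "\<exists>Y\<in>Obj D. \<exists>G. isomorphic C (fob R Y) G \<and> split_generator C G"
    and "\<exists>G. split_generator D G"
  shows "(\<forall>t. 0 \<le> entropy C (shift_pow C 2 \<circ>\<circ> C\<^sub>S) t \<longrightarrow>
            entropy D T\<^sub>S t = entropy C (shift_pow C 2 \<circ>\<circ> C\<^sub>S) t) \<and>
         ((\<exists>X\<in>Obj C. \<not> is_zero_obj C X) \<longrightarrow>
            entropy D T\<^sub>S 0 = entropy C (shift_pow C 2 \<circ>\<circ> C\<^sub>S) 0)"
proof -
  interpret C: triangulated_category K C by (rule assms(1))
  interpret D: triangulated_category K D by (rule assms(2))
  note sph = assms(5)[unfolded spherical_functor_def]
  interpret S: exact_functor_between K C D S using sph by unfold_locales blast
  interpret R: exact_functor_between K D C R using sph by unfold_locales blast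
  interpret L: exact_functor_between K D C L using sph by unfold_locales blast
  interpret T: exact_functor_between K D D T\<^sub>S
    using sph by unfold_locales (simp add: exact_autoequivalence_def)
  interpret Q: exact_functor_between K C C C\<^sub>S
    using sph by unfold_locales (simp add: exact_autoequivalence_def)
  define P where "P = shift_pow C 2 \<circ>\<circ> C\<^sub>S"
  have T: "D.reach_preserving T\<^sub>S" by (rule D.exact_reach_preserving[OF T.exact])
  have P: "C.reach_preserving P"
    unfolding P_def
    by (intro C.reach_preserving_fcomp C.shift_reach_preserving C.exact_reach_preserving Q.exact)
  note Tn = D.reach_preserving_fpow[OF T] and Pn = C.reach_preserving_fpow[OF P]
  have P_closed: "fob P X \<in> Obj C" if "X \<in> Obj C" for X
    using C.reach_preserving_closed[OF P that] .
  have P_iso: "isomorphic C (fob P X) (fob P Y)" if "isomorphic C X Y" for X Y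
    using that by (simp add: P_def fcomp_def C.sp_isomorphic Q.fob_isomorphic)

  \<comment> \<open>Condition (3) at \<open>X\<close> gives
    \<open>L T\<^sub>S X \<cong> R X[1]\<close>, and condition (4) at \<open>T\<^sub>S X\<close>
    gives \<open>R T\<^sub>S X \<cong> C\<^sub>S (L T\<^sub>S X)[1]\<close>. After substitution the
    two shifts add up to the one in \<open>P\<close>.\<close>
  have RT: "isomorphic C (fob R (fob T\<^sub>S X)) (fob P (fob R X))" if X: "X \<in> Obj D" for X
  proof -
    have R_LT: "isomorphic C (fob R X) (C.sp (- 1) (fob L (fob T\<^sub>S X)))"
      using nat_isomorphic_obj[of D C R "shift_pow C (- 1) \<circ>\<circ> L \<circ>\<circ> T\<^sub>S" X] sph X
      by (simp add: fcomp_def)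
    have R_QL: "isomorphic C (fob R (fob T\<^sub>S X)) (C.sp 1 (fob C\<^sub>S (fob L (fob T\<^sub>S X))))"
      using nat_isomorphic_obj[of D C R "shift_pow C 1 \<circ>\<circ> C\<^sub>S \<circ>\<circ> L" "fob T\<^sub>S X"] sph X
      by (simp add: fcomp_def)
    have "isomorphic C (C.sp 1 (fob R X)) (C.sp 1 (C.sp (- 1) (fob L (fob T\<^sub>S X))))"
      by (rule C.sp_isomorphic[OF R_LT])
    also have "isomorphic C \<dots> (fob L (fob T\<^sub>S X))"
      using C.sp_sp[of "fob L (fob T\<^sub>S X)" 1 "- 1"] X by simp
    finally have "isomorphic C (fob L (fob T\<^sub>S X)) (C.sp 1 (fob R X))" by (rule C.isomorphic_sym)
    then have "isomorphic C (fob C\<^sub>S (fob L (fob T\<^sub>S X))) (fob C\<^sub>S (C.sp 1 (fob R X)))"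
      by (rule Q.fob_isomorphic)
    also have "isomorphic C \<dots> (C.sp 1 (fob C\<^sub>S (fob R X)))" using X by (simp add: Q.fob_sp)
    finally have "isomorphic C (C.sp 1 (fob C\<^sub>S (fob L (fob T\<^sub>S X)))) (C.sp 1 (C.sp 1 (fob C\<^sub>S (fob R X))))"
      by (rule C.sp_isomorphic)
    also have "isomorphic C \<dots> (fob P (fob R X))"
      using C.sp_sp[of "fob C\<^sub>S (fob R X)" 1 1] X by (simp add: P_def fcomp_def)
    finally show ?thesis by (rule C.isomorphic_trans[OF R_QL])
  qed
  have RTn: "isomorphic C (fob R (fob (fpow T\<^sub>S n) X)) (fob (fpow P n) (fob R X))" if X: "X \<in> Obj D" for n X
  proof (induction n)
    case 0
    then show ?case using X by (simp add: fid_def)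
  next
    case (Suc n)
    have "isomorphic C (fob R (fob T\<^sub>S (fob (fpow T\<^sub>S n) X))) (fob P (fob R (fob (fpow T\<^sub>S n) X)))"
      using X by (intro RT D.reach_preserving_closed[OF Tn])
    from C.isomorphic_trans[OF this P_iso[OF Suc]] show ?case by (simp add: fcomp_def)
  qed

  obtain Y G\<^sub>0 where Y: "Y \<in> Obj D" "isomorphic C (fob R Y) G\<^sub>0" and G\<^sub>0: "split_generator C G\<^sub>0"
    using assms(6) by blast
  obtain G where G: "split_generator D G" using assms(7) by blast
  have GO: "G \<in> Obj D" and G0O: "G\<^sub>0 \<in> Obj C" using G G\<^sub>0 by (simp_all add: split_generator_def)
  let ?RG = "fob R G"
  have RGO: "?RG \<in> Obj C" using GO by simp
  have G0_RG: "C.reachable G\<^sub>0 ?RG" by (rule C.split_generator_reachable[OF G\<^sub>0 RGO])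
  \<comment> \<open>\<open>G\<close> reaches \<open>Y\<close> in \<open>D\<close>, so
    \<open>R G\<close> reaches \<open>R Y\<close>, which is isomorphic to \<open>G\<^sub>0\<close>.
    Thus \<open>G\<^sub>0\<close> and \<open>R G\<close> reach each other, although they stem from
    generators of different categories.\<close>
  have RG_G0: "C.reachable ?RG G\<^sub>0"
    using C.reachable_isomorphic[OF R.reachable_fob[OF D.split_generator_reachable[OF G Y(1)]]
      C.isomorphic_refl[OF RGO] Y(2)] .
  have G0_Pn: "C.reachable G\<^sub>0 (fob (fpow P n) X)" if "X \<in> Obj C" for n X
    using C.split_generator_reachable[OF G\<^sub>0 C.reach_preserving_closed[OF Pn that]] .
  have G_Tn: "D.reachable G (fob (fpow T\<^sub>S n) X)" if "X \<in> Obj D" for n X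
    using D.split_generator_reachable[OF G D.reach_preserving_closed[OF Tn that]] .

  \<comment> \<open>The path runs from \<open>G\<^sub>0\<close> through \<open>R G\<close> and
    \<open>P^n R G\<close> to \<open>P^n G\<^sub>0\<close>. Its middle leg is, up to isomorphism,
    the image under \<open>R\<close> of the path from \<open>G\<close> to
    \<open>T\<^sub>S^n G\<close>; the outer legs cost constants independent of
    \<open>n\<close>.\<close>
  have upper: "C.orbit_cx P t G\<^sub>0 n \<le> (C.cx t G\<^sub>0 ?RG * C.cx t ?RG G\<^sub>0) * D.orbit_cx T\<^sub>S t G n" for t n
  proof -
    note r1 = R.reachable_fob[OF G_Tn[OF GO, of n]]
    note r2 = C.reachable_isomorphic[OF r1 C.isomorphic_refl[OF RGO] RTn[OF GO]]
    note r3 = C.reach_preserving_reachable[OF Pn RG_G0, of n]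
    have le: "C.cx t ?RG (fob (fpow P n) ?RG) \<le> D.orbit_cx T\<^sub>S t G n"
      using R.cx_fob[OF G_Tn[OF GO, of n], of t] C.cx_isomorphic[OF r1 C.isomorphic_refl[OF RGO] RTn[OF GO]]
      by (simp add: D.orbit_cx_def)
    have "C.orbit_cx P t G\<^sub>0 n \<le> C.cx t G\<^sub>0 ?RG * C.cx t ?RG (fob (fpow P n) G\<^sub>0)"
      unfolding C.orbit_cx_def by (rule C.cx_trans[OF G0_RG C.reachable_trans[OF r2 r3]])
    also have "\<dots> \<le> C.cx t G\<^sub>0 ?RG * (C.cx t ?RG (fob (fpow P n) ?RG) * C.cx t (fob (fpow P n) ?RG) (fob (fpow P n) G\<^sub>0))"
      by (rule mult_left_mono[OF C.cx_trans[OF r2 r3] C.cx_nonneg[OF G0_RG]])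
    also have "\<dots> \<le> C.cx t G\<^sub>0 ?RG * (D.orbit_cx T\<^sub>S t G n * C.cx t ?RG G\<^sub>0)"
      using le C.reach_preserving_cx[OF Pn RG_G0] C.cx_nonneg[OF r2] C.cx_nonneg[OF r3] C.cx_nonneg[OF G0_RG]
      by (intro mult_left_mono mult_mono) (auto intro: order_trans)
    finally show ?thesis by (simp add: mult_ac)
  qed
  have ge: "entropy C P t \<le> entropy D T\<^sub>S t" for t
  proof (rule limit_mono[OF C.entropy_limit[OF P G\<^sub>0] D.entropy_limit[OF T G]])
    fix r assume "growth (D.orbit_cx T\<^sub>S t G) r"
    then show "growth (C.orbit_cx P t G\<^sub>0) r"
      by (rule growth_mult[OF _ upper]) (simp add: C.cx_nonneg[OF G0_RG] C.cx_nonneg[OF RG_G0])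
  qed

  \<comment> \<open>\<open>exp t\<close> is the cost of the shift in the rotated twist triangle. The
    other factors are the cost of passing from \<open>G\<close> to \<open>S G\<^sub>0\<close> and of
    exchanging \<open>G\<^sub>0\<close> for \<open>R G\<close> under \<open>S P^n\<close>.\<close>
  let ?c = "\<lambda>t. exp t * (D.cx t G (fob S G\<^sub>0) * C.cx t G\<^sub>0 ?RG)"
  have SG0: "D.reachable G (fob S G\<^sub>0)" by (rule D.split_generator_reachable[OF G]) (simp add: G0O)
  have lower: "D.orbit_cx T\<^sub>S t G (Suc n) \<le> D.orbit_cx T\<^sub>S t G n + ?c t * C.orbit_cx P t G\<^sub>0 n" for t n
  proof -
    let ?X = "fob (fpow T\<^sub>S n) G"
    let ?V = "fob S (fob R ?X)"
    have X: "?X \<in> Obj D" using D.reach_preserving_closed[OF Tn GO] .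
    have V: "?V \<in> Obj D" using X by simp
    have "is_functorial_cone K D B E\<^sub>D D B E\<^sub>D (S \<circ>\<circ> R) fid \<epsilon> T\<^sub>S" using sph by (simp add: is_twist_def)
    from D.functorial_cone_tri[OF assms(4) this X] X have "D.tri ?V ?X (fob T\<^sub>S ?X)"
      by (simp add: fcomp_def fid_def)
    \<comment> \<open>Rotation moves \<open>T\<^sub>S ?X\<close> from the third to the middle
      position, where it is an extension of the shift of \<open>?V\<close> by \<open>?X\<close> and
      subadditivity applies.\<close>
    then have tri: "D.tri ?X (fob (fpow T\<^sub>S (Suc n)) G) (D.sp 1 ?V)"
      using D.tri_rotate D.sp_up[of 0 ?V] by (simp add: fcomp_def)
    have GV: "D.reachable G ?V" by (rule D.split_generator_reachable[OF G V])
    note r1 = S.reachable_fob[OF G0_Pn[OF G0O, of n]]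
      and r2 = S.reachable_fob[OF C.reach_preserving_reachable[OF Pn G0_RG, of n]]
    have iso: "isomorphic D (fob S (fob (fpow P n) ?RG)) ?V"
      using S.fob_isomorphic[OF C.isomorphic_sym[OF RTn[OF GO]]] .
    have GPn: "D.reachable G (fob S (fob (fpow P n) ?RG))"
      using D.reachable_trans[OF SG0 D.reachable_trans[OF r1 r2]] .
    have "D.cx t G ?V = D.cx t G (fob S (fob (fpow P n) ?RG))"
      by (rule D.cx_isomorphic[OF GPn D.isomorphic_refl[OF GO] iso])
    also have "\<dots> \<le> D.cx t G (fob S G\<^sub>0) * D.cx t (fob S G\<^sub>0) (fob S (fob (fpow P n) ?RG))"
      by (rule D.cx_trans[OF SG0 D.reachable_trans[OF r1 r2]])
    also have "\<dots> \<le> D.cx t G (fob S G\<^sub>0) * (D.cx t (fob S G\<^sub>0) (fob S (fob (fpow P n) G\<^sub>0)) *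
        D.cx t (fob S (fob (fpow P n) G\<^sub>0)) (fob S (fob (fpow P n) ?RG)))"
      by (rule mult_left_mono[OF D.cx_trans[OF r1 r2] D.cx_nonneg[OF SG0]])
    also have "\<dots> \<le> D.cx t G (fob S G\<^sub>0) * (C.orbit_cx P t G\<^sub>0 n * C.cx t G\<^sub>0 ?RG)"
    proof (intro mult_left_mono mult_mono)
      show "D.cx t (fob S G\<^sub>0) (fob S (fob (fpow P n) G\<^sub>0)) \<le> C.orbit_cx P t G\<^sub>0 n"
        unfolding C.orbit_cx_def by (rule S.cx_fob[OF G0_Pn[OF G0O]])
      show "D.cx t (fob S (fob (fpow P n) G\<^sub>0)) (fob S (fob (fpow P n) ?RG)) \<le> C.cx t G\<^sub>0 ?RG"
        using S.cx_fob[OF C.reach_preserving_reachable[OF Pn G0_RG, of n], of t] C.reach_preserving_cx[OF Pn G0_RG, of t n]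
        by linarith
      show "0 \<le> C.orbit_cx P t G\<^sub>0 n"
        unfolding C.orbit_cx_def by (rule C.cx_nonneg[OF G0_Pn[OF G0O]])
    qed (use D.cx_nonneg[OF r2] D.cx_nonneg[OF SG0] in auto)
    finally have "exp (real_of_int 1 * t) * D.cx t G ?V \<le> ?c t * C.orbit_cx P t G\<^sub>0 n"
      by (simp add: mult_ac)
    moreover have "D.cx t G (D.sp 1 ?V) \<le> exp (real_of_int 1 * t) * D.cx t G ?V"
      by (rule D.cx_shift[OF GV])
    moreover have "D.orbit_cx T\<^sub>S t G (Suc n) \<le> D.orbit_cx T\<^sub>S t G n + D.cx t G (D.sp 1 ?V)"
      unfolding D.orbit_cx_def by (rule D.cx_extension[OF G_Tn[OF GO] D.reachable_shift[OF GV] tri])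
    ultimately show ?thesis by linarith
  qed
  have le: "entropy D T\<^sub>S t \<le> entropy C P t" if nonneg: "0 \<le> entropy C P t" for t
  proof (rule limit_mono[OF D.entropy_limit[OF T G] C.entropy_limit[OF P G\<^sub>0]])
    fix r assume less: "entropy C P t < ereal r" and b: "growth (C.orbit_cx P t G\<^sub>0) r"
    have "0 < ereal r" using nonneg less by (rule le_less_trans)
    then have r: "0 < r" by simp
    have "0 \<le> ?c t" using D.cx_nonneg[OF SG0] C.cx_nonneg[OF G0_RG] by simp
    from growth_recursion[OF b r this lower] show "growth (D.orbit_cx T\<^sub>S t G) r" .
  qed
  \<comment> \<open>\<open>P\<close> reflects zero objects, because the shift is invertible up to
    isomorphism and \<open>C\<^sub>S\<close> is faithful.\<close>
  have nonneg_0: "0 \<le> entropy C P 0" if "X \<in> Obj C" "\<not> is_zero_obj C X" for X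
  proof (rule C.entropy_0_nonneg[OF P G\<^sub>0 _ that])
    fix Z assume Z: "Z \<in> Obj C" and PZ: "is_zero_obj C (fob P Z)"
    have "is_zero_obj C (C.sp 2 (fob C\<^sub>S Z))" using PZ by (simp add: P_def fcomp_def)
    from C.sp_reflects_zero_obj[OF Q.fob_closed[OF Z] this] have "is_zero_obj C (fob C\<^sub>S Z)" .
    moreover have "equivalence_functor K C C C\<^sub>S" using sph unfolding exact_autoequivalence_def by blast
    ultimately show "is_zero_obj C Z" using Z C.equivalence_reflects_zero_obj by blast
  qed
  show ?thesis
    unfolding P_def[symmetric]
  proof (intro conjI allI impI)
    fix t assume "0 \<le> entropy C P t"
    then show "entropy D T\<^sub>S t = entropy C P t" by (intro antisym le ge)
  next
    assume "\<exists>X\<in>Obj C. \<not> is_zero_obj C X"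
    then show "entropy D T\<^sub>S 0 = entropy C P 0" using nonneg_0 by (blast intro: antisym le ge)
  qed
qed

end
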